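(* Let $a,b$ be real constants, at least one of which does not vanish, and let $h=h(p)$ be any solution of the equation $$h^2h''''=ap+b.$$ Then the metrics $$g_F=2\rho^2\Big[(dp-h\,dx)\,dx-(dy-p\,dx)\Big(\tfrac23 i\,d\phi+\tfrac23h'\,dx+\tfrac16h''(dy-p\,dx)\Big)\Big]$$ (with $\rho\neq 0$ an arbitrary function) form a split signature conformal class of metrics that satisfy the Bach equations, are of type $N\times N'$, and are not conformal to Einstein metrics.
   Context: All considerations are local and concern nonsingular points. The metrics live on the 4-dimensional space with coordinates $(x,y,p,\phi)$; $i$ is a fixed nonzero REAL constant; primes on $h$ denote derivatives with respect to $p$; products of 1-forms are symmetrized tensor products. A metric satisfies the Bach equations if its Bach tensor vanishes. Type $N\times N'$ means that both the self-dual and the anti-self-dual parts of the Weyl tensor are nonzero and of Petrov type N.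
   Formalization: Type N×N' is asserted only at points where ap+b ≠ 0; where ap+b = 0 one has h''''=0 and the Weyl tensor vanishes, so the type claim fails there. All other claims hold at every point. *)

theory Defs
  imports "HOL-Analysis.Analysis"
begin

section \<open>Calculus in a coordinate chart\<close>

text \<open>The chart is \<open>real^4\<close>; a point \<open>v\<close> has coordinates
  \<open>v$1 = x\<close>, \<open>v$2 = y\<close>, \<open>v$3 = p\<close>, \<open>v$4 = \<phi>\<close>. Tensor fields are given by their components in
  these coordinates, all indices down unless stated otherwise.\<close>

definition pd :: "4 \<Rightarrow> (real^4 \<Rightarrow> real) \<Rightarrow> real^4 \<Rightarrow> real" where
  "pd k f v = deriv (\<lambda>t. f (v + t *\<^sub>R axis k 1)) 0"

text \<open>\<open>C\<^sup>\<infinity>\<close> on an open set: all iterated partial derivatives exist and are (totally)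
  differentiable.\<close>

definition smooth_fun_on :: "(real^4) set \<Rightarrow> (real^4 \<Rightarrow> real) \<Rightarrow> bool" where
  "smooth_fun_on U f \<longleftrightarrow> (\<forall>ks. foldr pd ks f differentiable_on U)"


section \<open>Metrics, conformal classes\<close>

text \<open>Signature \<open>(+,+,-,-)\<close>, in the sense of Sylvester's law of inertia.\<close>

definition split_signature :: "real^4^4 \<Rightarrow> bool" where
  "split_signature G \<longleftrightarrow> transpose G = G \<and>
     (\<exists>P :: real^4^4. invertible P \<and>
        transpose P ** G ** P
          = (\<chi> a b. if a = b then (if a = 1 \<or> a = 2 then 1 else - 1) else 0))"

definition split_metric_on :: "(real^4) set \<Rightarrow> (real^4 \<Rightarrow> real^4^4) \<Rightarrow> bool" where
  "split_metric_on U g \<longleftrightarrow>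
     (\<forall>a b. smooth_fun_on U (\<lambda>v. g v $ a $ b)) \<and> (\<forall>v\<in>U. split_signature (g v))"

definition conformal_on ::
    "(real^4) set \<Rightarrow> (real^4 \<Rightarrow> real^4^4) \<Rightarrow> (real^4 \<Rightarrow> real^4^4) \<Rightarrow> bool" where
  "conformal_on U g g' \<longleftrightarrow>
     (\<exists>\<Omega>. smooth_fun_on U \<Omega> \<and> (\<forall>v\<in>U. \<Omega> v \<noteq> 0) \<and> (\<forall>v\<in>U. g' v = (\<Omega> v)\<^sup>2 *\<^sub>R g v))"


section \<open>Curvature\<close>

definition ginv :: "(real^4 \<Rightarrow> real^4^4) \<Rightarrow> real^4 \<Rightarrow> 4 \<Rightarrow> 4 \<Rightarrow> real" where
  "ginv g v a b = matrix_inv (g v) $ a $ b"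

text \<open>\<open>christoffel g v k a b\<close> is \<open>\<Gamma>\<^sup>k\<^sub>a\<^sub>b\<close>.\<close>

definition christoffel :: "(real^4 \<Rightarrow> real^4^4) \<Rightarrow> real^4 \<Rightarrow> 4 \<Rightarrow> 4 \<Rightarrow> 4 \<Rightarrow> real" where
  "christoffel g v k a b =
     (\<Sum>l\<in>UNIV. ginv g v k l *
        (pd a (\<lambda>u. g u $ b $ l) v + pd b (\<lambda>u. g u $ a $ l) v - pd l (\<lambda>u. g u $ a $ b) v)) / 2"

text \<open>\<open>riemann_up g v a b c d\<close> is \<open>R\<^sup>a\<^sub>b\<^sub>c\<^sub>d\<close>, with the convention
  \<open>(\<nabla>\<^sub>c\<nabla>\<^sub>d - \<nabla>\<^sub>d\<nabla>\<^sub>c) X\<^sup>a = R\<^sup>a\<^sub>b\<^sub>c\<^sub>d X\<^sup>b\<close>.\<close>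

definition riemann_up :: "(real^4 \<Rightarrow> real^4^4) \<Rightarrow> real^4 \<Rightarrow> 4 \<Rightarrow> 4 \<Rightarrow> 4 \<Rightarrow> 4 \<Rightarrow> real" where
  "riemann_up g v a b c d =
     pd c (\<lambda>u. christoffel g u a d b) v - pd d (\<lambda>u. christoffel g u a c b) v
     + (\<Sum>e\<in>UNIV. christoffel g v a c e * christoffel g v e d b
                 - christoffel g v a d e * christoffel g v e c b)"

definition riemann :: "(real^4 \<Rightarrow> real^4^4) \<Rightarrow> real^4 \<Rightarrow> 4 \<Rightarrow> 4 \<Rightarrow> 4 \<Rightarrow> 4 \<Rightarrow> real" where
  "riemann g v a b c d = (\<Sum>e\<in>UNIV. g v $ a $ e * riemann_up g v e b c d)"

definition ricci :: "(real^4 \<Rightarrow> real^4^4) \<Rightarrow> real^4 \<Rightarrow> 4 \<Rightarrow> 4 \<Rightarrow> real" where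
  "ricci g v a b = (\<Sum>c\<in>UNIV. riemann_up g v c a c b)"

definition scalar_curv :: "(real^4 \<Rightarrow> real^4^4) \<Rightarrow> real^4 \<Rightarrow> real" where
  "scalar_curv g v = (\<Sum>a\<in>UNIV. \<Sum>b\<in>UNIV. ginv g v a b * ricci g v a b)"

text \<open>The Schouten tensor \<open>(Ric - R g / (2(n-1))) / (n-2)\<close> and the Weyl tensor, for \<open>n = 4\<close>.\<close>

definition schouten :: "(real^4 \<Rightarrow> real^4^4) \<Rightarrow> real^4 \<Rightarrow> 4 \<Rightarrow> 4 \<Rightarrow> real" where
  "schouten g v a b = (ricci g v a b - scalar_curv g v / 6 * g v $ a $ b) / 2"

definition weyl :: "(real^4 \<Rightarrow> real^4^4) \<Rightarrow> real^4 \<Rightarrow> 4 \<Rightarrow> 4 \<Rightarrow> 4 \<Rightarrow> 4 \<Rightarrow> real" where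
  "weyl g v a b c d = riemann g v a b c d
     - (g v $ a $ c * schouten g v b d - g v $ a $ d * schouten g v b c
        - g v $ b $ c * schouten g v a d + g v $ b $ d * schouten g v a c)"

text \<open>Levi-Civita derivative of covariant tensor fields of rank 3 and 4; the first index after the
  point is the index of differentiation, e.g. \<open>nabla3 g T v e a b c\<close> is \<open>\<nabla>\<^sub>e T\<^sub>a\<^sub>b\<^sub>c\<close>.\<close>

definition nabla3 :: "(real^4 \<Rightarrow> real^4^4) \<Rightarrow> (real^4 \<Rightarrow> 4 \<Rightarrow> 4 \<Rightarrow> 4 \<Rightarrow> real)
    \<Rightarrow> real^4 \<Rightarrow> 4 \<Rightarrow> 4 \<Rightarrow> 4 \<Rightarrow> 4 \<Rightarrow> real" where
  "nabla3 g T v e a b c = pd e (\<lambda>u. T u a b c) v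
     - (\<Sum>m\<in>UNIV. christoffel g v m e a * T v m b c
                 + christoffel g v m e b * T v a m c
                 + christoffel g v m e c * T v a b m)"

definition nabla4 :: "(real^4 \<Rightarrow> real^4^4) \<Rightarrow> (real^4 \<Rightarrow> 4 \<Rightarrow> 4 \<Rightarrow> 4 \<Rightarrow> 4 \<Rightarrow> real)
    \<Rightarrow> real^4 \<Rightarrow> 4 \<Rightarrow> 4 \<Rightarrow> 4 \<Rightarrow> 4 \<Rightarrow> 4 \<Rightarrow> real" where
  "nabla4 g T v e a b c d = pd e (\<lambda>u. T u a b c d) v
     - (\<Sum>m\<in>UNIV. christoffel g v m e a * T v m b c d
                 + christoffel g v m e b * T v a m c d
                 + christoffel g v m e c * T v a b m d
                 + christoffel g v m e d * T v a b c m)"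

text \<open>\<open>div_weyl g v a c b\<close> is \<open>\<nabla>\<^sup>d C\<^sub>a\<^sub>c\<^sub>b\<^sub>d\<close>, and the Bach tensor is
  \<open>B\<^sub>a\<^sub>b = \<nabla>\<^sup>c\<nabla>\<^sup>d C\<^sub>a\<^sub>c\<^sub>b\<^sub>d + (1/2) R\<^sup>c\<^sup>d C\<^sub>a\<^sub>c\<^sub>b\<^sub>d\<close>.\<close>

definition div_weyl :: "(real^4 \<Rightarrow> real^4^4) \<Rightarrow> real^4 \<Rightarrow> 4 \<Rightarrow> 4 \<Rightarrow> 4 \<Rightarrow> real" where
  "div_weyl g v a c b =
     (\<Sum>d\<in>UNIV. \<Sum>e\<in>UNIV. ginv g v d e * nabla4 g (weyl g) v e a c b d)"

definition bach :: "(real^4 \<Rightarrow> real^4^4) \<Rightarrow> real^4 \<Rightarrow> 4 \<Rightarrow> 4 \<Rightarrow> real" where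
  "bach g v a b =
     (\<Sum>c\<in>UNIV. \<Sum>e\<in>UNIV. ginv g v c e * nabla3 g (div_weyl g) v e a c b)
     + (1/2) * (\<Sum>c\<in>UNIV. \<Sum>d\<in>UNIV.
          (\<Sum>m\<in>UNIV. \<Sum>n\<in>UNIV. ginv g v c m * ginv g v d n * ricci g v m n)
          * weyl g v a c b d)"

definition einstein_on :: "(real^4) set \<Rightarrow> (real^4 \<Rightarrow> real^4^4) \<Rightarrow> bool" where
  "einstein_on U g \<longleftrightarrow> (\<exists>\<Lambda>. \<forall>v\<in>U. \<forall>a b. ricci g v a b = \<Lambda> * g v $ a $ b)"

definition conformal_to_einstein_on :: "(real^4) set \<Rightarrow> (real^4 \<Rightarrow> real^4^4) \<Rightarrow> bool" where
  "conformal_to_einstein_on U g \<longleftrightarrow> (\<exists>g'. conformal_on U g g' \<and> einstein_on U g')"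


section \<open>Self-duality and Petrov types\<close>

definition levi_civita :: "4 \<Rightarrow> 4 \<Rightarrow> 4 \<Rightarrow> 4 \<Rightarrow> real" where
  "levi_civita a b c d = det (vector [axis a 1, axis b 1, axis c 1, axis d 1] :: real^4^4)"

text \<open>The volume form, for the orientation given by \<open>(x, y, p, \<phi>)\<close>, and \<open>\<epsilon>\<^sub>a\<^sub>b\<^sup>c\<^sup>d\<close>.\<close>

definition vol_form :: "(real^4 \<Rightarrow> real^4^4) \<Rightarrow> real^4 \<Rightarrow> 4 \<Rightarrow> 4 \<Rightarrow> 4 \<Rightarrow> 4 \<Rightarrow> real" where
  "vol_form g v a b c d = sqrt \<bar>det (g v)\<bar> * levi_civita a b c d"

definition vol_form_up :: "(real^4 \<Rightarrow> real^4^4) \<Rightarrow> real^4 \<Rightarrow> 4 \<Rightarrow> 4 \<Rightarrow> 4 \<Rightarrow> 4 \<Rightarrow> real" where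
  "vol_form_up g v a b c d =
     (\<Sum>m\<in>UNIV. \<Sum>n\<in>UNIV. vol_form g v a b m n * ginv g v m c * ginv g v n d)"

text \<open>Two-forms at a point are antisymmetric matrices. In split signature the Hodge star squares to
  the identity on them, so the two-forms split into the real three-dimensional eigenspaces for the
  eigenvalues \<open>s = 1\<close> (self-dual) and \<open>s = -1\<close> (anti-self-dual).\<close>

definition hodge2 :: "(real^4 \<Rightarrow> real^4^4) \<Rightarrow> real^4 \<Rightarrow> real^4^4 \<Rightarrow> real^4^4" where
  "hodge2 g v F =
     (\<chi> a b. (1/2) * (\<Sum>c\<in>UNIV. \<Sum>d\<in>UNIV. vol_form_up g v a b c d * F $ c $ d))"

definition dual_forms :: "(real^4 \<Rightarrow> real^4^4) \<Rightarrow> real \<Rightarrow> real^4 \<Rightarrow> (real^4^4) set" where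
  "dual_forms g s v = {F. transpose F = - F \<and> hodge2 g v F = s *\<^sub>R F}"

text \<open>The self-dual (\<open>s = 1\<close>) and anti-self-dual (\<open>s = -1\<close>) part \<open>(C + s *C)/2\<close> of the Weyl tensor,
  and its action on two-forms, \<open>F\<^sub>a\<^sub>b \<mapsto> (1/2) W\<^sub>a\<^sub>b\<^sub>c\<^sub>d F\<^sup>c\<^sup>d\<close>.\<close>

definition weyl_part ::
    "(real^4 \<Rightarrow> real^4^4) \<Rightarrow> real \<Rightarrow> real^4 \<Rightarrow> 4 \<Rightarrow> 4 \<Rightarrow> 4 \<Rightarrow> 4 \<Rightarrow> real" where
  "weyl_part g s v a b c d =
     (weyl g v a b c d
      + s * ((1/2) * (\<Sum>e\<in>UNIV. \<Sum>f\<in>UNIV. vol_form_up g v a b e f * weyl g v e f c d))) / 2"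

definition weyl_endo ::
    "(real^4 \<Rightarrow> real^4^4) \<Rightarrow> real \<Rightarrow> real^4 \<Rightarrow> real^4^4 \<Rightarrow> real^4^4" where
  "weyl_endo g s v F =
     (\<chi> a b. (1/2) * (\<Sum>c\<in>UNIV. \<Sum>d\<in>UNIV. weyl_part g s v a b c d *
        (\<Sum>m\<in>UNIV. \<Sum>n\<in>UNIV. ginv g v c m * ginv g v d n * F $ m $ n)))"

text \<open>Petrov type N in Petrov's sense: on the three-dimensional space of (anti-)self-dual two-forms,
  the Weyl endomorphism has the single eigenvalue 0, with Jordan blocks of sizes 2 and 1
  (Segre symbol \<open>[(21)]\<close>); \<open>e1, e2, e3\<close> is a Jordan basis.\<close>

definition petrov_type_N :: "(real^4 \<Rightarrow> real^4^4) \<Rightarrow> real \<Rightarrow> real^4 \<Rightarrow> bool" where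
  "petrov_type_N g s v \<longleftrightarrow>
     (\<exists>e1 e2 e3. distinct [e1, e2, e3] \<and> independent {e1, e2, e3} \<and>
        span {e1, e2, e3} = dual_forms g s v \<and>
        weyl_endo g s v e1 = 0 \<and> weyl_endo g s v e2 = e1 \<and> weyl_endo g s v e3 = 0)"

definition type_NN' :: "(real^4 \<Rightarrow> real^4^4) \<Rightarrow> real^4 \<Rightarrow> bool" where
  "type_NN' g v \<longleftrightarrow>
     (\<forall>s\<in>{1, -1}. (\<exists>a b c d. weyl_part g s v a b c d \<noteq> 0) \<and> petrov_type_N g s v)"


section \<open>The metrics\<close>

definition sym_prod :: "real^4 \<Rightarrow> real^4 \<Rightarrow> real^4^4" where
  "sym_prod \<alpha> \<beta> = (\<chi> a b. (\<alpha> $ a * \<beta> $ b + \<beta> $ a * \<alpha> $ b) / 2)"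

definition gF :: "real \<Rightarrow> (real \<Rightarrow> real) \<Rightarrow> (real^4 \<Rightarrow> real) \<Rightarrow> real^4 \<Rightarrow> real^4^4" where
  "gF i h \<rho> v =
     (let dx = axis 1 1; dy = axis 2 1; dp = axis 3 1; d\<phi> = axis 4 1;
          p = v $ 3;
          \<theta> = dy - p *\<^sub>R dx
      in (2 * (\<rho> v)\<^sup>2) *\<^sub>R
           (sym_prod (dp - h p *\<^sub>R dx) dx
            - sym_prod \<theta> ((2/3 * i) *\<^sub>R d\<phi> + (2/3 * deriv h p) *\<^sub>R dx
                           + (1/6 * (deriv ^^ 2) h p) *\<^sub>R \<theta>)))"

end

theory Submission
  imports Defs
begin

text \<open>The metrics of the theorem are \<open>\<rho>\<^sup>2 g\<^sub>0\<close> for one fixed base metric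
  \<open>g\<^sub>0 = \<theta>\<^sup>3\<theta>\<^sup>1 + \<theta>\<^sup>1\<theta>\<^sup>3 - \<theta>\<^sup>2\<theta>\<^sup>4 - \<theta>\<^sup>4\<theta>\<^sup>2\<close>, written in the null coframe
  \<open>\<theta>\<^sup>1 = dx\<close>, \<open>\<theta>\<^sup>2 = dy - p dx\<close>, \<open>\<theta>\<^sup>3 = dp - h dx\<close>,
  \<open>\<theta>\<^sup>4 = (2/3) (i d\<phi> + h' dx + h'' \<theta>\<^sup>2 / 4)\<close>. All components of \<open>g\<^sub>0\<close> depend on \<open>p\<close> only.

  The curvature is short in this coframe. The Weyl tensor of \<open>g\<^sub>0\<close> is
  \<open>(h\<^sup>2 h''''/6) \<omega>\<^sup>1\<^sup>2 \<otimes> \<omega>\<^sup>1\<^sup>2 + (h''''/6) \<omega>\<^sup>2\<^sup>3 \<otimes> \<omega>\<^sup>2\<^sup>3\<close> with \<open>\<omega>\<^sup>i\<^sup>j = \<theta>\<^sup>i \<and> \<theta>\<^sup>j\<close> (lemma \<open>weyl_g0\<close>). The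
  two simple null two-forms have opposite duality, so each half of the Weyl tensor is the square of
  a null two-form; this is type N on both sides when \<open>h\<close> and \<open>h''''\<close> do not vanish (lemma
  \<open>type_NN'_gh\<close>). The Bach tensor of \<open>g\<^sub>0\<close> is \<open>(1/3) (h\<^sup>2 h'''')'' \<theta>\<^sup>2 \<otimes> \<theta>\<^sup>2\<close> (lemma \<open>bach_g0\<close>), which vanishes
  when \<open>h\<^sup>2 h''''\<close> is affine in \<open>p\<close>. Both facts pass to \<open>\<rho>\<^sup>2 g\<^sub>0\<close> because in dimension four the
  Weyl tensor scales with \<open>\<rho>\<^sup>2\<close> and the Bach tensor with \<open>\<rho>\<^sup>-\<^sup>2\<close>, for every metric whose Weyl tensor has
  its usual algebraic symmetries (lemmas \<open>weyl_gh\<close>, \<open>bach_gh\<close>).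

  If \<open>w\<^sup>2 g\<^sub>0\<close> is Einstein, then \<open>u = 1/w\<close> solves the linear system
  \<open>\<nabla>\<^sub>a \<nabla>\<^sub>b u + u P\<^sub>a\<^sub>b = \<mu> g\<^sub>a\<^sub>b\<close> with \<open>P\<close> the Schouten tensor. Where \<open>a p + b\<close> does not vanish, a few
  components of this system and their \<open>p\<close>-derivatives force \<open>\<partial>\<^sub>p u = 0\<close> and then \<open>h'''' (a p + b) u = 0\<close>,
  a contradiction (lemma \<open>not_einstein\<close>).

  The equation itself shows that \<open>h\<close> has no zero, even at a root of \<open>a p + b\<close> (lemma \<open>h_nonzero\<close>);
  hence \<open>h'''' = (a p + b) / h\<^sup>2\<close>, and \<open>h\<close> has derivatives of all orders.\<close>

section \<open>Partial derivatives and smooth functions\<close>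

lemma has_real_derivative_pd:
  assumes "f differentiable (at v)"
  shows "((\<lambda>t. f (v + t *\<^sub>R axis k 1)) has_real_derivative pd k f v) (at 0)"
proof -
  have "(\<lambda>t. f (v + t *\<^sub>R axis k 1)) differentiable (at 0)"
    by (rule differentiable_compose[where f = f]) (use assms in \<open>auto intro!: derivative_intros\<close>)
  then show ?thesis
    unfolding pd_def by (simp add: DERIV_deriv_iff_real_differentiable)
qed

lemma pd_eqI:
  "((\<lambda>t. f (v + t *\<^sub>R axis k 1)) has_real_derivative D) (at 0) \<Longrightarrow> pd k f v = D"
  unfolding pd_def by (rule DERIV_imp_deriv)

lemma differentiable_on_open_at:
  "f differentiable_on U \<Longrightarrow> open U \<Longrightarrow> v \<in> U \<Longrightarrow> f differentiable (at v)"
  by (metis at_within_open differentiable_on_def)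

lemma eventually_line_in:
  fixes v w :: "'a::real_normed_vector"
  assumes "open U" "v \<in> U"
  shows "eventually (\<lambda>t. v + t *\<^sub>R w \<in> U) (nhds (0::real))"
proof -
  have "((\<lambda>t. v + t *\<^sub>R w) \<longlongrightarrow> v + 0 *\<^sub>R w) (nhds 0)"
    by (intro tendsto_add tendsto_scaleR tendsto_const) (simp add: filterlim_ident)
  then show ?thesis using assms topological_tendstoD by fastforce
qed

lemma pd_cong:
  assumes "open U" "v \<in> U" "\<And>u. u \<in> U \<Longrightarrow> f u = g u"
  shows "pd k f v = pd k g v"
  unfolding pd_def
  by (rule deriv_cong_ev, rule eventually_mono[OF eventually_line_in[OF assms(1,2), of "axis k 1"]])
    (simp_all add: assms(3))

lemma pd_const: "pd k (\<lambda>_. c) v = 0"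
  by (rule pd_eqI) auto

lemma pd_add:
  assumes "f differentiable (at v)" "g differentiable (at v)"
  shows "pd k (\<lambda>u. f u + g u) v = pd k f v + pd k g v"
  by (rule pd_eqI) (intro DERIV_add has_real_derivative_pd assms)

lemma pd_diff:
  assumes "f differentiable (at v)" "g differentiable (at v)"
  shows "pd k (\<lambda>u. f u - g u) v = pd k f v - pd k g v"
  by (rule pd_eqI) (intro DERIV_diff has_real_derivative_pd assms)

lemma pd_minus:
  assumes "f differentiable (at v)"
  shows "pd k (\<lambda>u. - f u) v = - pd k f v"
  by (rule pd_eqI) (intro DERIV_minus has_real_derivative_pd assms)

lemma pd_mult:
  assumes "f differentiable (at v)" "g differentiable (at v)"
  shows "pd k (\<lambda>u. f u * g u) v = pd k f v * g v + f v * pd k g v"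
  by (rule pd_eqI)
    (use DERIV_mult'[OF has_real_derivative_pd[OF assms(1), of k] has_real_derivative_pd[OF assms(2), of k]]
      in \<open>simp add: algebra_simps\<close>)

lemma pd_inverse:
  assumes "f differentiable (at v)" "f v \<noteq> 0"
  shows "pd k (\<lambda>u. inverse (f u)) v = - pd k f v * (inverse (f v) * inverse (f v))"
  by (rule pd_eqI)
    (use DERIV_inverse'[OF has_real_derivative_pd[OF assms(1), of k]] assms(2)
      in \<open>simp add: algebra_simps\<close>)

lemma pd_cdivide:
  assumes "f differentiable (at v)"
  shows "pd k (\<lambda>u. f u / c) v = pd k f v / c"
  by (rule pd_eqI) (intro DERIV_cdivide has_real_derivative_pd assms)

lemma pd_sum:
  assumes "\<And>m. m \<in> A \<Longrightarrow> f m differentiable (at v)"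
  shows "pd k (\<lambda>u. \<Sum>m\<in>A. f m u) v = (\<Sum>m\<in>A. pd k (f m) v)"
  by (rule pd_eqI) (intro DERIV_sum has_real_derivative_pd assms)

lemma foldr_pd_snoc: "foldr pd ks (pd k f) = foldr pd (ks @ [k]) f"
  by simp

lemma smooth_pd: "smooth_fun_on U f \<Longrightarrow> smooth_fun_on U (pd k f)"
  unfolding smooth_fun_on_def foldr_pd_snoc by blast

lemma smooth_differentiable:
  "smooth_fun_on U f \<Longrightarrow> open U \<Longrightarrow> v \<in> U \<Longrightarrow> f differentiable (at v)"
  unfolding smooth_fun_on_def by (metis differentiable_on_open_at foldr_Nil id_apply)

lemma differentiable_on_cong:
  assumes "f differentiable_on U" "\<And>v. v \<in> U \<Longrightarrow> f v = g v"
  shows "g differentiable_on U"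
  using assms unfolding differentiable_on_def differentiable_def
  by (metis has_derivative_transform)

text \<open>The algebra of functions generated by a set \<open>S\<close>. If the generators are differentiable on \<open>U\<close>
  and their partial derivatives agree on \<open>U\<close> with members of the algebra, all members are smooth.
  This yields every closure property of smooth functions used below.\<close>

inductive_set fun_alg :: "(real^4 \<Rightarrow> real) set \<Rightarrow> (real^4 \<Rightarrow> real) set" for S where
  base: "f \<in> S \<Longrightarrow> f \<in> fun_alg S"
| const: "(\<lambda>_. c) \<in> fun_alg S"
| add: "f \<in> fun_alg S \<Longrightarrow> g \<in> fun_alg S \<Longrightarrow> (\<lambda>v. f v + g v) \<in> fun_alg S"
| mult: "f \<in> fun_alg S \<Longrightarrow> g \<in> fun_alg S \<Longrightarrow> (\<lambda>v. f v * g v) \<in> fun_alg S"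

lemma smooth_fun_alg:
  assumes U: "open U" and f: "f \<in> fun_alg S"
    and diff: "\<And>f. f \<in> S \<Longrightarrow> f differentiable_on U"
    and pdS: "\<And>f k. f \<in> S \<Longrightarrow> \<exists>f'\<in>fun_alg S. \<forall>v\<in>U. pd k f v = f' v"
  shows "smooth_fun_on U f"
proof -
  have alg_diff: "f differentiable_on U" if "f \<in> fun_alg S" for f
    using that by induction (auto intro: diff derivative_intros)
  have alg_pd: "\<exists>f'\<in>fun_alg S. \<forall>v\<in>U. pd k f v = f' v" if "f \<in> fun_alg S" for f k
    using that
  proof induction
    case (base f)
    then show ?case by (rule pdS)
  next
    case (const c)
    show ?case by (rule bexI[OF _ fun_alg.const[of 0]]) (simp add: pd_const)
  next
    case (add f g)
    then obtain f' g' where f': "f' \<in> fun_alg S" "\<forall>v\<in>U. pd k f v = f' v"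
      and g': "g' \<in> fun_alg S" "\<forall>v\<in>U. pd k g v = g' v" by blast
    show ?case
    proof (intro bexI ballI)
      fix v assume "v \<in> U"
      then show "pd k (\<lambda>v. f v + g v) v = f' v + g' v"
        using add f' g' by (simp add: pd_add differentiable_on_open_at[OF alg_diff U])
    qed (intro fun_alg.add f' g')
  next
    case (mult f g)
    then obtain f' g' where f': "f' \<in> fun_alg S" "\<forall>v\<in>U. pd k f v = f' v"
      and g': "g' \<in> fun_alg S" "\<forall>v\<in>U. pd k g v = g' v" by blast
    show ?case
    proof (intro bexI ballI)
      fix v assume "v \<in> U"
      then show "pd k (\<lambda>v. f v * g v) v = f' v * g v + f v * g' v"
        using mult f' g' by (simp add: pd_mult differentiable_on_open_at[OF alg_diff U])
    qed (intro fun_alg.add fun_alg.mult f' g' mult)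
  qed
  have "\<exists>f'\<in>fun_alg S. \<forall>v\<in>U. foldr pd ks f v = f' v" for ks
  proof (induction ks)
    case Nil
    then show ?case using f by auto
  next
    case (Cons k ks)
    then obtain f' where f': "f' \<in> fun_alg S" "\<forall>v\<in>U. foldr pd ks f v = f' v" by blast
    then have "\<forall>v\<in>U. pd k (foldr pd ks f) v = pd k f' v"
      using pd_cong[OF U] by blast
    then show ?case using alg_pd[OF f'(1), of k] by auto
  qed
  then show ?thesis
    unfolding smooth_fun_on_def using alg_diff differentiable_on_cong by metis
qed

lemma smooth_base:
  assumes "open U" "f \<in> fun_alg {f. smooth_fun_on U f}"
  shows "smooth_fun_on U f"
proof (rule smooth_fun_alg[OF assms])
  fix f k assume "f \<in> {f. smooth_fun_on U f}"
  then show "f differentiable_on U" "\<exists>f'\<in>fun_alg {f. smooth_fun_on U f}. \<forall>v\<in>U. pd k f v = f' v"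
    by (auto intro!: bexI[where x = "pd k f"] fun_alg.base smooth_pd)
      (metis foldr_Nil id_apply smooth_fun_on_def)
qed

lemma smooth_const: "open U \<Longrightarrow> smooth_fun_on U (\<lambda>_. c)"
  by (auto intro: smooth_base fun_alg.intros)

lemma smooth_add:
  "open U \<Longrightarrow> smooth_fun_on U f \<Longrightarrow> smooth_fun_on U g \<Longrightarrow> smooth_fun_on U (\<lambda>v. f v + g v)"
  by (rule smooth_base, assumption, rule fun_alg.add; rule fun_alg.base, simp)

lemma smooth_mult:
  "open U \<Longrightarrow> smooth_fun_on U f \<Longrightarrow> smooth_fun_on U g \<Longrightarrow> smooth_fun_on U (\<lambda>v. f v * g v)"
  by (rule smooth_base, assumption, rule fun_alg.mult; rule fun_alg.base, simp)

lemma smooth_minus: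
  assumes "open U" "smooth_fun_on U f" shows "smooth_fun_on U (\<lambda>v. - f v)"
  using smooth_mult[OF assms(1) smooth_const[OF assms(1), of "-1"] assms(2)] by simp

lemma smooth_diff:
  assumes "open U" "smooth_fun_on U f" "smooth_fun_on U g"
  shows "smooth_fun_on U (\<lambda>v. f v - g v)"
  using smooth_add[OF assms(1,2) smooth_minus[OF assms(1,3)]] by simp

lemma smooth_sum:
  assumes "open U" "\<And>m. m \<in> A \<Longrightarrow> smooth_fun_on U (f m)"
  shows "smooth_fun_on U (\<lambda>v. \<Sum>m\<in>A. f m v)"
  using assms(2)
  by (induction A rule: infinite_finite_induct) (auto intro: smooth_const smooth_add assms(1))

lemma smooth_power2:
  "open U \<Longrightarrow> smooth_fun_on U f \<Longrightarrow> smooth_fun_on U (\<lambda>v. (f v)\<^sup>2)"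
  unfolding power2_eq_square by (rule smooth_mult)

lemma smooth_inverse:
  assumes U: "open U" and f: "smooth_fun_on U f" and nz: "\<And>v. v \<in> U \<Longrightarrow> f v \<noteq> 0"
  shows "smooth_fun_on U (\<lambda>v. inverse (f v))"
proof (rule smooth_fun_alg[OF U fun_alg.base])
  let ?S = "{f. smooth_fun_on U f} \<union> {\<lambda>v. inverse (f v)}"
  show "(\<lambda>v. inverse (f v)) \<in> ?S" by simp
  fix g k assume g: "g \<in> ?S"
  have fd: "f differentiable_on U" using f by (metis foldr_Nil id_apply smooth_fun_on_def)
  show "g differentiable_on U"
    using g
  proof
    assume "g \<in> {f. smooth_fun_on U f}"
    then show ?thesis by simp (metis foldr_Nil id_apply smooth_fun_on_def)
  next
    assume "g \<in> {\<lambda>v. inverse (f v)}"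
    then show ?thesis using differentiable_on_inverse[OF fd] nz by auto
  qed
  show "\<exists>f'\<in>fun_alg ?S. \<forall>v\<in>U. pd k g v = f' v"
  proof (cases "smooth_fun_on U g")
    case True
    then show ?thesis by (auto intro!: bexI[where x = "pd k g"] fun_alg.base smooth_pd)
  next
    case False
    then have g: "g = (\<lambda>v. inverse (f v))" using g by auto
    show ?thesis
    proof (intro bexI ballI)
      fix v assume "v \<in> U"
      then show "pd k g v = (-1) * pd k f v * (inverse (f v) * inverse (f v))"
        unfolding g by (subst pd_inverse) (auto intro: smooth_differentiable f U simp: nz)
    next
      show "(\<lambda>v. (-1) * pd k f v * (inverse (f v) * inverse (f v))) \<in> fun_alg ?S"
        by (rule fun_alg.mult[OF fun_alg.mult[OF fun_alg.const fun_alg.base]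
              fun_alg.mult[OF fun_alg.base fun_alg.base]]) (simp_all add: smooth_pd f)
    qed
  qed
qed

lemma smooth_divide:
  assumes "open U" "smooth_fun_on U f" "smooth_fun_on U g" "\<And>v. v \<in> U \<Longrightarrow> g v \<noteq> 0"
  shows "smooth_fun_on U (\<lambda>v. f v / g v)"
  unfolding divide_inverse by (intro smooth_mult smooth_inverse assms)

lemma smooth_cdivide: "open U \<Longrightarrow> smooth_fun_on U f \<Longrightarrow> smooth_fun_on U (\<lambda>v. f v / c)"
  unfolding divide_inverse by (intro smooth_mult smooth_const)

lemma pd_coord_fun:
  assumes "(F has_real_derivative F' (v $ j)) (at (v $ j))"
  shows "pd k (\<lambda>u. F (u $ j)) v = (if k = j then F' (v $ j) else 0)"
proof (rule pd_eqI)
  have "((\<lambda>t::real. (v + t *\<^sub>R axis k 1) $ j) has_real_derivative (if k = j then 1 else 0)) (at 0)"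
    by (auto simp: axis_def intro!: derivative_eq_intros)
  from DERIV_chain2[OF _ this, where f = F]
  show "((\<lambda>t. F ((v + t *\<^sub>R axis k 1) $ j)) has_real_derivative (if k = j then F' (v $ j) else 0)) (at 0)"
    using assms by (auto simp: mult_ac)
qed

text \<open>Functions of one coordinate, all of whose derivatives exist.\<close>

lemma smooth_coord_fun:
  assumes U: "open U" and I: "open I" "\<And>v. v \<in> U \<Longrightarrow> v $ j \<in> I"
    and F: "\<And>n p. p \<in> I \<Longrightarrow> (F n has_real_derivative F (Suc n) p) (at p)"
  shows "smooth_fun_on U (\<lambda>v. F n (v $ j))"
proof (rule smooth_fun_alg[OF U fun_alg.base])
  let ?S = "range (\<lambda>n v. F n (v $ j))"
  show "(\<lambda>v. F n (v $ j)) \<in> ?S" by simp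
  fix g k assume "g \<in> ?S"
  then obtain n where g: "g = (\<lambda>v. F n (v $ j))" by auto
  show "g differentiable_on U"
    unfolding g differentiable_on_def
  proof
    fix v assume "v \<in> U"
    then have "F n differentiable (at (v $ j))"
      using F I real_differentiable_def by blast
    then have "(\<lambda>v. F n (v $ j)) differentiable (at v)"
      by (rule differentiable_compose[of "F n"])
        (rule bounded_linear_imp_differentiable[OF bounded_linear_vec_nth])
    then show "(\<lambda>v. F n (v $ j)) differentiable (at v within U)"
      by (rule differentiable_at_withinI)
  qed
  show "\<exists>f'\<in>fun_alg ?S. \<forall>v\<in>U. pd k g v = f' v"
    unfolding g
    by (rule bexI[where x = "\<lambda>v. (if k = j then 1 else 0) * F (Suc n) (v $ j)"],
        simp add: pd_coord_fun[where F' = "F (Suc n)"] F I(2), rule fun_alg.mult[OF fun_alg.const fun_alg.base], simp)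
qed

lemma pd_has_real_derivative_line:
  assumes "f differentiable (at (w + t *\<^sub>R axis k 1))"
  shows "((\<lambda>t. f (w + t *\<^sub>R axis k 1)) has_real_derivative pd k f (w + t *\<^sub>R axis k 1)) (at t)"
proof -
  have "((\<lambda>s. f ((w + t *\<^sub>R axis k 1) + (s - t) *\<^sub>R axis k 1)) has_real_derivative
      pd k f (w + t *\<^sub>R axis k 1) * 1) (at t)"
    by (rule DERIV_chain2[where f = "\<lambda>t'. f (w + t *\<^sub>R axis k 1 + t' *\<^sub>R axis k 1)"])
      (use has_real_derivative_pd[OF assms] in \<open>auto intro!: derivative_eq_intros\<close>)
  then show ?thesis by (simp add: scaleR_left_diff_distrib)
qed

text \<open>The second difference quotient of \<open>f\<close> is a value of a mixed second derivative near \<open>v\<close>.\<close>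

lemma second_difference:
  assumes U: "open U" and f: "smooth_fun_on U f" and B: "ball v r \<subseteq> U" and t: "0 < t" "2 * t < r"
  shows "\<exists>w. dist w v < 2 * t \<and>
    f (v + t *\<^sub>R axis a 1 + t *\<^sub>R axis b 1) - f (v + t *\<^sub>R axis a 1) - f (v + t *\<^sub>R axis b 1) + f v
      = t * t * pd b (pd a f) w"
proof -
  have dist_v: "dist (v + s *\<^sub>R axis a 1 + s' *\<^sub>R axis b 1) v \<le> \<bar>s\<bar> + \<bar>s'\<bar>" for s s'
    using norm_triangle_ineq[of "s *\<^sub>R axis a (1::real)" "s' *\<^sub>R axis b 1"]
    by (simp add: dist_norm)
  have inU: "v + s *\<^sub>R axis a 1 + s' *\<^sub>R axis b 1 \<in> U" if "0 \<le> s" "s \<le> t" "0 \<le> s'" "s' \<le> t" for s s'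
    using dist_v[of s s'] that B t by (force simp: dist_commute subset_iff)
  have inU': "v + s *\<^sub>R axis a 1 \<in> U" if "0 \<le> s" "s \<le> t" for s
    using inU[of s 0] that t by simp
  define \<psi> where "\<psi> s = f (v + t *\<^sub>R axis b 1 + s *\<^sub>R axis a 1) - f (v + s *\<^sub>R axis a 1)" for s
  have "\<exists>z>0. z < t \<and> \<psi> t - \<psi> 0 = (t - 0) *
      (pd a f (v + t *\<^sub>R axis b 1 + z *\<^sub>R axis a 1) - pd a f (v + z *\<^sub>R axis a 1))"
  proof (rule MVT2[OF t(1)])
    fix s assume s: "0 \<le> s" "s \<le> t"
    show "(\<psi> has_real_derivative
        pd a f (v + t *\<^sub>R axis b 1 + s *\<^sub>R axis a 1) - pd a f (v + s *\<^sub>R axis a 1)) (at s)"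
      unfolding \<psi>_def
      by (intro DERIV_diff pd_has_real_derivative_line smooth_differentiable[OF f U])
        (use inU[of s t] inU'[of s] s t in \<open>auto simp: add_ac\<close>)
  qed
  then obtain z where z: "0 < z" "z < t" and \<psi>: "\<psi> t - \<psi> 0 = t *
      (pd a f (v + t *\<^sub>R axis b 1 + z *\<^sub>R axis a 1) - pd a f (v + z *\<^sub>R axis a 1))"
    by auto
  have "\<exists>z'>0. z' < t \<and>
      pd a f ((v + z *\<^sub>R axis a 1) + t *\<^sub>R axis b 1) - pd a f ((v + z *\<^sub>R axis a 1) + 0 *\<^sub>R axis b 1) =
      (t - 0) * pd b (pd a f) ((v + z *\<^sub>R axis a 1) + z' *\<^sub>R axis b 1)"
    by (rule MVT2[OF t(1)], rule pd_has_real_derivative_line)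
      (use inU z in \<open>auto intro!: smooth_differentiable[OF smooth_pd[OF f] U]\<close>)
  then obtain z' where z': "0 < z'" "z' < t" and pd: "pd a f (v + z *\<^sub>R axis a 1 + t *\<^sub>R axis b 1)
      - pd a f (v + z *\<^sub>R axis a 1) = t * pd b (pd a f) (v + z *\<^sub>R axis a 1 + z' *\<^sub>R axis b 1)"
    by auto
  show ?thesis
  proof (intro exI conjI)
    show "dist (v + z *\<^sub>R axis a 1 + z' *\<^sub>R axis b 1) v < 2 * t"
      using dist_v[of z z'] z z' by linarith
    show "f (v + t *\<^sub>R axis a 1 + t *\<^sub>R axis b 1) - f (v + t *\<^sub>R axis a 1) - f (v + t *\<^sub>R axis b 1) + f v
        = t * t * pd b (pd a f) (v + z *\<^sub>R axis a 1 + z' *\<^sub>R axis b 1)"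
      using \<psi> pd by (simp add: \<psi>_def add_ac)
  qed
qed

text \<open>Clairaut's theorem.\<close>

theorem pd_commute:
  assumes U: "open U" and f: "smooth_fun_on U f" and v: "v \<in> U"
  shows "pd a (pd b f) v = pd b (pd a f) v"
proof (rule ccontr)
  assume ne: "pd a (pd b f) v \<noteq> pd b (pd a f) v"
  define e where "e = \<bar>pd a (pd b f) v - pd b (pd a f) v\<bar> / 2"
  have e: "e > 0" using ne by (simp add: e_def)
  have cont: "isCont (pd j (pd k f)) v" for j k
    by (intro differentiable_imp_continuous_within smooth_differentiable[OF _ U v] smooth_pd f)
  obtain d1 where d1: "d1 > 0" "\<And>w. dist w v < d1 \<Longrightarrow> \<bar>pd a (pd b f) w - pd a (pd b f) v\<bar> < e"
    using cont[of a b] e unfolding continuous_at_eps_delta dist_real_def by blast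
  obtain d2 where d2: "d2 > 0" "\<And>w. dist w v < d2 \<Longrightarrow> \<bar>pd b (pd a f) w - pd b (pd a f) v\<bar> < e"
    using cont[of b a] e unfolding continuous_at_eps_delta dist_real_def by blast
  obtain r where r: "r > 0" "ball v r \<subseteq> U" using U v open_contains_ball by blast
  define t where "t = min r (min d1 d2) / 4"
  have t: "0 < t" "2 * t < r" "2 * t < d1" "2 * t < d2"
    using r d1 d2 unfolding t_def by auto
  obtain w where w: "dist w v < 2 * t" "f (v + t *\<^sub>R axis a 1 + t *\<^sub>R axis b 1)
      - f (v + t *\<^sub>R axis a 1) - f (v + t *\<^sub>R axis b 1) + f v = t * t * pd b (pd a f) w"
    using second_difference[OF U f r(2) t(1,2)] by blast
  obtain w' where w': "dist w' v < 2 * t" "f (v + t *\<^sub>R axis b 1 + t *\<^sub>R axis a 1)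
      - f (v + t *\<^sub>R axis b 1) - f (v + t *\<^sub>R axis a 1) + f v = t * t * pd a (pd b f) w'"
    using second_difference[OF U f r(2) t(1,2)] by blast
  have "t * t * pd b (pd a f) w = t * t * pd a (pd b f) w'"
    unfolding w(2)[symmetric] w'(2)[symmetric] by (simp add: add_ac)
  then have "pd b (pd a f) w = pd a (pd b f) w'" using t by simp
  moreover have "\<bar>pd a (pd b f) w' - pd a (pd b f) v\<bar> < e" "\<bar>pd b (pd a f) w - pd b (pd a f) v\<bar> < e"
    using d1(2)[of w'] d2(2)[of w] w(1) w'(1) t by linarith+
  ultimately have "\<bar>pd a (pd b f) v - pd b (pd a f) v\<bar> < e + e" by linarith
  then show False by (simp add: e_def)
qed

section \<open>Metrics, their connection and traces\<close>

text \<open>The Kronecker delta, kept opaque so that contractions with it are rewritten by \<open>sum_kd\<close>.\<close>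

definition kd :: "4 \<Rightarrow> 4 \<Rightarrow> real" where
  "kd a b = (if a = b then 1 else 0)"

lemma kd_sym: "kd a b = kd b a"
  by (simp add: kd_def)

lemma sum_kd:
  "(\<Sum>m\<in>UNIV. kd a m * f m) = f a" "(\<Sum>m\<in>UNIV. kd m a * f m) = f a"
  by (simp_all add: kd_def if_distrib[of "\<lambda>x. x * _"] cong: if_cong)

lemma matrix_inv_both:
  fixes A :: "'a::semiring_1^'n^'m"
  assumes "invertible A" shows "A ** matrix_inv A = mat 1 \<and> matrix_inv A ** A = mat 1"
  using assms unfolding invertible_def matrix_inv_def by (rule someI_ex)

lemmas matrix_inv_right = matrix_inv_both[THEN conjunct1]
  and matrix_inv_left = matrix_inv_both[THEN conjunct2]

lemma matrix_inv_unique: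
  fixes A :: "'a::semiring_1^'n^'m"
  assumes "A ** B = mat 1" "B ** A = mat 1" shows "matrix_inv A = B"
proof -
  have "invertible A" using assms unfolding invertible_def by blast
  then show ?thesis
    by (metis assms(1) matrix_inv_left matrix_mul_assoc matrix_mul_lid matrix_mul_rid)
qed

lemma scaleR_matrix_mult: "(r *\<^sub>R A) ** (s *\<^sub>R B) = (r * s) *\<^sub>R (A ** B)"
  for A :: "real^'n^'m" and B :: "real^'k^'n"
  by (simp add: matrix_matrix_mult_def vec_eq_iff sum_distrib_left mult_ac)

lemma invertible_scaleR:
  fixes A :: "real^'n^'m"
  assumes "invertible A" "r \<noteq> 0"
  shows "invertible (r *\<^sub>R A)" "matrix_inv (r *\<^sub>R A) = inverse r *\<^sub>R matrix_inv A"
proof -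
  have "(r *\<^sub>R A) ** (inverse r *\<^sub>R matrix_inv A) = mat 1"
    "(inverse r *\<^sub>R matrix_inv A) ** (r *\<^sub>R A) = mat 1"
    using assms by (simp_all add: scaleR_matrix_mult matrix_inv_right matrix_inv_left)
  then show "invertible (r *\<^sub>R A)" "matrix_inv (r *\<^sub>R A) = inverse r *\<^sub>R matrix_inv A"
    by (auto simp: invertible_def intro: matrix_inv_unique)
qed

text \<open>A metric with smooth components whose inverse also has smooth components. Regularity of the
  inverse follows from that of the metric, but is immediate for a metric with an explicit inverse.\<close>

locale metric_chart =
  fixes U :: "(real^4) set" and g :: "real^4 \<Rightarrow> real^4^4"
  assumes U: "open U"
    and smooth_g: "smooth_fun_on U (\<lambda>v. g v $ a $ b)"
    and smooth_ginv: "smooth_fun_on U (\<lambda>v. ginv g v a b)"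
    and g_sym: "v \<in> U \<Longrightarrow> g v $ a $ b = g v $ b $ a"
    and g_inv: "v \<in> U \<Longrightarrow> invertible (g v)"
begin

lemmas smooth_intros = smooth_const[OF U] smooth_add[OF U] smooth_diff[OF U] smooth_minus[OF U]
  smooth_mult[OF U] smooth_sum[OF U] smooth_power2[OF U] smooth_g smooth_ginv smooth_pd

lemmas differentiableI = smooth_differentiable[OF _ U]

lemma ginv_sym:
  assumes "v \<in> U" shows "ginv g v a b = ginv g v b a"
proof -
  let ?A = "g v" and ?B = "matrix_inv (g v)"
  have "transpose ?A = ?A" using g_sym[OF assms] by (simp add: transpose_def vec_eq_iff)
  then have "transpose ?B ** ?A = transpose (?A ** ?B)"
    by (simp add: matrix_transpose_mul)
  then have *: "transpose ?B ** ?A = mat 1"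
    by (simp add: matrix_inv_right g_inv[OF assms] transpose_mat)
  have "transpose ?B = transpose ?B ** (?A ** ?B)"
    by (simp add: matrix_inv_right g_inv[OF assms])
  also have "\<dots> = ?B" by (simp add: matrix_mul_assoc *)
  finally have "transpose ?B $ a $ b = ?B $ a $ b" by simp
  then show ?thesis by (simp add: ginv_def transpose_def)
qed

lemma g_ginv:
  assumes "v \<in> U" shows "(\<Sum>m\<in>UNIV. g v $ a $ m * ginv g v m b) = kd a b"
  using matrix_inv_right[OF g_inv[OF assms]]
  by (simp add: ginv_def kd_def matrix_matrix_mult_def mat_def vec_eq_iff)

lemma ginv_g:
  assumes "v \<in> U" shows "(\<Sum>m\<in>UNIV. ginv g v a m * g v $ m $ b) = kd a b"
  using matrix_inv_left[OF g_inv[OF assms]]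
  by (simp add: ginv_def kd_def matrix_matrix_mult_def mat_def vec_eq_iff)

lemma lower_raise:
  assumes "v \<in> U"
  shows "(\<Sum>m\<in>UNIV. g v $ b $ m * (\<Sum>l\<in>UNIV. ginv g v m l * X l)) = X b"
proof -
  have "(\<Sum>m\<in>UNIV. g v $ b $ m * (\<Sum>l\<in>UNIV. ginv g v m l * X l))
      = (\<Sum>l\<in>UNIV. (\<Sum>m\<in>UNIV. g v $ b $ m * ginv g v m l) * X l)"
    unfolding sum_4 by algebra
  then show ?thesis by (simp add: g_ginv[OF assms] sum_kd)
qed

lemma raise_lower:
  assumes "v \<in> U"
  shows "(\<Sum>m\<in>UNIV. ginv g v b m * (\<Sum>l\<in>UNIV. g v $ m $ l * X l)) = X b"
proof -
  have "(\<Sum>m\<in>UNIV. ginv g v b m * (\<Sum>l\<in>UNIV. g v $ m $ l * X l))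
      = (\<Sum>l\<in>UNIV. (\<Sum>m\<in>UNIV. ginv g v b m * g v $ m $ l) * X l)"
    unfolding sum_4 by algebra
  then show ?thesis by (simp add: ginv_g[OF assms] sum_kd)
qed

lemma christoffel_sym:
  assumes "v \<in> U" shows "christoffel g v k a b = christoffel g v k b a"
proof -
  have "pd l (\<lambda>u. g u $ a $ b) v = pd l (\<lambda>u. g u $ b $ a) v" for l
    by (rule pd_cong[OF U assms]) (rule g_sym)
  then show ?thesis unfolding christoffel_def by (simp add: algebra_simps)
qed

text \<open>The Koszul formula with the upper index lowered.\<close>

lemma christoffel_lower:
  assumes "v \<in> U"
  shows "(\<Sum>m\<in>UNIV. g v $ c $ m * christoffel g v m a b)
    = (pd a (\<lambda>u. g u $ b $ c) v + pd b (\<lambda>u. g u $ a $ c) v - pd c (\<lambda>u. g u $ a $ b) v) / 2"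
  using lower_raise[OF assms, of c "\<lambda>l. pd a (\<lambda>u. g u $ b $ l) v + pd b (\<lambda>u. g u $ a $ l) v
      - pd l (\<lambda>u. g u $ a $ b) v"]
  by (simp add: christoffel_def flip: sum_divide_distrib)

text \<open>Compatibility of the Levi-Civita connection with the metric, and with its inverse.\<close>

lemma pd_metric:
  assumes "v \<in> U"
  shows "pd c (\<lambda>u. g u $ a $ b) v = (\<Sum>m\<in>UNIV. g v $ b $ m * christoffel g v m c a)
    + (\<Sum>m\<in>UNIV. g v $ a $ m * christoffel g v m c b)"
proof -
  have "pd l (\<lambda>u. g u $ x $ y) v = pd l (\<lambda>u. g u $ y $ x) v" for l x y
    by (rule pd_cong[OF U assms]) (rule g_sym)
  from this[of c b a] this[of a c b] show ?thesis
    unfolding christoffel_lower[OF assms] by (simp add: field_simps)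
qed

lemma pd_ginv:
  assumes v: "v \<in> U"
  shows "pd c (\<lambda>u. ginv g u a b) v = - (\<Sum>m\<in>UNIV. ginv g v a m * christoffel g v b c m)
    - (\<Sum>m\<in>UNIV. christoffel g v a c m * ginv g v m b)"
proof -
  let ?\<Gamma> = "christoffel g v"
  \<comment> \<open>Differentiate \<open>g\<^sub>n\<^sub>m g\<^sup>m\<^sup>b = \<delta>\<close>; raising \<open>n\<close> afterwards isolates the derivative of the inverse.\<close>
  have low: "(\<Sum>m\<in>UNIV. g v $ n $ m * pd c (\<lambda>u. ginv g u m b) v)
      = - ?\<Gamma> b c n - (\<Sum>m\<in>UNIV. g v $ n $ m * (\<Sum>l\<in>UNIV. ?\<Gamma> m c l * ginv g v l b))" for n
  proof -
    have "pd c (\<lambda>u. \<Sum>m\<in>UNIV. g u $ n $ m * ginv g u m b) v = pd c (\<lambda>u. kd n b) v"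
      by (rule pd_cong[OF U v]) (rule g_ginv)
    moreover have "pd c (\<lambda>u. \<Sum>m\<in>UNIV. g u $ n $ m * ginv g u m b) v
        = (\<Sum>m\<in>UNIV. pd c (\<lambda>u. g u $ n $ m) v * ginv g v m b + g v $ n $ m * pd c (\<lambda>u. ginv g u m b) v)"
      by (subst pd_sum) (auto intro!: differentiableI[OF _ v] smooth_intros sum.cong pd_mult)
    ultimately have "(\<Sum>m\<in>UNIV. g v $ n $ m * pd c (\<lambda>u. ginv g u m b) v)
        = - (\<Sum>m\<in>UNIV. pd c (\<lambda>u. g u $ n $ m) v * ginv g v m b)"
      by (simp add: pd_const sum.distrib)
    also have "\<dots> = - (\<Sum>l\<in>UNIV. (\<Sum>m\<in>UNIV. ginv g v b m * g v $ m $ l) * ?\<Gamma> l c n)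
        - (\<Sum>m\<in>UNIV. g v $ n $ m * (\<Sum>l\<in>UNIV. ?\<Gamma> m c l * ginv g v l b))"
      unfolding pd_metric[OF v] ginv_sym[OF v, of b] sum_4 by algebra
    finally show ?thesis by (simp add: ginv_g[OF v] sum_kd)
  qed
  have "pd c (\<lambda>u. ginv g u a b) v
      = (\<Sum>n\<in>UNIV. ginv g v a n * (\<Sum>m\<in>UNIV. g v $ n $ m * pd c (\<lambda>u. ginv g u m b) v))"
    by (rule raise_lower[OF v, symmetric])
  also have "\<dots> = - (\<Sum>m\<in>UNIV. ginv g v a m * ?\<Gamma> b c m) - (\<Sum>n\<in>UNIV. ginv g v a n *
      (\<Sum>m\<in>UNIV. g v $ n $ m * (\<Sum>l\<in>UNIV. ?\<Gamma> m c l * ginv g v l b)))"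
    by (simp add: low right_diff_distrib sum_subtractf sum_negf)
  finally show ?thesis by (simp add: raise_lower[OF v])
qed

lemma smooth_christoffel: "smooth_fun_on U (\<lambda>v. christoffel g v k a b)"
  unfolding christoffel_def divide_inverse by (intro smooth_intros)

lemma smooth_riemann_up: "smooth_fun_on U (\<lambda>v. riemann_up g v a b c d)"
  unfolding riemann_up_def by (intro smooth_intros smooth_christoffel)

lemma smooth_ricci: "smooth_fun_on U (\<lambda>v. ricci g v a b)"
  unfolding ricci_def by (intro smooth_intros smooth_riemann_up)

lemma smooth_weyl: "smooth_fun_on U (\<lambda>v. weyl g v a b c d)"
  unfolding weyl_def riemann_def schouten_def scalar_curv_def divide_inverse
  by (intro smooth_intros smooth_ricci smooth_riemann_up)

lemma smooth_div_weyl: "smooth_fun_on U (\<lambda>v. div_weyl g v a b c)"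
  unfolding div_weyl_def nabla4_def by (intro smooth_intros smooth_christoffel smooth_weyl)

end

text \<open>The trace of a pair of lower indices with the inverse of the metric.\<close>

definition ctr :: "(real^4 \<Rightarrow> real^4^4) \<Rightarrow> real^4 \<Rightarrow> (4 \<Rightarrow> 4 \<Rightarrow> real) \<Rightarrow> real" where
  "ctr g v f = (\<Sum>a\<in>UNIV. \<Sum>b\<in>UNIV. ginv g v a b * f a b)"

lemma ctr_add: "ctr g v (\<lambda>a b. f a b + h a b) = ctr g v f + ctr g v h"
  by (simp add: ctr_def sum.distrib distrib_left)

lemma ctr_diff: "ctr g v (\<lambda>a b. f a b - h a b) = ctr g v f - ctr g v h"
  by (simp add: ctr_def sum_subtractf right_diff_distrib)

lemma ctr_minus: "ctr g v (\<lambda>a b. - f a b) = - ctr g v f"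
  by (simp add: ctr_def sum_negf)

lemma ctr_cmult: "ctr g v (\<lambda>a b. c * f a b) = c * ctr g v f"
  by (simp add: ctr_def sum_distrib_left mult_ac)

lemma ctr_sum: "ctr g v (\<lambda>a b. \<Sum>m\<in>(UNIV::4 set). f m a b) = (\<Sum>m\<in>UNIV. ctr g v (f m))"
  by (simp add: sum_4 ctr_add)

lemma ctr_commute:
  "ctr g v (\<lambda>c e. ctr g v (\<lambda>d f. F c e d f)) = ctr g v (\<lambda>d f. ctr g v (\<lambda>c e. F c e d f))"
proof -
  have "ctr g v (\<lambda>c e. \<Sum>d\<in>UNIV. \<Sum>f\<in>UNIV. ginv g v d f * F c e d f)
      = (\<Sum>d\<in>UNIV. \<Sum>f\<in>UNIV. ginv g v d f * ctr g v (\<lambda>c e. F c e d f))"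
    by (simp only: ctr_sum ctr_cmult)
  then show ?thesis by (simp only: ctr_def)
qed

lemma div_weyl_ctr: "div_weyl k v a c b = ctr k v (\<lambda>d e. nabla4 k (weyl k) v e a c b d)"
  unfolding div_weyl_def ctr_def ..

lemma bach_ctr: "bach k v a b = ctr k v (\<lambda>c e. nabla3 k (div_weyl k) v e a c b)
    + 1 / 2 * ctr k v (\<lambda>c m. ctr k v (\<lambda>d n. ricci k v m n * weyl k v a c b d))"
proof -
  have "(\<Sum>d\<in>UNIV. (\<Sum>m\<in>UNIV. \<Sum>n\<in>UNIV. ginv k v c m * ginv k v d n * ricci k v m n) * weyl k v a c b d)
      = (\<Sum>m\<in>UNIV. ginv k v c m * ctr k v (\<lambda>d n. ricci k v m n * weyl k v a c b d))" for c
    unfolding ctr_def by (simp add: sum_distrib_left sum_distrib_right mult_ac) (rule sum.swap)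
  then show ?thesis unfolding bach_def ctr_def by simp
qed

text \<open>The symmetries of a curvature tensor: skew in the first pair, symmetric under exchange of the
  pairs, and the first Bianchi identity. That the traces vanish is stated separately.\<close>

definition weyl_symmetric :: "(4 \<Rightarrow> 4 \<Rightarrow> 4 \<Rightarrow> 4 \<Rightarrow> real) \<Rightarrow> bool" where
  "weyl_symmetric C \<longleftrightarrow> (\<forall>a b c d. C b a c d = - C a b c d \<and> C c d a b = C a b c d \<and>
     C a b c d + C b c a d + C c a b d = 0)"

context metric_chart
begin

lemma ctr_swap:
  assumes "v \<in> U" shows "ctr g v f = ctr g v (\<lambda>a b. f b a)"
proof -
  have "ctr g v f = (\<Sum>b\<in>UNIV. \<Sum>a\<in>UNIV. ginv g v a b * f a b)"
    unfolding ctr_def by (rule sum.swap)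
  also have "\<dots> = ctr g v (\<lambda>a b. f b a)"
    unfolding ctr_def by (intro sum.cong refl) (metis ginv_sym[OF assms])
  finally show ?thesis .
qed

lemma ctr_g:
  assumes "v \<in> U"
  shows "ctr g v (\<lambda>a b. g v $ b $ c * X a) = X c" "ctr g v (\<lambda>a b. g v $ b $ a) = 4"
proof -
  have "ctr g v (\<lambda>a b. g v $ b $ c * X a) = (\<Sum>a\<in>UNIV. (\<Sum>b\<in>UNIV. ginv g v a b * g v $ b $ c) * X a)"
    unfolding ctr_def by (simp add: sum_distrib_left mult_ac)
  then show "ctr g v (\<lambda>a b. g v $ b $ c * X a) = X c" by (simp add: ginv_g[OF assms] sum_kd)
  have "ctr g v (\<lambda>a b. g v $ b $ a) = (\<Sum>a\<in>UNIV. kd a a)"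
    unfolding ctr_def by (simp add: ginv_g[OF assms])
  then show "ctr g v (\<lambda>a b. g v $ b $ a) = 4" by (simp add: kd_def)
qed

lemma ctr_antisym:
  assumes "v \<in> U" "\<And>a b. f b a = - f a b" shows "ctr g v f = 0"
proof -
  have "ctr g v f = ctr g v (\<lambda>a b. - f a b)"
    unfolding assms(2)[symmetric] by (rule ctr_swap[OF assms(1)])
  then show ?thesis by (simp add: ctr_minus)
qed

text \<open>Covariant differentiation commutes with traces.\<close>

lemma ctr_nabla4:
  assumes v: "v \<in> U" and T: "\<And>a b c d. smooth_fun_on U (\<lambda>u. T u a b c d)"
  shows "ctr g v (\<lambda>c d. nabla4 g T v e a c b d) = pd e (\<lambda>u. ctr g u (\<lambda>c d. T u a c b d)) v
    - (\<Sum>m\<in>UNIV. christoffel g v m e a * ctr g v (\<lambda>c d. T v m c b d)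
        + christoffel g v m e b * ctr g v (\<lambda>c d. T v a c m d))"
proof -
  have "pd e (\<lambda>u. ctr g u (\<lambda>c d. T u a c b d)) v = (\<Sum>c\<in>UNIV. \<Sum>d\<in>UNIV.
      pd e (\<lambda>u. ginv g u c d) v * T v a c b d + ginv g v c d * pd e (\<lambda>u. T u a c b d) v)"
    unfolding ctr_def
    by (subst pd_sum, intro differentiableI[OF _ v] smooth_intros T)
      (intro sum.cong refl, subst pd_sum, intro differentiableI[OF _ v] smooth_intros T,
       intro sum.cong refl pd_mult differentiableI[OF _ v] smooth_intros T)
  also have "\<dots> = ctr g v (\<lambda>c d. pd e (\<lambda>u. T u a c b d) v)
      - (\<Sum>c\<in>UNIV. \<Sum>d\<in>UNIV. (\<Sum>m\<in>UNIV. ginv g v c m * christoffel g v d e m) * T v a c b d)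
      - (\<Sum>c\<in>UNIV. \<Sum>d\<in>UNIV. (\<Sum>m\<in>UNIV. christoffel g v c e m * ginv g v m d) * T v a c b d)"
    unfolding pd_ginv[OF v] ctr_def by (simp add: algebra_simps sum.distrib sum_subtractf)
  also have "(\<Sum>c\<in>UNIV. \<Sum>d\<in>UNIV. (\<Sum>m\<in>UNIV. ginv g v c m * christoffel g v d e m) * T v a c b d)
      = ctr g v (\<lambda>c d. \<Sum>m\<in>UNIV. christoffel g v m e d * T v a c b m)"
    unfolding ctr_def sum_4 by (simp add: algebra_simps)
  also have "(\<Sum>c\<in>UNIV. \<Sum>d\<in>UNIV. (\<Sum>m\<in>UNIV. christoffel g v c e m * ginv g v m d) * T v a c b d)
      = ctr g v (\<lambda>c d. \<Sum>m\<in>UNIV. christoffel g v m e c * T v a m b d)"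
    unfolding ctr_def sum_4 by (simp add: algebra_simps)
  finally show ?thesis
    unfolding nabla4_def by (simp add: ctr_diff ctr_add ctr_sum ctr_cmult sum.distrib)
qed

end

section \<open>Conformal covariance of the Weyl and Bach tensors\<close>

locale conformal_change = metric_chart +
  fixes w :: "real^4 \<Rightarrow> real"
  assumes smooth_w: "smooth_fun_on U w" and w_nz: "v \<in> U \<Longrightarrow> w v \<noteq> 0"
begin

text \<open>The rescaled metric \<open>w\<^sup>2 g\<close>; lemma names with \<open>gh\<close> refer to it. In the following definitions
  \<open>\<Upsilon> = d log w\<close> is \<open>ups\<close>, with raised index \<open>ups_up\<close> and square \<open>ups2\<close>; \<open>nups\<close> is \<open>\<nabla>\<Upsilon>\<close>; \<open>chg\<close> is the difference
  tensor of the two connections; and \<open>qs\<close>, with first index raised \<open>qs_up\<close>, turns out to be the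
  difference of the two Schouten tensors.\<close>

abbreviation gh where "gh \<equiv> \<lambda>v. (w v)\<^sup>2 *\<^sub>R g v"

definition ups :: "real^4 \<Rightarrow> 4 \<Rightarrow> real" where
  "ups v a = pd a w v * inverse (w v)"

definition ups_up :: "real^4 \<Rightarrow> 4 \<Rightarrow> real" where
  "ups_up v a = (\<Sum>b\<in>UNIV. ginv g v a b * ups v b)"

definition ups2 :: "real^4 \<Rightarrow> real" where
  "ups2 v = (\<Sum>b\<in>UNIV. ups_up v b * ups v b)"

definition nups :: "real^4 \<Rightarrow> 4 \<Rightarrow> 4 \<Rightarrow> real" where
  "nups v a b = pd a (\<lambda>u. ups u b) v - (\<Sum>m\<in>UNIV. christoffel g v m a b * ups v m)"

definition chg :: "real^4 \<Rightarrow> 4 \<Rightarrow> 4 \<Rightarrow> 4 \<Rightarrow> real" where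
  "chg v k a b = kd k a * ups v b + kd k b * ups v a - g v $ a $ b * ups_up v k"

definition qs :: "real^4 \<Rightarrow> 4 \<Rightarrow> 4 \<Rightarrow> real" where
  "qs v a b = ups v a * ups v b - nups v a b - ups2 v / 2 * g v $ a $ b"

definition qs_up :: "real^4 \<Rightarrow> 4 \<Rightarrow> 4 \<Rightarrow> real" where
  "qs_up v a b = (\<Sum>e\<in>UNIV. ginv g v a e * qs v e b)"

lemma smooth_ups: "smooth_fun_on U (\<lambda>v. ups v a)"
  unfolding ups_def by (intro smooth_intros smooth_inverse[OF U] smooth_w w_nz)

lemma smooth_ups_up: "smooth_fun_on U (\<lambda>v. ups_up v a)"
  unfolding ups_up_def by (intro smooth_intros smooth_ups)

lemma smooth_gh: "smooth_fun_on U (\<lambda>v. gh v $ a $ b)"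
  by (simp add: smooth_intros smooth_w)

lemma ginv_gh: "v \<in> U \<Longrightarrow> ginv gh v a b = inverse ((w v)\<^sup>2) * ginv g v a b"
  by (simp add: ginv_def invertible_scaleR g_inv w_nz)

lemma ups_low:
  assumes "v \<in> U" shows "(\<Sum>m\<in>UNIV. g v $ a $ m * ups_up v m) = ups v a"
  unfolding ups_up_def by (rule lower_raise[OF assms])

lemma pd_w: "v \<in> U \<Longrightarrow> pd a w v = ups v a * w v"
  by (simp add: ups_def w_nz)

lemma pd_scaled:
  assumes v: "v \<in> U" and f: "smooth_fun_on U f"
  shows "pd c (\<lambda>u. (w u)\<^sup>2 * f u) v = (w v)\<^sup>2 * (2 * ups v c * f v + pd c f v)"
  unfolding power2_eq_square
  by (simp add: pd_mult differentiableI[OF _ v] smooth_intros smooth_w f pd_w[OF v] algebra_simps)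

lemma christoffel_gh:
  assumes v: "v \<in> U"
  shows "christoffel gh v k a b = christoffel g v k a b + chg v k a b"
proof -
  have raise: "(\<Sum>l\<in>UNIV. ginv g v k l * g v $ x $ l) = kd k x" for x
    unfolding ginv_g[OF v, of k x, symmetric] by (intro sum.cong refl) (metis g_sym[OF v])
  have "christoffel gh v k a b = (\<Sum>l\<in>UNIV. ginv g v k l * (pd a (\<lambda>u. g u $ b $ l) v + pd b (\<lambda>u. g u $ a $ l) v
      - pd l (\<lambda>u. g u $ a $ b) v + 2 * ups v a * g v $ b $ l + 2 * ups v b * g v $ a $ l
      - 2 * ups v l * g v $ a $ b)) / 2"
    unfolding christoffel_def
    by (simp add: ginv_gh[OF v] pd_scaled[OF v smooth_g] w_nz[OF v] mult.assoc sum_4)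
      (simp add: w_nz[OF v] field_simps power2_eq_square)
  also have "\<dots> = christoffel g v k a b + ups v a * (\<Sum>l\<in>UNIV. ginv g v k l * g v $ b $ l)
      + ups v b * (\<Sum>l\<in>UNIV. ginv g v k l * g v $ a $ l) - g v $ a $ b * ups_up v k"
    unfolding christoffel_def ups_up_def sum_4
    by (simp add: field_simps)
  finally show ?thesis by (simp add: raise chg_def)
qed

text \<open>Contractions of the difference tensor, over its upper and over its last lower index.\<close>

lemma chg_first:
  assumes "v \<in> U"
  shows "(\<Sum>m\<in>UNIV. chg v m a b * X m) = ups v b * X a + ups v a * X b
    - g v $ a $ b * (\<Sum>m\<in>UNIV. ups_up v m * X m)"
proof -
  have "(\<Sum>m\<in>UNIV. chg v m a b * X m) = ups v b * (\<Sum>m\<in>UNIV. kd m a * X m)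
    + ups v a * (\<Sum>m\<in>UNIV. kd m b * X m) - g v $ a $ b * (\<Sum>m\<in>UNIV. ups_up v m * X m)"
    unfolding chg_def sum_4 by algebra
  then show ?thesis by (simp add: sum_kd)
qed

lemma chg_third:
  assumes "v \<in> U"
  shows "(\<Sum>m\<in>UNIV. chg v a c m * X m) = kd a c * (\<Sum>m\<in>UNIV. ups v m * X m) + ups v c * X a
    - ups_up v a * (\<Sum>m\<in>UNIV. g v $ c $ m * X m)"
proof -
  have "(\<Sum>m\<in>UNIV. chg v a c m * X m) = kd a c * (\<Sum>m\<in>UNIV. ups v m * X m)
    + ups v c * (\<Sum>m\<in>UNIV. kd a m * X m) - ups_up v a * (\<Sum>m\<in>UNIV. g v $ c $ m * X m)"
    unfolding chg_def sum_4 by algebra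
  then show ?thesis by (simp add: sum_kd)
qed

text \<open>The one-form \<open>\<Upsilon> = d log w\<close> is closed.\<close>

lemma nups_sym:
  assumes v: "v \<in> U" shows "nups v a b = nups v b a"
proof -
  have "pd a (\<lambda>u. ups u b) v = pd a (pd b w) v * inverse (w v) - ups v a * ups v b" for a b
    unfolding ups_def
    by (simp add: pd_mult pd_inverse differentiableI[OF _ v] smooth_pd smooth_inverse[OF U] smooth_w w_nz v
        algebra_simps)
  then show ?thesis
    unfolding nups_def using pd_commute[OF U smooth_w v, of a b] christoffel_sym[OF v, of _ a b]
    by simp
qed

lemma pd_ups_up:
  assumes v: "v \<in> U"
  shows "pd c (\<lambda>u. ups_up u a) v = (\<Sum>e\<in>UNIV. ginv g v a e * nups v e c)
    - (\<Sum>e\<in>UNIV. christoffel g v a c e * ups_up v e)"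
proof -
  have "pd c (\<lambda>u. ups_up u a) v
      = (\<Sum>b\<in>UNIV. pd c (\<lambda>u. ginv g u a b) v * ups v b + ginv g v a b * pd c (\<lambda>u. ups u b) v)"
    unfolding ups_up_def
    by (subst pd_sum) (auto intro!: differentiableI[OF _ v] smooth_intros smooth_ups sum.cong pd_mult)
  also have "\<dots> = (\<Sum>e\<in>UNIV. ginv g v a e * nups v c e)
      - (\<Sum>e\<in>UNIV. christoffel g v a c e * ups_up v e)"
    unfolding pd_ginv[OF v] nups_def ups_up_def sum_4 by algebra
  finally show ?thesis by (simp add: nups_sym[OF v, of c])
qed

lemma qs_sym: "v \<in> U \<Longrightarrow> qs v a b = qs v b a"
  unfolding qs_def using nups_sym[of v a b] g_sym[of v a b] by simp

lemma qs_low: "v \<in> U \<Longrightarrow> (\<Sum>m\<in>UNIV. g v $ a $ m * qs_up v m b) = qs v a b"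
  unfolding qs_up_def by (rule lower_raise)

lemma qs_up_eq:
  assumes v: "v \<in> U"
  shows "qs_up v a b = ups_up v a * ups v b - (\<Sum>e\<in>UNIV. ginv g v a e * nups v e b) - ups2 v / 2 * kd a b"
  unfolding qs_up_def qs_def ginv_g[OF v, symmetric] ups_up_def sum_4 by algebra

text \<open>The curvature of \<open>w\<^sup>2 g\<close>. The terms with Christoffel symbols cancel because the derivatives of \<open>g\<close>,
  \<open>\<Upsilon>\<close> and its raised form are expressed by covariant ones.\<close>

lemma riemann_up_gh:
  assumes v: "v \<in> U"
  shows "riemann_up gh v a b c d = riemann_up g v a b c d + kd a c * qs v d b - kd a d * qs v c b
    - g v $ b $ c * qs_up v a d + g v $ b $ d * qs_up v a c"
proof -
  define \<Gamma> where "\<Gamma> = christoffel g v"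
  define A where "A x y = (\<Sum>e\<in>UNIV. ups v e * \<Gamma> e x y)" for x y
  define B where "B x y = (\<Sum>e\<in>UNIV. \<Gamma> x y e * ups_up v e)" for x y
  define L where "L x y z = (\<Sum>e\<in>UNIV. g v $ x $ e * \<Gamma> e y z)" for x y z
  define N where "N x y = (\<Sum>e\<in>UNIV. ginv g v x e * nups v e y)" for x y
  have \<Gamma>_sym: "\<Gamma> x d y = \<Gamma> x y d" for x y d
    unfolding \<Gamma>_def by (rule christoffel_sym[OF v])
  have pd_ups: "pd x (\<lambda>u. ups u y) v = nups v x y + A x y" for x y
    unfolding nups_def A_def \<Gamma>_def by (simp add: mult.commute)
  have pd_up: "pd x (\<lambda>u. ups_up u y) v = N y x - B y x" for x y
    unfolding pd_ups_up[OF v] N_def B_def \<Gamma>_def ..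
  have pd_g: "pd x (\<lambda>u. g u $ y $ z) v = L z x y + L y x z" for x y z
    unfolding pd_metric[OF v] L_def \<Gamma>_def ..
  have pd_chg: "pd x (\<lambda>u. chg u a y b) v = kd a y * (nups v x b + A x b) + kd a b * (nups v x y + A x y)
      - ((L b x y + L y x b) * ups_up v a + g v $ y $ b * (N a x - B a x))" for x y
    unfolding chg_def
    by (simp add: pd_add pd_diff pd_mult pd_const differentiableI[OF _ v] smooth_intros smooth_ups
        smooth_ups_up pd_ups pd_up pd_g)
  have pd_\<Gamma>: "pd x (\<lambda>u. christoffel gh u a y b) v
      = pd x (\<lambda>u. christoffel g u a y b) v + pd x (\<lambda>u. chg u a y b) v" for x y
  proof -
    have "pd x (\<lambda>u. christoffel gh u a y b) v = pd x (\<lambda>u. christoffel g u a y b + chg u a y b) v"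
      by (rule pd_cong[OF U v]) (rule christoffel_gh)
    also have "\<dots> = pd x (\<lambda>u. christoffel g u a y b) v + pd x (\<lambda>u. chg u a y b) v"
      unfolding chg_def
      by (rule pd_add) (intro differentiableI[OF _ v] smooth_intros smooth_christoffel smooth_ups smooth_ups_up)+
    finally show ?thesis .
  qed
  have up2: "(\<Sum>e\<in>UNIV. ups_up v e * chg v a c e) = kd a c * ups2 v" for c
  proof -
    have "(\<Sum>e\<in>UNIV. ups_up v e * chg v a c e) = (\<Sum>e\<in>UNIV. chg v a c e * ups_up v e)"
      by (simp add: mult.commute)
    also have "\<dots> = kd a c * ups2 v"
      unfolding chg_third[OF v] ups_low[OF v] ups2_def by (simp add: mult.commute)
    finally show ?thesis .
  qed
  have quad: "(\<Sum>e\<in>UNIV. christoffel gh v a x e * christoffel gh v e y b)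
      = (\<Sum>e\<in>UNIV. \<Gamma> a x e * \<Gamma> e y b)
      + (ups v b * \<Gamma> a x y + ups v y * \<Gamma> a x b - g v $ y $ b * B a x)
      + (kd a x * A y b + ups v x * \<Gamma> a y b - ups_up v a * L x y b)
      + (ups v b * chg v a x y + ups v y * chg v a x b - g v $ y $ b * (kd a x * ups2 v))" for x y
  proof -
    have "(\<Sum>e\<in>UNIV. christoffel gh v a x e * christoffel gh v e y b)
      = (\<Sum>e\<in>UNIV. \<Gamma> a x e * \<Gamma> e y b) + (\<Sum>e\<in>UNIV. chg v e y b * \<Gamma> a x e)
      + (\<Sum>e\<in>UNIV. chg v a x e * \<Gamma> e y b) + (\<Sum>e\<in>UNIV. chg v e y b * chg v a x e)"
      unfolding christoffel_gh[OF v] \<Gamma>_def[symmetric] sum_4 by algebra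
    moreover have "(\<Sum>e\<in>UNIV. ups_up v e * \<Gamma> a x e) = B a x" for x
      unfolding B_def by (simp add: mult.commute)
    ultimately show ?thesis
      by (simp add: chg_first[OF v] chg_third[OF v] up2 flip: A_def L_def)
  qed
  have "riemann_up gh v a b c d - riemann_up g v a b c d
      = pd c (\<lambda>u. chg u a d b) v - pd d (\<lambda>u. chg u a c b) v
      + ((\<Sum>e\<in>UNIV. christoffel gh v a c e * christoffel gh v e d b) - (\<Sum>e\<in>UNIV. \<Gamma> a c e * \<Gamma> e d b))
      - ((\<Sum>e\<in>UNIV. christoffel gh v a d e * christoffel gh v e c b) - (\<Sum>e\<in>UNIV. \<Gamma> a d e * \<Gamma> e c b))"
    unfolding riemann_up_def \<Gamma>_def pd_\<Gamma> sum_subtractf by simp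
  also have "\<dots> = kd a c * qs v d b - kd a d * qs v c b
      - g v $ b $ c * qs_up v a d + g v $ b $ d * qs_up v a c"
    unfolding quad pd_chg unfolding qs_up_eq[OF v] qs_def N_def[symmetric] chg_def
    using \<Gamma>_sym[of a d c] nups_sym[OF v, of d c] g_sym[OF v, of c b] g_sym[OF v, of d b]
      g_sym[OF v, of d c] kd_sym
    by (simp add: A_def L_def \<Gamma>_sym[of _ d c]) (simp add: algebra_simps)
  finally show ?thesis by simp
qed

lemma ricci_gh:
  assumes v: "v \<in> U"
  shows "ricci gh v a b = ricci g v a b + 2 * qs v a b + g v $ a $ b * (\<Sum>c\<in>UNIV. qs_up v c c)"
proof -
  have "ricci gh v a b = ricci g v a b + (\<Sum>c\<in>UNIV. kd c c) * qs v b a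
      - (\<Sum>c\<in>UNIV. kd c b * qs v c a) - (\<Sum>c\<in>UNIV. g v $ a $ c * qs_up v c b)
      + g v $ a $ b * (\<Sum>c\<in>UNIV. qs_up v c c)"
    unfolding ricci_def riemann_up_gh[OF v] sum_4 by algebra
  moreover have "(\<Sum>c\<in>UNIV. kd c c) = 4" by (simp add: kd_def)
  ultimately show ?thesis by (simp add: sum_kd qs_low[OF v] qs_sym[OF v, of b])
qed

lemma scalar_curv_gh:
  assumes v: "v \<in> U"
  shows "scalar_curv gh v = inverse ((w v)\<^sup>2) * (scalar_curv g v + 6 * (\<Sum>c\<in>UNIV. qs_up v c c))"
proof -
  have "scalar_curv gh v = inverse ((w v)\<^sup>2) * (scalar_curv g v
      + 2 * (\<Sum>a\<in>UNIV. \<Sum>b\<in>UNIV. ginv g v a b * qs v a b)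
      + (\<Sum>a\<in>UNIV. \<Sum>b\<in>UNIV. ginv g v a b * g v $ a $ b) * (\<Sum>c\<in>UNIV. qs_up v c c))"
    unfolding scalar_curv_def ricci_gh[OF v] ginv_gh[OF v] sum_4 by (simp add: algebra_simps)
  moreover have "(\<Sum>a\<in>UNIV. \<Sum>b\<in>UNIV. ginv g v a b * qs v a b) = (\<Sum>c\<in>UNIV. qs_up v c c)"
    unfolding qs_up_def by (intro sum.cong refl) (metis qs_sym[OF v])
  moreover have "(\<Sum>a\<in>UNIV. \<Sum>b\<in>UNIV. ginv g v a b * g v $ a $ b) = (\<Sum>a\<in>UNIV. kd a a)"
    unfolding ginv_g[OF v, symmetric] by (intro sum.cong refl) (metis g_sym[OF v])
  ultimately show ?thesis by (simp add: kd_def)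
qed

lemma schouten_gh: "v \<in> U \<Longrightarrow> schouten gh v a b = schouten g v a b + qs v a b"
  by (simp add: schouten_def ricci_gh scalar_curv_gh w_nz field_simps)

text \<open>The Weyl tensor with four lower indices scales with \<open>w\<^sup>2\<close>.\<close>

lemma weyl_gh:
  assumes v: "v \<in> U"
  shows "weyl gh v a b c d = (w v)\<^sup>2 * weyl g v a b c d"
proof -
  have "riemann gh v a b c d = (w v)\<^sup>2 * (riemann g v a b c d + (\<Sum>e\<in>UNIV. kd e c * g v $ a $ e) * qs v d b
      - (\<Sum>e\<in>UNIV. kd e d * g v $ a $ e) * qs v c b - g v $ b $ c * (\<Sum>e\<in>UNIV. g v $ a $ e * qs_up v e d)
      + g v $ b $ d * (\<Sum>e\<in>UNIV. g v $ a $ e * qs_up v e c))"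
    unfolding riemann_def riemann_up_gh[OF v] sum_4 by (simp add: algebra_simps)
  then show ?thesis
    unfolding weyl_def schouten_gh[OF v] sum_kd qs_low[OF v]
    using qs_sym[OF v, of d b] qs_sym[OF v, of c b] by (simp add: algebra_simps)
qed

end

text \<open>For the divergence of the Weyl tensor only its algebraic symmetries and its vanishing traces
  matter; they are assumed here and are checked on the explicit Weyl tensor of the base metric.\<close>

locale conformal_change_weyl = conformal_change +
  assumes weyl_symm: "v \<in> U \<Longrightarrow> weyl_symmetric (weyl g v)"
    and weyl_trace: "v \<in> U \<Longrightarrow> ctr g v (\<lambda>a b. weyl g v a c b d) = 0"
begin

abbreviation "C \<equiv> weyl g"

lemma C_sym:
  assumes "v \<in> U"
  shows "C v b a c d = - C v a b c d" "C v a b d c = - C v a b c d" "C v c d a b = C v a b c d"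
    "C v a b c d + C v b c a d + C v c a b d = 0"
  using weyl_symm[OF assms] unfolding weyl_symmetric_def by (blast, metis, blast, blast)

lemma C_trace:
  assumes v: "v \<in> U"
  shows "ctr g v (\<lambda>d e. C v e c b d) = 0" "ctr g v (\<lambda>d e. C v a e b d) = 0"
    "ctr g v (\<lambda>d e. C v a c e d) = 0" "ctr g v (\<lambda>c d. C v a c b d) = 0"
proof -
  have "ctr g v (\<lambda>d e. C v e c b d) = ctr g v (\<lambda>d e. - C v d b e c)"
  proof -
    have "C v e c b d = - C v d b e c" for d e
      using C_sym(2)[OF v, of e c d b] C_sym(3)[OF v, of e c d b] by simp
    then show ?thesis by simp
  qed
  then show "ctr g v (\<lambda>d e. C v e c b d) = 0"
    by (simp add: ctr_minus weyl_trace[OF v])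
  have "C v a x b y = C v x a y b" for x y
    using C_sym(1)[OF v, of a x b y] C_sym(2)[OF v, of x a b y] by simp
  then show "ctr g v (\<lambda>d e. C v a e b d) = 0" "ctr g v (\<lambda>c d. C v a c b d) = 0"
    using ctr_swap[OF v, of "\<lambda>d e. C v e a d b"] by (simp_all add: weyl_trace[OF v])
  show "ctr g v (\<lambda>d e. C v a c e d) = 0"
    by (rule ctr_antisym[OF v]) (rule C_sym[OF v])
qed

lemma nabla_C_sym:
  assumes v: "v \<in> U"
  shows "nabla4 g C v e b a c d = - nabla4 g C v e a b c d"
    "nabla4 g C v e c d a b = nabla4 g C v e a b c d"
    "nabla4 g C v e a b c d + nabla4 g C v e b c a d + nabla4 g C v e c a b d = 0"
proof -
  have "pd e (\<lambda>u. C u b a c d) v = pd e (\<lambda>u. - C u a b c d) v"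
    by (rule pd_cong[OF U v]) (rule C_sym)
  then have 1: "pd e (\<lambda>u. C u b a c d) v = - pd e (\<lambda>u. C u a b c d) v"
    by (simp add: pd_minus differentiableI[OF smooth_weyl v])
  have 2: "C v b a c d = - C v a b c d" for a b c d by (rule C_sym[OF v])
  show "nabla4 g C v e b a c d = - nabla4 g C v e a b c d"
    unfolding nabla4_def 1 2[of b a] 2[of _ a] 2[of b] sum_4 by simp
  have 1: "pd e (\<lambda>u. C u c d a b) v = pd e (\<lambda>u. C u a b c d) v"
    by (rule pd_cong[OF U v]) (rule C_sym)
  have 2: "C v c d a b = C v a b c d" for a b c d by (rule C_sym[OF v])
  show "nabla4 g C v e c d a b = nabla4 g C v e a b c d"
    unfolding nabla4_def 1 2[of c d] 2[of _ d] 2[of c _] sum_4 by simp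
  have "pd e (\<lambda>u. C u a b c d + C u b c a d + C u c a b d) v = pd e (\<lambda>u. 0) v"
    by (rule pd_cong[OF U v]) (rule C_sym)
  then have 1: "pd e (\<lambda>u. C u a b c d) v + pd e (\<lambda>u. C u b c a d) v + pd e (\<lambda>u. C u c a b d) v = 0"
    by (simp add: pd_add pd_const differentiableI[OF _ v] smooth_intros smooth_weyl)
  have 2: "C v a b c d = - C v b c a d - C v c a b d" for a b c d
    using C_sym(4)[OF v, of a b c d] by simp
  have "nabla4 g C v e a b c d + nabla4 g C v e b c a d + nabla4 g C v e c a b d
    = pd e (\<lambda>u. C u a b c d) v + pd e (\<lambda>u. C u b c a d) v + pd e (\<lambda>u. C u c a b d) v
     - (\<Sum>m\<in>UNIV. christoffel g v m e a * (C v m b c d + C v b c m d + C v c m b d)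
       + christoffel g v m e b * (C v a m c d + C v m c a d + C v c a m d)
       + christoffel g v m e c * (C v a b m d + C v b m a d + C v m a b d)
       + christoffel g v m e d * (C v a b c m + C v b c a m + C v c a b m))"
    unfolding nabla4_def sum_4 by (simp add: algebra_simps)
  also have "\<dots> = 0"
    unfolding 1 by (simp add: C_sym(4)[OF v])
  finally show "nabla4 g C v e a b c d + nabla4 g C v e b c a d + nabla4 g C v e c a b d = 0" .
qed

text \<open>The contraction \<open>\<Upsilon>\<^sup>m C\<^sub>a\<^sub>c\<^sub>b\<^sub>m\<close>.\<close>

definition UC :: "real^4 \<Rightarrow> 4 \<Rightarrow> 4 \<Rightarrow> 4 \<Rightarrow> real" where
  "UC v a c b = (\<Sum>m\<in>UNIV. ups_up v m * C v a c b m)"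

abbreviation "D \<equiv> div_weyl g"

lemma smooth_UC: "smooth_fun_on U (\<lambda>v. UC v a c b)"
  unfolding UC_def by (intro smooth_intros smooth_ups_up smooth_weyl)

lemma ctr_gh: "v \<in> U \<Longrightarrow> ctr gh v f = inverse ((w v)\<^sup>2) * ctr g v f"
  by (simp add: ctr_def ginv_gh sum_distrib_left mult_ac)

lemma ctr_ups:
  assumes "v \<in> U"
  shows "ctr g v (\<lambda>a b. ups v b * X a) = (\<Sum>m\<in>UNIV. ups_up v m * X m)"
    "ctr g v (\<lambda>a b. ups v a * X b) = (\<Sum>m\<in>UNIV. ups_up v m * X m)"
proof -
  show *: "ctr g v (\<lambda>a b. ups v b * X a) = (\<Sum>m\<in>UNIV. ups_up v m * X m)"
    unfolding ctr_def ups_up_def sum_4 by (simp add: algebra_simps)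
  show "ctr g v (\<lambda>a b. ups v a * X b) = (\<Sum>m\<in>UNIV. ups_up v m * X m)"
    by (subst ctr_swap[OF assms]) (rule *)
qed

lemma UC_sym:
  assumes v: "v \<in> U"
  shows "UC v c a b = - UC v a c b" "UC v a c b + UC v c b a + UC v b a c = 0"
    "(\<Sum>m\<in>UNIV. ups_up v m * C v m c b d) = - UC v b d c"
    "(\<Sum>m\<in>UNIV. ups_up v m * C v a m b d) = UC v b d a"
    "(\<Sum>m\<in>UNIV. ups_up v m * C v a c m d) = - UC v a c d"
proof -
  show "UC v c a b = - UC v a c b"
    unfolding UC_def by (simp add: C_sym(1)[OF v, of c a] flip: sum_negf)
  have "UC v a c b + UC v c b a + UC v b a c
      = (\<Sum>m\<in>UNIV. ups_up v m * (C v a c b m + C v c b a m + C v b a c m))"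
    unfolding UC_def sum_4 by (simp add: algebra_simps)
  then show "UC v a c b + UC v c b a + UC v b a c = 0" by (simp add: C_sym(4)[OF v])
  have "C v m c b d = - C v b d c m" for m
    using C_sym(2,3)[OF v] by metis
  then show "(\<Sum>m\<in>UNIV. ups_up v m * C v m c b d) = - UC v b d c"
    unfolding UC_def by (simp add: sum_negf)
  have "C v a m b d = C v b d a m" for m
    using C_sym(3)[OF v] by metis
  then show "(\<Sum>m\<in>UNIV. ups_up v m * C v a m b d) = UC v b d a"
    unfolding UC_def by simp
  have "C v a c m d = - C v a c d m" for m
    using C_sym(2)[OF v] by metis
  then show "(\<Sum>m\<in>UNIV. ups_up v m * C v a c m d) = - UC v a c d"
    unfolding UC_def by (simp add: sum_negf)
qed

lemma nabla_weyl_gh: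
  assumes v: "v \<in> U"
  shows "nabla4 gh (weyl gh) v e a c b d = (w v)\<^sup>2 * (nabla4 g C v e a c b d - 2 * (ups v e * C v a c b d)
    - (ups v a * C v e c b d + ups v c * C v a e b d + ups v b * C v a c e d + ups v d * C v a c b e)
    - g v $ e $ a * UC v b d c + g v $ e $ c * UC v b d a - g v $ e $ b * UC v a c d
    + g v $ e $ d * UC v a c b)"
proof -
  have pd: "pd e (\<lambda>u. weyl gh u a c b d) v = (w v)\<^sup>2 * (2 * ups v e * C v a c b d + pd e (\<lambda>u. C u a c b d) v)"
    unfolding pd_scaled[OF v smooth_weyl, symmetric] by (rule pd_cong[OF U v]) (rule weyl_gh)
  have "nabla4 gh (weyl gh) v e a c b d = (w v)\<^sup>2 * (nabla4 g C v e a c b d + 2 * ups v e * C v a c b d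
     - (\<Sum>m\<in>UNIV. chg v m e a * C v m c b d) - (\<Sum>m\<in>UNIV. chg v m e c * C v a m b d)
     - (\<Sum>m\<in>UNIV. chg v m e b * C v a c m d) - (\<Sum>m\<in>UNIV. chg v m e d * C v a c b m))"
    unfolding nabla4_def pd christoffel_gh[OF v] weyl_gh[OF v] sum_4 by (simp add: algebra_simps)
  then show ?thesis
    unfolding chg_first[OF v] UC_sym(3-5)[OF v] UC_def[symmetric] by (simp add: algebra_simps)
qed

text \<open>The divergence changes by \<open>(n - 3) \<Upsilon>\<^sup>m C\<^sub>a\<^sub>c\<^sub>b\<^sub>m\<close>, which is \<open>UC\<close> for \<open>n = 4\<close>. The derivative of \<open>w\<^sup>2\<close> and the
  difference tensor contribute traces of \<open>C\<close>, which vanish, and terms \<open>UC\<close> with permuted indices,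
  which the Bianchi identity collects.\<close>

lemma div_weyl_gh:
  assumes v: "v \<in> U"
  shows "div_weyl gh v a c b = D v a c b + UC v a c b"
proof -
  have "div_weyl gh v a c b = ctr g v (\<lambda>d e. nabla4 g C v e a c b d - 2 * (ups v e * C v a c b d)
    - (ups v a * C v e c b d + ups v c * C v a e b d + ups v b * C v a c e d + ups v d * C v a c b e)
    - g v $ e $ a * UC v b d c + g v $ e $ c * UC v b d a - g v $ e $ b * UC v a c d
    + UC v a c b * g v $ e $ d)"
    unfolding div_weyl_ctr ctr_gh[OF v] nabla_weyl_gh[OF v] ctr_cmult by (simp add: w_nz[OF v] mult.commute)
  also have "\<dots> = D v a c b - 2 * UC v a c b - UC v a c b - UC v b a c + UC v b c a - UC v a c b + 4 * UC v a c b"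
    unfolding ctr_add ctr_diff ctr_cmult ctr_ups[OF v] ctr_g[OF v] C_trace[OF v] div_weyl_ctr UC_def[symmetric]
    by simp
  also have "UC v b c a = UC v a c b + UC v b a c"
    using UC_sym(2)[OF v, of a c b] UC_sym(1)[OF v, of b c a] by simp
  finally show ?thesis by simp
qed

text \<open>The divergence inherits skewness, the cyclic identity and the vanishing trace.\<close>

lemma D_sym:
  assumes v: "v \<in> U"
  shows "D v c a b = - D v a c b" "D v a c b + D v c b a + D v b a c = 0"
    "ctr g v (\<lambda>c e. D v a c e) = 0"
proof -
  show "D v c a b = - D v a c b"
    unfolding div_weyl_ctr ctr_minus[symmetric] nabla_C_sym(1)[OF v, symmetric] ..
  have "D v a c b + D v c b a + D v b a c = ctr g v (\<lambda>d e. nabla4 g C v e a c b d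
      + nabla4 g C v e c b a d + nabla4 g C v e b a c d)"
    unfolding div_weyl_ctr ctr_add ..
  then show "D v a c b + D v c b a + D v b a c = 0"
    by (simp add: nabla_C_sym(3)[OF v] ctr_def)
  have neg: "nabla4 g C v f a c e d = - nabla4 g C v f a c d e" for f c e d
    using nabla_C_sym(1,2)[OF v] by metis
  have inner: "ctr g v (\<lambda>c e. nabla4 g C v f a c e d) = - ctr g v (\<lambda>c e. nabla4 g C v f a c d e)" for f d
    unfolding ctr_minus[symmetric] neg[symmetric] ..
  have tr0: "ctr g v (\<lambda>c e. nabla4 g C v f a c d e) = 0" for f d
  proof -
    have "pd f (\<lambda>u. ctr g u (\<lambda>c e. C u a c d e)) v = pd f (\<lambda>u. 0) v"
      by (rule pd_cong[OF U v]) (rule C_trace)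
    then show ?thesis
      unfolding ctr_nabla4[OF v smooth_weyl] C_trace[OF v] by (simp add: pd_const)
  qed
  have "ctr g v (\<lambda>c e. D v a c e) = ctr g v (\<lambda>d f. ctr g v (\<lambda>c e. nabla4 g C v f a c e d))"
    unfolding div_weyl_ctr by (rule ctr_commute)
  then show "ctr g v (\<lambda>c e. D v a c e) = 0"
    by (simp add: inner tr0 ctr_def[of _ _ "\<lambda>_ _. 0"])
qed

lemma nabla3_UC:
  assumes v: "v \<in> U"
  shows "nabla3 g UC v e a c b = (\<Sum>d\<in>UNIV. (\<Sum>n\<in>UNIV. ginv g v d n * nups v n e) * C v a c b d)
    + (\<Sum>m\<in>UNIV. ups_up v m * nabla4 g C v e a c b m)"
proof -
  have "pd e (\<lambda>u. UC u a c b) v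
      = (\<Sum>m\<in>UNIV. pd e (\<lambda>u. ups_up u m) v * C v a c b m + ups_up v m * pd e (\<lambda>u. C u a c b m) v)"
    unfolding UC_def
    by (subst pd_sum) (auto intro!: differentiableI[OF _ v] smooth_intros smooth_ups_up smooth_weyl
        sum.cong pd_mult)
  then show ?thesis
    unfolding nabla3_def nabla4_def pd_ups_up[OF v] UC_def sum_4 by (simp add: algebra_simps)
qed

text \<open>Conformal covariance of the Bach tensor. In the divergence of \<open>D + UC\<close> the terms linear in \<open>D\<close> cancel
  by the cyclic identity; what remains, \<open>(\<nabla>\<^sup>c\<Upsilon>\<^sup>d - \<Upsilon>\<^sup>c\<Upsilon>\<^sup>d) C\<^sub>a\<^sub>c\<^sub>b\<^sub>d\<close>, is the negative of half the change of
  \<open>R\<^sup>c\<^sup>d C\<^sub>a\<^sub>c\<^sub>b\<^sub>d\<close>.\<close>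

theorem bach_gh:
  assumes v: "v \<in> U"
  shows "bach gh v a b = inverse ((w v)\<^sup>2) * bach g v a b"
proof -
  define T where "T x y z = D v x y z + UC v x y z" for x y z
  define Y where "Y x y = (\<Sum>m\<in>UNIV. ups_up v m * T x m y)" for x y
  define UUC where "UUC = (\<Sum>m\<in>UNIV. ups_up v m * UC v a m b)"
  define NC where "NC = ctr g v (\<lambda>c e. \<Sum>d\<in>UNIV. (\<Sum>n\<in>UNIV. ginv g v d n * nups v n e) * C v a c b d)"
  have T_anti: "T y x z = - T x y z" for x y z
    unfolding T_def D_sym(1)[OF v, of y] UC_sym(1)[OF v, of y] by simp
  have UC_trace: "ctr g v (\<lambda>c e. UC v a c e) = 0"
  proof -
    have neg: "C v a c e m = - C v a c m e" for c e m by (rule C_sym(2)[OF v])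
    have "ctr g v (\<lambda>c e. C v a c e m) = - ctr g v (\<lambda>c e. C v a c m e)" for m
      unfolding ctr_minus[symmetric] neg[symmetric] ..
    then have "ctr g v (\<lambda>c e. C v a c e m) = 0" for m
      by (simp add: C_trace[OF v])
    then show ?thesis unfolding UC_def by (simp add: ctr_sum ctr_cmult)
  qed
  have T_trace: "ctr g v (\<lambda>c e. T a c e) = 0"
    unfolding T_def by (simp add: ctr_add D_sym(3)[OF v] UC_trace)
  have T_trace': "ctr g v (\<lambda>c e. T e c b) = 0"
    by (rule ctr_antisym[OF v]) (rule T_anti)
  have Y': "(\<Sum>m\<in>UNIV. ups_up v m * T m x y) = - Y x y" for x y
    unfolding Y_def T_anti[of _ x] by (simp add: sum_negf)
  have pdT: "pd e (\<lambda>u. div_weyl gh u a c b) v = pd e (\<lambda>u. D u a c b) v + pd e (\<lambda>u. UC u a c b) v" for e c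
    unfolding pd_add[OF differentiableI[OF smooth_div_weyl v] differentiableI[OF smooth_UC v], symmetric]
    by (rule pd_cong[OF U v]) (rule div_weyl_gh)
  have "nabla3 gh (div_weyl gh) v e a c b = nabla3 g D v e a c b + nabla3 g UC v e a c b
      - (\<Sum>m\<in>UNIV. chg v m e a * T m c b) - (\<Sum>m\<in>UNIV. chg v m e c * T a m b)
      - (\<Sum>m\<in>UNIV. chg v m e b * T a c m)" for e c
    unfolding nabla3_def pdT christoffel_gh[OF v] div_weyl_gh[OF v] T_def sum_4
    by (simp add: algebra_simps)
  also have "\<dots> e c = nabla3 g D v e a c b + nabla3 g UC v e a c b
      - ups v a * T e c b - ups v e * T a c b - g v $ e $ a * Y c b
      - ups v c * T a e b - ups v e * T a c b + Y a b * g v $ e $ c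
      - ups v b * T a c e - ups v e * T a c b + g v $ e $ b * (\<Sum>m\<in>UNIV. ups_up v m * T a c m)" for e c
    unfolding chg_first[OF v] Y' Y_def[symmetric] by (simp add: algebra_simps)
  finally have nabla_T: "nabla3 gh (div_weyl gh) v e a c b = nabla3 g D v e a c b + nabla3 g UC v e a c b
      - ups v a * T e c b - ups v e * T a c b - g v $ e $ a * Y c b
      - ups v c * T a e b - ups v e * T a c b + Y a b * g v $ e $ c
      - ups v b * T a c e - ups v e * T a c b + g v $ e $ b * (\<Sum>m\<in>UNIV. ups_up v m * T a c m)" for e c .
  have nabla_UC: "ctr g v (\<lambda>c e. nabla3 g UC v e a c b) = NC + (\<Sum>m\<in>UNIV. ups_up v m * D v b m a)"
  proof -
    have "nabla4 g C v e a c b m = nabla4 g C v e b m a c" for e c m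
      by (rule nabla_C_sym(2)[OF v])
    then show ?thesis
      unfolding nabla3_UC[OF v] ctr_add NC_def div_weyl_ctr by (simp add: ctr_sum ctr_cmult)
  qed
  have "ctr g v (\<lambda>c e. nabla3 gh (div_weyl gh) v e a c b) = ctr g v (\<lambda>c e. nabla3 g D v e a c b)
      + NC + (\<Sum>m\<in>UNIV. ups_up v m * D v b m a)
      - Y a b + (\<Sum>m\<in>UNIV. ups_up v m * T a b m)"
    unfolding nabla_T ctr_add ctr_diff ctr_cmult ctr_g[OF v] ctr_ups[OF v] T_trace T_trace' nabla_UC
      Y_def[symmetric] by simp
  moreover have "(\<Sum>m\<in>UNIV. ups_up v m * D v b m a) - Y a b + (\<Sum>m\<in>UNIV. ups_up v m * T a b m) = - UUC"
  proof -
    have cyc: "D v a b m = D v a m b - D v b m a" for m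
      using D_sym(2)[OF v, of a b m] D_sym(1)[OF v, of m a b] by simp
    have "(\<Sum>m\<in>UNIV. ups_up v m * D v b m a) - Y a b + (\<Sum>m\<in>UNIV. ups_up v m * T a b m)
      = (\<Sum>m\<in>UNIV. ups_up v m * UC v a b m) - UUC"
      unfolding Y_def T_def UUC_def cyc sum_4 by (simp add: algebra_simps)
    moreover have "(\<Sum>m\<in>UNIV. ups_up v m * UC v a b m) = 0"
    proof -
      have "(\<Sum>m\<in>UNIV. ups_up v m * UC v a b m) = (\<Sum>m\<in>UNIV. \<Sum>n\<in>UNIV. ups_up v m * ups_up v n * C v a b m n)"
        unfolding UC_def by (simp add: sum_distrib_left mult_ac)
      also have "\<dots> = (\<Sum>n\<in>UNIV. \<Sum>m\<in>UNIV. ups_up v m * ups_up v n * C v a b m n)"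
        by (rule sum.swap)
      also have "\<dots> = - (\<Sum>n\<in>UNIV. \<Sum>m\<in>UNIV. ups_up v n * ups_up v m * C v a b n m)"
        unfolding sum_negf[symmetric] by (intro sum.cong refl) (metis C_sym(2)[OF v] mult.commute mult_minus_right)
      finally show ?thesis
        unfolding UC_def by (simp add: sum_distrib_left mult_ac)
    qed
    ultimately show ?thesis by simp
  qed
  ultimately have div: "ctr g v (\<lambda>c e. nabla3 gh (div_weyl gh) v e a c b)
      = ctr g v (\<lambda>c e. nabla3 g D v e a c b) + NC - UUC" by simp
  have ric: "ctr g v (\<lambda>c m. ctr g v (\<lambda>d n. ricci gh v m n * C v a c b d))
      = ctr g v (\<lambda>c m. ctr g v (\<lambda>d n. ricci g v m n * C v a c b d)) + 2 * (UUC - NC)"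
  proof -
    let ?t = "\<Sum>c\<in>UNIV. qs_up v c c"
    have "ricci gh v m n * C v a c b d = ricci g v m n * C v a c b d + (2 * ups v m) * (ups v n * C v a c b d)
        - 2 * (nups v m n * C v a c b d) + (?t - ups2 v) * (g v $ n $ m * C v a c b d)" for m n c d
      unfolding ricci_gh[OF v] qs_def using g_sym[OF v, of m n] by (simp add: algebra_simps)
    then have "ctr g v (\<lambda>d n. ricci gh v m n * C v a c b d) = ctr g v (\<lambda>d n. ricci g v m n * C v a c b d)
        + 2 * (ups v m * UC v a c b) - 2 * ctr g v (\<lambda>d n. nups v m n * C v a c b d)
        + (?t - ups2 v) * C v a c b m" for m c
      by (simp only: ctr_add ctr_diff ctr_cmult ctr_ups[OF v] ctr_g[OF v] UC_def mult.assoc)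
    moreover have "ctr g v (\<lambda>d n. nups v m n * C v a c b d)
        = (\<Sum>d\<in>UNIV. (\<Sum>n\<in>UNIV. ginv g v d n * nups v n m) * C v a c b d)" for m c
      unfolding ctr_def by (simp add: sum_distrib_left mult_ac nups_sym[OF v, of m])
    ultimately show ?thesis
      by (simp only: ctr_add ctr_diff ctr_cmult ctr_ups[OF v] C_trace[OF v] NC_def UUC_def) simp
  qed
  have pull: "ricci gh v m n * ((w v)\<^sup>2 * C v a c b d) = (w v)\<^sup>2 * (ricci gh v m n * C v a c b d)" for m n c d
    by simp
  have "bach gh v a b = inverse ((w v)\<^sup>2) * (ctr g v (\<lambda>c e. nabla3 g D v e a c b) + NC - UUC)
      + 1 / 2 * (inverse ((w v)\<^sup>2) * (inverse ((w v)\<^sup>2) * ((w v)\<^sup>2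
        * (ctr g v (\<lambda>c m. ctr g v (\<lambda>d n. ricci g v m n * C v a c b d)) + 2 * (UUC - NC)))))"
    unfolding bach_ctr ctr_gh[OF v] weyl_gh[OF v] div pull ctr_cmult ric by simp
  also have "\<dots> = inverse ((w v)\<^sup>2) * bach g v a b"
    unfolding bach_ctr using w_nz[OF v] by (simp add: algebra_simps)
  finally show ?thesis .
qed

end

section \<open>The base metric and its connection\<close>

text \<open>A function on the four indices given by its list of values.\<close>

definition sel4 :: "'a \<Rightarrow> 'a \<Rightarrow> 'a \<Rightarrow> 'a \<Rightarrow> 4 \<Rightarrow> 'a" where
  "sel4 x y z t k = (if k = 1 then x else if k = 2 then y else if k = 3 then z else t)"

lemma sel4_simps [simp]: "sel4 x y z t 1 = x" "sel4 x y z t 2 = y" "sel4 x y z t 3 = z" "sel4 x y z t 4 = t"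
  by (simp_all add: sel4_def)

text \<open>\<open>H n\<close> stands for the \<open>n\<close>-th derivative of \<open>h\<close>; the fourth-order equation is not yet used.\<close>

locale frame_metric =
  fixes U :: "(real^4) set" and I :: "real set" and i :: real and H :: "nat \<Rightarrow> real \<Rightarrow> real"
  assumes U: "open U" and I: "open I" and UI: "\<And>v. v \<in> U \<Longrightarrow> v $ 3 \<in> I" and i: "i \<noteq> 0"
    and H: "\<And>n p. p \<in> I \<Longrightarrow> (H n has_real_derivative H (Suc n) p) (at p)"
begin

text \<open>The null coframe and its dual frame, as functions of \<open>p\<close> and of the coordinate index.\<close>

definition th1 :: "real \<Rightarrow> 4 \<Rightarrow> real" where "th1 p = sel4 1 0 0 0"
definition th2 :: "real \<Rightarrow> 4 \<Rightarrow> real" where "th2 p = sel4 (- p) 1 0 0"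
definition th3 :: "real \<Rightarrow> 4 \<Rightarrow> real" where "th3 p = sel4 (- H 0 p) 0 1 0"
definition th4 :: "real \<Rightarrow> 4 \<Rightarrow> real" where "th4 p = sel4 (2/3 * H 1 p - 1/6 * H 2 p * p) (1/6 * H 2 p) 0 (2/3 * i)"

definition e1 :: "real \<Rightarrow> 4 \<Rightarrow> real" where "e1 p = sel4 1 p (H 0 p) (- H 1 p / i)"
definition e2 :: "real \<Rightarrow> 4 \<Rightarrow> real" where "e2 p = sel4 0 1 0 (- H 2 p / (4 * i))"
definition e3 :: "real \<Rightarrow> 4 \<Rightarrow> real" where "e3 p = sel4 0 0 1 0"
definition e4 :: "real \<Rightarrow> 4 \<Rightarrow> real" where "e4 p = sel4 0 0 0 (3 / (2 * i))"

lemmas th_defs = th1_def th2_def th3_def th4_def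
lemmas e_defs = e1_def e2_def e3_def e4_def

text \<open>The components of the base metric and of its inverse at a point with third coordinate \<open>p\<close>.\<close>

definition gt :: "real \<Rightarrow> 4 \<Rightarrow> 4 \<Rightarrow> real" where
  "gt p a b = th3 p a * th1 p b + th1 p a * th3 p b - th2 p a * th4 p b - th4 p a * th2 p b"

definition git :: "real \<Rightarrow> 4 \<Rightarrow> 4 \<Rightarrow> real" where
  "git p a b = e3 p a * e1 p b + e1 p a * e3 p b - e2 p a * e4 p b - e4 p a * e2 p b"

definition g0 :: "real^4 \<Rightarrow> real^4^4" where
  "g0 v = (\<chi> a b. gt (v $ 3) a b)"

lemma g0_nth: "g0 v $ a $ b = gt (v $ 3) a b"
  by (simp add: g0_def)

lemma gt_git: "(\<Sum>m\<in>UNIV. gt p a m * git p m b) = kd a b"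
proof -
  have "\<forall>a b. (\<Sum>m\<in>UNIV. gt p a m * git p m b) = kd a b"
    unfolding forall_4 sum_4 gt_def git_def th_defs e_defs kd_def using i by (simp add: field_simps)
  then show ?thesis by blast
qed

lemma git_gt: "(\<Sum>m\<in>UNIV. git p a m * gt p m b) = kd a b"
proof -
  have "\<forall>a b. (\<Sum>m\<in>UNIV. git p a m * gt p m b) = kd a b"
    unfolding forall_4 sum_4 gt_def git_def th_defs e_defs kd_def using i by (simp add: field_simps)
  then show ?thesis by blast
qed

lemma g0_inverse: "g0 v ** (\<chi> a b. git (v $ 3) a b) = mat 1" "(\<chi> a b. git (v $ 3) a b) ** g0 v = mat 1"
  by (simp_all add: g0_def matrix_matrix_mult_def mat_def vec_eq_iff gt_git git_gt kd_def)

lemma invertible_g0: "invertible (g0 v)"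
  unfolding invertible_def using g0_inverse by blast

lemma ginv_g0: "ginv g0 v a b = git (v $ 3) a b"
  by (simp add: ginv_def matrix_inv_unique[OF g0_inverse])

lemma smooth_H: "smooth_fun_on U (\<lambda>v. H n (v $ 3))"
  by (rule smooth_coord_fun[where F = H, OF U I UI H])

lemma smooth_p: "smooth_fun_on U (\<lambda>v. v $ 3)"
  by (rule smooth_coord_fun[where F = "\<lambda>n p. if n = 0 then p else if n = 1 then 1 else 0" and n = 0, simplified,
        OF U open_UNIV]) (auto intro!: derivative_eq_intros)

lemmas smooth_basic = smooth_const[OF U] smooth_add[OF U] smooth_diff[OF U] smooth_minus[OF U]
  smooth_mult[OF U] smooth_cdivide[OF U] smooth_H smooth_p

lemma smooth_frame:
  "smooth_fun_on U (\<lambda>v. th1 (v $ 3) a)" "smooth_fun_on U (\<lambda>v. th2 (v $ 3) a)"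
  "smooth_fun_on U (\<lambda>v. th3 (v $ 3) a)" "smooth_fun_on U (\<lambda>v. th4 (v $ 3) a)"
  "smooth_fun_on U (\<lambda>v. e1 (v $ 3) a)" "smooth_fun_on U (\<lambda>v. e2 (v $ 3) a)"
  "smooth_fun_on U (\<lambda>v. e3 (v $ 3) a)" "smooth_fun_on U (\<lambda>v. e4 (v $ 3) a)"
  using exhaust_4[of a] unfolding th_defs e_defs
  by (auto intro!: smooth_basic simp del: One_nat_def)

sublocale metric_chart U g0
proof
  show "open U" by (rule U)
  show "smooth_fun_on U (\<lambda>v. g0 v $ a $ b)" for a b
    unfolding g0_nth gt_def by (intro smooth_basic smooth_frame)
  show "smooth_fun_on U (\<lambda>v. ginv g0 v a b)" for a b
    unfolding ginv_g0 git_def by (intro smooth_basic smooth_frame)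
  show "g0 v $ a $ b = g0 v $ b $ a" for v a b
    by (simp add: g0_nth gt_def)
  show "invertible (g0 v)" for v by (rule invertible_g0)
qed

text \<open>The \<open>p\<close>-derivatives of the coframe (\<open>\<theta>\<^sup>1\<close> is constant) and of the metric.\<close>

definition dth2 :: "4 \<Rightarrow> real" where "dth2 = sel4 (- 1) 0 0 0"
definition dth3 :: "real \<Rightarrow> 4 \<Rightarrow> real" where "dth3 p = sel4 (- H 1 p) 0 0 0"
definition dth4 :: "real \<Rightarrow> 4 \<Rightarrow> real" where
  "dth4 p = sel4 (1/2 * H 2 p - 1/6 * H 3 p * p) (1/6 * H 3 p) 0 0"

definition dgt :: "real \<Rightarrow> 4 \<Rightarrow> 4 \<Rightarrow> real" where
  "dgt p a b = dth3 p a * th1 p b + th1 p a * dth3 p b - dth2 a * th4 p b - th2 p a * dth4 p b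
     - dth4 p a * th2 p b - th4 p a * dth2 b"

lemma H_deriv:
  assumes "p \<in> I"
  shows "(H 0 has_real_derivative H 1 p) (at p)" "(H 1 has_real_derivative H 2 p) (at p)"
    "(H 2 has_real_derivative H 3 p) (at p)" "(H 3 has_real_derivative H 4 p) (at p)"
    "(H 4 has_real_derivative H 5 p) (at p)" "(H 5 has_real_derivative H 6 p) (at p)"
  using H[OF assms, of 0] H[OF assms, of 1] H[OF assms, of 2] H[OF assms, of 3] H[OF assms, of 4]
    H[OF assms, of 5]
  by (simp_all add: eval_nat_numeral)

lemma th_deriv:
  assumes "p \<in> I"
  shows "((\<lambda>p. th1 p a) has_real_derivative 0) (at p)" "((\<lambda>p. th2 p a) has_real_derivative dth2 a) (at p)"
    "((\<lambda>p. th3 p a) has_real_derivative dth3 p a) (at p)" "((\<lambda>p. th4 p a) has_real_derivative dth4 p a) (at p)"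
proof -
  have "\<forall>a. ((\<lambda>p. th1 p a) has_real_derivative 0) (at p) \<and> ((\<lambda>p. th2 p a) has_real_derivative dth2 a) (at p) \<and>
    ((\<lambda>p. th3 p a) has_real_derivative dth3 p a) (at p) \<and> ((\<lambda>p. th4 p a) has_real_derivative dth4 p a) (at p)"
    unfolding forall_4 th_defs dth2_def dth3_def dth4_def sel4_simps
    by (intro conjI; rule DERIV_cong, (rule DERIV_add DERIV_diff DERIV_minus DERIV_cdivide DERIV_const DERIV_mult
          DERIV_ident H_deriv[OF assms])+, simp add: field_simps del: One_nat_def)
  then show "((\<lambda>p. th1 p a) has_real_derivative 0) (at p)" "((\<lambda>p. th2 p a) has_real_derivative dth2 a) (at p)"
    "((\<lambda>p. th3 p a) has_real_derivative dth3 p a) (at p)" "((\<lambda>p. th4 p a) has_real_derivative dth4 p a) (at p)"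
    by blast+
qed

lemma gt_deriv: "p \<in> I \<Longrightarrow> ((\<lambda>p. gt p a b) has_real_derivative dgt p a b) (at p)"
  unfolding gt_def dgt_def by (auto intro!: derivative_eq_intros th_deriv)

lemma pd_g0:
  assumes "v \<in> U" shows "pd k (\<lambda>u. g0 u $ a $ b) v = (if k = 3 then dgt (v $ 3) a b else 0)"
  unfolding g0_nth by (rule pd_coord_fun[where F' = "\<lambda>p. dgt p a b"]) (rule gt_deriv[OF UI[OF assms]])

text \<open>The Christoffel symbols \<open>\<Gamma>\<^sup>k\<^sub>a\<^sub>b\<close> of the base metric, one block for each \<open>k\<close>, and their
  \<open>p\<close>-derivatives.\<close>

definition Gm :: "real \<Rightarrow> 4 \<Rightarrow> 4 \<Rightarrow> 4 \<Rightarrow> real" where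
  "Gm p k a b = sel4
    (sel4 (sel4 (H 1 p / 3 - H 2 p * p / 3 + H 3 p * p * p / 6) (H 2 p / 6 - H 3 p * p / 6) 0 (- (i / 3)))
      (sel4 (H 2 p / 6 - H 3 p * p / 6) (H 3 p / 6) 0 0)
      (\<lambda>_. 0)
      (sel4 (- (i / 3)) 0 0 0))
    (sel4 (sel4 (H 1 p * p / 3 - H 2 p * p * p / 3 + H 3 p * p * p * p / 6) (H 2 p * p / 6 - H 3 p * p * p / 6) (- (1 / 2)) (- (i * p / 3)))
      (sel4 (H 2 p * p / 6 - H 3 p * p * p / 6) (H 3 p * p / 6) 0 0)
      (sel4 (- (1 / 2)) 0 0 0)
      (sel4 (- (i * p / 3)) 0 0 0))
    (sel4 (sel4 (2 * H 0 p * H 1 p / 3 - 2 * H 0 p * H 2 p * p / 3 + H 0 p * H 3 p * p * p / 3) (H 0 p * H 2 p / 3 - H 0 p * H 3 p * p / 3) (- (2 * H 1 p / 3) + H 2 p * p / 6) (- (2 * H 0 p * i / 3)))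
      (sel4 (H 0 p * H 2 p / 3 - H 0 p * H 3 p * p / 3) (H 0 p * H 3 p / 3) (- (H 2 p / 6)) 0)
      (sel4 (- (2 * H 1 p / 3) + H 2 p * p / 6) (- (H 2 p / 6)) 0 (i / 3))
      (sel4 (- (2 * H 0 p * i / 3)) 0 (i / 3) 0))
    (sel4 (sel4 (H 1 p * H 2 p * p / (3 * i) - H 1 p * H 3 p * p * p / (6 * i) - H 1 p * H 1 p / (3 * i)) (- (H 1 p * H 2 p / (6 * i)) + H 1 p * H 3 p * p / (6 * i)) (H 2 p / (2 * i) - H 3 p * p / (4 * i)) (H 1 p / 3))
      (sel4 (- (H 1 p * H 2 p / (6 * i)) + H 1 p * H 3 p * p / (6 * i)) (- (H 1 p * H 3 p / (6 * i))) (H 3 p / (4 * i)) 0)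
      (sel4 (H 2 p / (2 * i) - H 3 p * p / (4 * i)) (H 3 p / (4 * i)) 0 0)
      (sel4 (H 1 p / 3) 0 0 0)) k a b"

definition dGm :: "real \<Rightarrow> 4 \<Rightarrow> 4 \<Rightarrow> 4 \<Rightarrow> real" where
  "dGm p k a b = sel4
    (sel4 (sel4 (H 4 p * p * p / 6) (- (H 4 p * p / 6)) 0 0)
      (sel4 (- (H 4 p * p / 6)) (H 4 p / 6) 0 0)
      (\<lambda>_. 0)
      (\<lambda>_. 0))
    (sel4 (sel4 (H 1 p / 3 - H 2 p * p / 3 + H 3 p * p * p / 6 + H 4 p * p * p * p / 6) (H 2 p / 6 - H 3 p * p / 6 - H 4 p * p * p / 6) 0 (- (i / 3)))
      (sel4 (H 2 p / 6 - H 3 p * p / 6 - H 4 p * p * p / 6) (H 3 p / 6 + H 4 p * p / 6) 0 0)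
      (\<lambda>_. 0)
      (sel4 (- (i / 3)) 0 0 0))
    (sel4 (sel4 (H 0 p * H 4 p * p * p / 3 - 2 * H 1 p * H 2 p * p / 3 + H 1 p * H 3 p * p * p / 3 + 2 * H 1 p * H 1 p / 3) (- (H 0 p * H 4 p * p / 3) + H 1 p * H 2 p / 3 - H 1 p * H 3 p * p / 3) (- (H 2 p / 2) + H 3 p * p / 6) (- (2 * H 1 p * i / 3)))
      (sel4 (- (H 0 p * H 4 p * p / 3) + H 1 p * H 2 p / 3 - H 1 p * H 3 p * p / 3) (H 0 p * H 4 p / 3 + H 1 p * H 3 p / 3) (- (H 3 p / 6)) 0)
      (sel4 (- (H 2 p / 2) + H 3 p * p / 6) (- (H 3 p / 6)) 0 0)
      (sel4 (- (2 * H 1 p * i / 3)) 0 0 0))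
    (sel4 (sel4 (- (H 1 p * H 2 p / (3 * i)) - H 1 p * H 4 p * p * p / (6 * i) - H 2 p * H 3 p * p * p / (6 * i) + H 2 p * H 2 p * p / (3 * i)) (H 1 p * H 4 p * p / (6 * i) + H 2 p * H 3 p * p / (6 * i) - H 2 p * H 2 p / (6 * i)) (H 3 p / (4 * i) - H 4 p * p / (4 * i)) (H 2 p / 3))
      (sel4 (H 1 p * H 4 p * p / (6 * i) + H 2 p * H 3 p * p / (6 * i) - H 2 p * H 2 p / (6 * i)) (- (H 1 p * H 4 p / (6 * i)) - H 2 p * H 3 p / (6 * i)) (H 4 p / (4 * i)) 0)
      (sel4 (H 3 p / (4 * i) - H 4 p * p / (4 * i)) (H 4 p / (4 * i)) 0 0)
      (sel4 (H 2 p / 3) 0 0 0)) k a b"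

lemma christoffel_g0:
  assumes v: "v \<in> U" shows "christoffel g0 v k a b = Gm (v $ 3) k a b"
proof -
  have "christoffel g0 v k a b = (\<Sum>l\<in>UNIV. git (v $ 3) k l * ((if a = 3 then dgt (v $ 3) b l else 0)
      + (if b = 3 then dgt (v $ 3) a l else 0) - (if l = 3 then dgt (v $ 3) a b else 0))) / 2"
    unfolding christoffel_def ginv_g0 pd_g0[OF v] ..
  moreover have "\<forall>k a b. (\<Sum>l\<in>UNIV. git p k l * ((if a = 3 then dgt p b l else 0)
      + (if b = 3 then dgt p a l else 0) - (if l = 3 then dgt p a b else 0))) / 2 = Gm p k a b" for p
    unfolding forall_4 sum_4 git_def dgt_def th_defs e_defs dth2_def dth3_def dth4_def Gm_def
    using i by (simp add: field_simps power2_eq_square power3_eq_cube)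
  ultimately show ?thesis by metis
qed

lemma Gm_deriv:
  assumes "p \<in> I" shows "((\<lambda>p. Gm p k a b) has_real_derivative dGm p k a b) (at p)"
proof -
  have "\<forall>k a b. ((\<lambda>p. Gm p k a b) has_real_derivative dGm p k a b) (at p)"
    unfolding forall_4 Gm_def dGm_def sel4_simps
    by (intro conjI; rule DERIV_cong, (rule DERIV_add DERIV_diff DERIV_minus DERIV_cdivide DERIV_const DERIV_mult
          DERIV_ident H_deriv[OF assms])+, simp add: i field_simps del: One_nat_def)
  then show ?thesis by blast
qed

section \<open>Curvature of the base metric\<close>

text \<open>The entries of the two tables, as rewrite rules.\<close>

lemmas Gm_k = Gm_def[where k = 1] Gm_def[where k = 2]
  Gm_def[where k = 3] Gm_def[where k = 4]
lemmas Gm_ka = Gm_k[where a = 1] Gm_k[where a = 2]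
  Gm_k[where a = 3] Gm_k[where a = 4]
lemmas Gm_eval = Gm_ka[where b = 1, unfolded sel4_simps] Gm_ka[where b = 2, unfolded sel4_simps]
  Gm_ka[where b = 3, unfolded sel4_simps] Gm_ka[where b = 4, unfolded sel4_simps]

lemmas dGm_k = dGm_def[where k = 1] dGm_def[where k = 2]
  dGm_def[where k = 3] dGm_def[where k = 4]
lemmas dGm_ka = dGm_k[where a = 1] dGm_k[where a = 2]
  dGm_k[where a = 3] dGm_k[where a = 4]
lemmas dGm_eval = dGm_ka[where b = 1, unfolded sel4_simps] dGm_ka[where b = 2, unfolded sel4_simps]
  dGm_ka[where b = 3, unfolded sel4_simps] dGm_ka[where b = 4, unfolded sel4_simps]

text \<open>The curvature tensor \<open>R\<^sup>a\<^sub>b\<^sub>c\<^sub>d\<close> in terms of the tables.\<close>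

definition Rup :: "real \<Rightarrow> 4 \<Rightarrow> 4 \<Rightarrow> 4 \<Rightarrow> 4 \<Rightarrow> real" where
  "Rup p a b c d = (if c = 3 then dGm p a d b else 0) - (if d = 3 then dGm p a c b else 0)
     + (\<Sum>e\<in>UNIV. Gm p a c e * Gm p e d b - Gm p a d e * Gm p e c b)"

lemma pd_christoffel_g0:
  assumes v: "v \<in> U"
  shows "pd l (\<lambda>u. christoffel g0 u k a b) v = (if l = 3 then dGm (v $ 3) k a b else 0)"
proof -
  have "pd l (\<lambda>u. christoffel g0 u k a b) v = pd l (\<lambda>u. Gm (u $ 3) k a b) v"
    by (rule pd_cong[OF U v]) (rule christoffel_g0)
  also have "\<dots> = (if l = 3 then dGm (v $ 3) k a b else 0)"
    by (rule pd_coord_fun[where F' = "\<lambda>p. dGm p k a b"]) (rule Gm_deriv[OF UI[OF v]])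
  finally show ?thesis .
qed

lemma riemann_up_g0: "v \<in> U \<Longrightarrow> riemann_up g0 v a b c d = Rup (v $ 3) a b c d"
  by (simp add: riemann_up_def pd_christoffel_g0 christoffel_g0 Rup_def)

text \<open>The Schouten tensor in the coframe.\<close>

definition St :: "real \<Rightarrow> 4 \<Rightarrow> 4 \<Rightarrow> real" where
  "St p a b = H 0 p * H 3 p / 12 * (th1 p a * th2 p b + th2 p a * th1 p b)
     - H 2 p / 8 * (th1 p a * th3 p b + th3 p a * th1 p b)
     + (H 0 p * H 4 p / 6 + H 1 p * H 3 p / 6 - H 2 p * H 2 p / 16) * (th2 p a * th2 p b)
     - H 3 p / 12 * (th2 p a * th3 p b + th3 p a * th2 p b) - 1/4 * (th4 p a * th4 p b)"

lemma ricci_table: "\<forall>a b. (\<Sum>c\<in>UNIV. Rup p c a c b) = 2 * St p a b - H 2 p / 4 * gt p a b"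
  unfolding forall_4
  by (intro conjI) (simp_all add: sum_4 Rup_def Gm_eval dGm_eval St_def gt_def th_defs i field_simps
      del: One_nat_def)

lemma ricci_g0: "v \<in> U \<Longrightarrow> ricci g0 v a b = 2 * St (v $ 3) a b - H 2 (v $ 3) / 4 * gt (v $ 3) a b"
  unfolding ricci_def riemann_up_g0 using ricci_table by blast

lemma scalar_g0:
  assumes v: "v \<in> U" shows "scalar_curv g0 v = - 3 / 2 * H 2 (v $ 3)"
proof -
  have "scalar_curv g0 v = 2 * (\<Sum>a\<in>UNIV. \<Sum>b\<in>UNIV. git (v $ 3) a b * St (v $ 3) a b)
     - H 2 (v $ 3) / 4 * (\<Sum>a\<in>UNIV. \<Sum>b\<in>UNIV. git (v $ 3) a b * gt (v $ 3) b a)"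
    unfolding scalar_curv_def ginv_g0 ricci_g0[OF v] sum_4 by (simp add: gt_def algebra_simps)
  moreover have "(\<Sum>a\<in>UNIV. \<Sum>b\<in>UNIV. git p a b * St p a b) = - H 2 p / 4" for p
    unfolding sum_4 git_def St_def th_defs e_defs sel4_simps using i by (simp add: field_simps)
  ultimately show ?thesis by (simp add: git_gt kd_def)
qed

lemma schouten_g0: "v \<in> U \<Longrightarrow> schouten g0 v a b = St (v $ 3) a b"
  by (simp add: schouten_def ricci_g0 scalar_g0 g0_nth)

text \<open>The two-forms \<open>\<omega>\<^sup>i\<^sup>j = \<theta>\<^sup>i \<and> \<theta>\<^sup>j\<close> occurring in the Weyl tensor, and the Weyl tensor.\<close>

definition w12 :: "real \<Rightarrow> 4 \<Rightarrow> 4 \<Rightarrow> real" where "w12 p a b = th1 p a * th2 p b - th2 p a * th1 p b"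
definition w23 :: "real \<Rightarrow> 4 \<Rightarrow> 4 \<Rightarrow> real" where "w23 p a b = th2 p a * th3 p b - th3 p a * th2 p b"

definition Wt :: "real \<Rightarrow> 4 \<Rightarrow> 4 \<Rightarrow> 4 \<Rightarrow> 4 \<Rightarrow> real" where
  "Wt p a b c d = H 0 p * H 0 p * H 4 p / 6 * (w12 p a b * w12 p c d) + H 4 p / 6 * (w23 p a b * w23 p c d)"

text \<open>The curvature tensor with all indices down, for ordered index pairs \<open>c < d\<close>; the remaining ones follow by
  skewness.\<close>

lemma Rup_table: "\<forall>a b. (\<Sum>e\<in>UNIV. gt p a e * Rup p e b c d) = Wt p a b c d
    + (gt p a c * St p b d - gt p a d * St p b c - gt p b c * St p a d + gt p b d * St p a c)"
  if "(c, d) = (1, 2) \<or> (c, d) = (1, 3) \<or> (c, d) = (1, 4) \<or> (c, d) = (2, 3) \<or> (c, d) = (2, 4) \<or> (c, d) = (3, 4)"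
  using that unfolding forall_4
  by (elim disjE; intro conjI; clarify)
    (simp_all add: sum_4 Rup_def Gm_eval dGm_eval St_def gt_def Wt_def w12_def w23_def th_defs i field_simps
      del: One_nat_def)

lemma weyl_g0:
  assumes v: "v \<in> U" shows "weyl g0 v a b c d = Wt (v $ 3) a b c d"
proof -
  let ?p = "v $ 3"
  have Rup_anti: "Rup p e b c d = - Rup p e b d c" for p e b c d
    unfolding Rup_def sum_4 by simp
  have Wt_anti: "Wt p a b c d = - Wt p a b d c" for p c d
    unfolding Wt_def w12_def w23_def by (simp add: algebra_simps)
  have flip: "(\<Sum>e\<in>UNIV. gt p a e * Rup p e b c d) = - (\<Sum>e\<in>UNIV. gt p a e * Rup p e b d c)" for p c d
    unfolding Rup_anti[of p _ b c d] by (simp add: sum_negf)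
  have "(\<Sum>e\<in>UNIV. gt ?p a e * Rup ?p e b c d) = Wt ?p a b c d
    + (gt ?p a c * St ?p b d - gt ?p a d * St ?p b c - gt ?p b c * St ?p a d + gt ?p b d * St ?p a c)"
  proof -
    consider "c = d" | "(c, d) = (1, 2) \<or> (c, d) = (1, 3) \<or> (c, d) = (1, 4) \<or> (c, d) = (2, 3) \<or> (c, d) = (2, 4) \<or> (c, d) = (3, 4)"
      | "(d, c) = (1, 2) \<or> (d, c) = (1, 3) \<or> (d, c) = (1, 4) \<or> (d, c) = (2, 3) \<or> (d, c) = (2, 4) \<or> (d, c) = (3, 4)"
      using exhaust_4[of c] exhaust_4[of d] by (elim disjE) simp_all
    then show ?thesis
    proof cases
      case 1
      then show ?thesis using flip[of ?p c c] Wt_anti[of ?p c c] by simp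
    next
      case 2
      then show ?thesis using Rup_table by blast
    next
      case 3
      from Rup_table[OF 3, THEN spec, THEN spec, of ?p a b] show ?thesis
        unfolding flip[of ?p c d] Wt_anti[of ?p c d] by simp
    qed
  qed
  then show ?thesis
    by (simp add: weyl_def riemann_def riemann_up_g0[OF v] schouten_g0[OF v] g0_nth)
qed

lemma weyl_symmetric_g0: "v \<in> U \<Longrightarrow> weyl_symmetric (weyl g0 v)"
  unfolding weyl_symmetric_def weyl_g0 Wt_def w12_def w23_def by (auto simp: algebra_simps)

lemma weyl_trace_g0: "v \<in> U \<Longrightarrow> ctr g0 v (\<lambda>a b. weyl g0 v a c b d) = 0"
proof -
  have "\<forall>c d. (\<Sum>a\<in>UNIV. \<Sum>b\<in>UNIV. git p a b * Wt p a c b d) = 0" for p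
    unfolding forall_4 Wt_def w12_def w23_def
    by (intro conjI) (simp_all add: sum_4 git_def e_defs th_defs i field_simps del: One_nat_def)
  then show "v \<in> U \<Longrightarrow> ctr g0 v (\<lambda>a b. weyl g0 v a c b d) = 0"
    by (simp add: ctr_def ginv_g0 weyl_g0)
qed

section \<open>Divergence of the Weyl tensor and Bach tensor of the base metric\<close>

definition w13 :: "real \<Rightarrow> 4 \<Rightarrow> 4 \<Rightarrow> real" where "w13 p a b = th1 p a * th3 p b - th3 p a * th1 p b"
definition w24 :: "real \<Rightarrow> 4 \<Rightarrow> 4 \<Rightarrow> real" where "w24 p a b = th2 p a * th4 p b - th4 p a * th2 p b"

definition dw12 :: "real \<Rightarrow> 4 \<Rightarrow> 4 \<Rightarrow> real" where "dw12 p a b = th1 p a * dth2 b - dth2 a * th1 p b"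
definition dw23 :: "real \<Rightarrow> 4 \<Rightarrow> 4 \<Rightarrow> real" where
  "dw23 p a b = dth2 a * th3 p b + th2 p a * dth3 p b - dth3 p a * th2 p b - th3 p a * dth2 b"

text \<open>The connection one-form that scales \<open>\<omega>\<^sup>1\<^sup>2\<close> and, with the opposite sign, \<open>\<omega>\<^sup>2\<^sup>3\<close>. The covariant derivatives of
  these forms stay in the space of two-forms of the same duality.\<close>

definition conn :: "real \<Rightarrow> 4 \<Rightarrow> real" where
  "conn p e = - H 1 p * th1 p e - H 2 p / 4 * th2 p e + th4 p e / 2"

lemma nabla_w12: "(if e = 3 then dw12 p a b else 0) - (\<Sum>m\<in>UNIV. Gm p m e a * w12 p m b + Gm p m e b * w12 p a m)
    = conn p e * w12 p a b + th1 p e / 2 * (w13 p a b - w24 p a b)"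
proof -
  have "\<forall>e a b. (if e = 3 then dw12 p a b else 0) - (\<Sum>m\<in>UNIV. Gm p m e a * w12 p m b + Gm p m e b * w12 p a m)
    = conn p e * w12 p a b + th1 p e / 2 * (w13 p a b - w24 p a b)"
    unfolding forall_4
    by (intro conjI) (simp_all add: sum_4 Gm_eval conn_def w12_def w13_def w24_def dw12_def th_defs dth2_def
        i field_simps del: One_nat_def)
  then show ?thesis by blast
qed

lemma nabla_w23: "(if e = 3 then dw23 p a b else 0) - (\<Sum>m\<in>UNIV. Gm p m e a * w23 p m b + Gm p m e b * w23 p a m)
    = - conn p e * w23 p a b - th3 p e / 2 * (w13 p a b + w24 p a b)"
proof -
  have "\<forall>e a b. (if e = 3 then dw23 p a b else 0) - (\<Sum>m\<in>UNIV. Gm p m e a * w23 p m b + Gm p m e b * w23 p a m)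
    = - conn p e * w23 p a b - th3 p e / 2 * (w13 p a b + w24 p a b)"
    unfolding forall_4
    by (intro conjI) (simp_all add: sum_4 Gm_eval conn_def w23_def w13_def w24_def dw23_def th_defs dth2_def dth3_def
        i field_simps del: One_nat_def)
  then show ?thesis by blast
qed

text \<open>The coefficients of the divergence of the Weyl tensor: \<open>al = h\<^sup>2 h''''/6\<close> with its first two
  derivatives, and \<open>be = (h h''''' + 2 h' h'''') / 6\<close> with its derivative.\<close>

definition al :: "real \<Rightarrow> real" where "al p = H 0 p * H 0 p * H 4 p / 6"
definition al1 :: "real \<Rightarrow> real" where "al1 p = (2 * H 0 p * H 1 p * H 4 p + H 0 p * H 0 p * H 5 p) / 6"
definition al2 :: "real \<Rightarrow> real" where
  "al2 p = (2 * H 1 p * H 1 p * H 4 p + 2 * H 0 p * H 2 p * H 4 p + 4 * H 0 p * H 1 p * H 5 p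
     + H 0 p * H 0 p * H 6 p) / 6"
definition be :: "real \<Rightarrow> real" where "be p = (H 0 p * H 5 p + 2 * H 1 p * H 4 p) / 6"
definition be1 :: "real \<Rightarrow> real" where
  "be1 p = (3 * H 1 p * H 5 p + H 0 p * H 6 p + 2 * H 2 p * H 4 p) / 6"

lemma coefficients_deriv:
  assumes "p \<in> I"
  shows "(al has_real_derivative al1 p) (at p)" "(al1 has_real_derivative al2 p) (at p)"
    "(be has_real_derivative be1 p) (at p)"
  unfolding al_def[abs_def] al1_def[abs_def] be_def[abs_def] al1_def al2_def be1_def
  by (rule DERIV_cong, (rule DERIV_add DERIV_diff DERIV_minus DERIV_cdivide DERIV_const DERIV_mult
        DERIV_ident H_deriv[OF assms])+, simp add: field_simps del: One_nat_def)+

lemma w_deriv: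
  assumes "p \<in> I"
  shows "((\<lambda>p. w12 p a b) has_real_derivative dw12 p a b) (at p)"
    "((\<lambda>p. w23 p a b) has_real_derivative dw23 p a b) (at p)"
  unfolding w12_def dw12_def w23_def dw23_def
  by (rule DERIV_cong, (rule DERIV_add DERIV_diff DERIV_mult th_deriv[OF assms])+, simp)+

text \<open>The divergence of the Weyl tensor and its \<open>p\<close>-derivative.\<close>

definition Dt :: "real \<Rightarrow> 4 \<Rightarrow> 4 \<Rightarrow> 4 \<Rightarrow> real" where
  "Dt p a c b = w12 p a c * (- (al p / 2) * th1 p b - al1 p * th2 p b)
     + w23 p a c * (be p * th2 p b - H 4 p / 12 * th3 p b)"

definition dDt :: "real \<Rightarrow> 4 \<Rightarrow> 4 \<Rightarrow> 4 \<Rightarrow> real" where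
  "dDt p a c b = dw12 p a c * (- (al p / 2) * th1 p b - al1 p * th2 p b)
     + w12 p a c * (- (al1 p / 2) * th1 p b - al2 p * th2 p b - al1 p * dth2 b)
     + dw23 p a c * (be p * th2 p b - H 4 p / 12 * th3 p b)
     + w23 p a c * (be1 p * th2 p b + be p * dth2 b - H 5 p / 12 * th3 p b - H 4 p / 12 * dth3 p b)"

lemma Dt_deriv:
  assumes "p \<in> I" shows "((\<lambda>p. Dt p a c b) has_real_derivative dDt p a c b) (at p)"
  unfolding Dt_def dDt_def
  by (rule DERIV_cong, (rule DERIV_add DERIV_diff DERIV_minus DERIV_mult DERIV_cdivide th_deriv[OF assms]
        w_deriv[OF assms] coefficients_deriv[OF assms] H_deriv[OF assms])+, simp add: field_simps del: One_nat_def)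

text \<open>The covariant derivative of the Weyl tensor.\<close>

definition NWt :: "real \<Rightarrow> 4 \<Rightarrow> 4 \<Rightarrow> 4 \<Rightarrow> 4 \<Rightarrow> 4 \<Rightarrow> real" where
  "NWt p e a b c d =
     (al1 p * (th3 p e + H 0 p * th1 p e) + 2 * al p * conn p e) * (w12 p a b * w12 p c d)
     + al p / 2 * th1 p e * ((w13 p a b - w24 p a b) * w12 p c d + w12 p a b * (w13 p c d - w24 p c d))
     + (H 5 p / 6 * (th3 p e + H 0 p * th1 p e) - H 4 p / 3 * conn p e) * (w23 p a b * w23 p c d)
     - H 4 p / 12 * th3 p e * ((w13 p a b + w24 p a b) * w23 p c d + w23 p a b * (w13 p c d + w24 p c d))"

lemma nabla_weyl_g0:
  assumes v: "v \<in> U"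
  shows "nabla4 g0 (weyl g0) v e a b c d = NWt (v $ 3) e a b c d"
proof -
  define p where "p = v $ 3"
  have p: "p \<in> I" using UI[OF v] by (simp add: p_def)
  let ?one = "\<lambda>x. if e = 3 then x else (0::real)"
  let ?dW = "al1 p * (w12 p a b * w12 p c d) + al p * (dw12 p a b * w12 p c d + w12 p a b * dw12 p c d)
     + H 5 p / 6 * (w23 p a b * w23 p c d) + H 4 p / 6 * (dw23 p a b * w23 p c d + w23 p a b * dw23 p c d)"
  have "((\<lambda>p. Wt p a b c d) has_real_derivative ?dW) (at p)"
    unfolding Wt_def al_def[symmetric]
    by (rule DERIV_cong, (rule DERIV_add DERIV_mult DERIV_cdivide w_deriv[OF p] coefficients_deriv[OF p]
          H_deriv[OF p])+, simp add: field_simps del: One_nat_def)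
  then have "pd e (\<lambda>u. Wt (u $ 3) a b c d) v = ?one ?dW"
    unfolding p_def by (subst pd_coord_fun[where F' = "\<lambda>_. ?dW"]) (simp_all add: p_def)
  moreover have "pd e (\<lambda>u. weyl g0 u a b c d) v = pd e (\<lambda>u. Wt (u $ 3) a b c d) v"
    by (rule pd_cong[OF U v]) (rule weyl_g0)
  ultimately have pd: "pd e (\<lambda>u. weyl g0 u a b c d) v = ?one ?dW" by simp
  have dp: "?one 1 = th3 p e + H 0 p * th1 p e"
    using exhaust_4[of e] by (auto simp: th_defs)
  have "nabla4 g0 (weyl g0) v e a b c d
      = al1 p * ?one 1 * (w12 p a b * w12 p c d)
      + al p * ((?one (dw12 p a b) - (\<Sum>m\<in>UNIV. Gm p m e a * w12 p m b + Gm p m e b * w12 p a m)) * w12 p c d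
          + w12 p a b * (?one (dw12 p c d) - (\<Sum>m\<in>UNIV. Gm p m e c * w12 p m d + Gm p m e d * w12 p c m)))
      + H 5 p / 6 * ?one 1 * (w23 p a b * w23 p c d)
      + H 4 p / 6 * ((?one (dw23 p a b) - (\<Sum>m\<in>UNIV. Gm p m e a * w23 p m b + Gm p m e b * w23 p a m)) * w23 p c d
          + w23 p a b * (?one (dw23 p c d) - (\<Sum>m\<in>UNIV. Gm p m e c * w23 p m d + Gm p m e d * w23 p c m)))"
    unfolding nabla4_def pd weyl_g0[OF v] christoffel_g0[OF v] p_def[symmetric] Wt_def al_def sum_4
    by (cases "e = 3") (simp_all add: field_simps del: One_nat_def)
  also have "\<dots> = NWt p e a b c d"
    unfolding dp nabla_w12 nabla_w23 NWt_def by (simp add: field_simps)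
  finally show ?thesis by (simp add: p_def)
qed

lemma div_weyl_table: "(\<Sum>d\<in>UNIV. \<Sum>e\<in>UNIV. git p d e * NWt p e a c b d) = Dt p a c b"
proof -
  have "\<forall>b. (\<Sum>d\<in>UNIV. \<Sum>e\<in>UNIV. git p d e *
       ((al1 p * (th3 p e + H 0 p * th1 p e) + 2 * al p * conn p e) * (x12 * w12 p b d)
     + al p / 2 * th1 p e * ((x13 - x24) * w12 p b d + x12 * (w13 p b d - w24 p b d))
     + (H 5 p / 6 * (th3 p e + H 0 p * th1 p e) - H 4 p / 3 * conn p e) * (x23 * w23 p b d)
     - H 4 p / 12 * th3 p e * ((x13 + x24) * w23 p b d + x23 * (w13 p b d + w24 p b d))))
     = x12 * (- (al p / 2) * th1 p b - al1 p * th2 p b) + x23 * (be p * th2 p b - H 4 p / 12 * th3 p b)"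
    for x12 x13 x24 x23
    unfolding forall_4
    by (intro conjI) (simp_all add: sum_4 git_def conn_def be_def w12_def w23_def w13_def w24_def e_defs th_defs
        i field_simps del: One_nat_def)
  then show ?thesis unfolding NWt_def Dt_def by blast
qed

lemma div_weyl_g0: "v \<in> U \<Longrightarrow> div_weyl g0 v a c b = Dt (v $ 3) a c b"
  by (simp add: div_weyl_def ginv_g0 nabla_weyl_g0 div_weyl_table)

text \<open>The contraction \<open>R\<^sup>c\<^sup>d C\<^sub>a\<^sub>c\<^sub>b\<^sub>d\<close>.\<close>

definition RWt :: "real \<Rightarrow> 4 \<Rightarrow> 4 \<Rightarrow> real" where
  "RWt p a b = - (al p / 2) * (th1 p a * th1 p b) - H 4 p / 12 * (th3 p a * th3 p b)"

lemma ricci_weyl_table: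
  "(\<Sum>c\<in>UNIV. \<Sum>m\<in>UNIV. git p c m * (\<Sum>d\<in>UNIV. \<Sum>n\<in>UNIV. git p d n
     * ((2 * St p m n - H 2 p / 4 * gt p m n) * Wt p a c b d))) = RWt p a b"
proof -
  \<comment> \<open>Only \<open>m\<close> is instantiated: the values at \<open>a\<close> and \<open>b\<close> enter as constants.\<close>
  have "\<forall>m. (\<Sum>d\<in>UNIV. \<Sum>n\<in>UNIV. git p d n * ((2 * St p m n - H 2 p / 4 * gt p m n)
        * (u * (b1 * th2 p d - b2 * th1 p d) + w * (b2 * th3 p d - b3 * th2 p d))))
      = u * (b1 * (th4 p m / 2 - H 2 p / 4 * th2 p m) + b2 * (H 2 p / 2 * th1 p m + H 3 p / 6 * th2 p m))
      + w * (b2 * (H 0 p * H 3 p / 6 * th2 p m - H 2 p / 2 * th3 p m) - b3 * (th4 p m / 2 - H 2 p / 4 * th2 p m))"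
    for u w b1 b2 b3
    unfolding forall_4
    by (intro conjI) (simp_all add: sum_4 git_def St_def gt_def e_defs th_defs i field_simps del: One_nat_def)
  then have inner: "(\<Sum>d\<in>UNIV. \<Sum>n\<in>UNIV. git p d n * ((2 * St p m n - H 2 p / 4 * gt p m n)
        * (u * (b1 * th2 p d - b2 * th1 p d) + w * (b2 * th3 p d - b3 * th2 p d))))
      = u * (b1 * (th4 p m / 2 - H 2 p / 4 * th2 p m) + b2 * (H 2 p / 2 * th1 p m + H 3 p / 6 * th2 p m))
      + w * (b2 * (H 0 p * H 3 p / 6 * th2 p m - H 2 p / 2 * th3 p m) - b3 * (th4 p m / 2 - H 2 p / 4 * th2 p m))"
    for m u w b1 b2 b3 by blast
  have outer: "(\<Sum>c\<in>UNIV. \<Sum>m\<in>UNIV. git p c m *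
        (s * (a1 * th2 p c - a2 * th1 p c) * (b1 * (th4 p m / 2 - H 2 p / 4 * th2 p m)
          + b2 * (H 2 p / 2 * th1 p m + H 3 p / 6 * th2 p m))
       + t * (a2 * th3 p c - a3 * th2 p c) * (b2 * (H 0 p * H 3 p / 6 * th2 p m - H 2 p / 2 * th3 p m)
          - b3 * (th4 p m / 2 - H 2 p / 4 * th2 p m))))
      = - (s / 2) * (a1 * b1) - t / 2 * (a3 * b3)" for s t a1 a2 a3 b1 b2 b3
    by (simp add: sum_4 git_def e_defs th_defs i field_simps del: One_nat_def)
  have W: "Wt p a c b d = al p * (th1 p a * th2 p c - th2 p a * th1 p c) * (th1 p b * th2 p d - th2 p b * th1 p d)
      + H 4 p / 6 * (th2 p a * th3 p c - th3 p a * th2 p c) * (th2 p b * th3 p d - th3 p b * th2 p d)" for c d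
    by (simp add: Wt_def al_def w12_def w23_def)
  show ?thesis
    unfolding W inner outer RWt_def by simp
qed

text \<open>The covariant derivatives of \<open>\<theta>\<^sup>1\<close>, \<open>\<theta>\<^sup>2\<close> and \<open>\<theta>\<^sup>3\<close>.\<close>

lemma nabla_th:
  "0 - (\<Sum>m\<in>UNIV. Gm p m e b * th1 p m)
    = conn p e * th1 p b + th1 p e * (th4 p b / 2 - H 2 p / 4 * th2 p b) - H 3 p / 6 * (th2 p e * th2 p b)"
  "(if e = 3 then dth2 b else 0) - (\<Sum>m\<in>UNIV. Gm p m e b * th2 p m)
    = (th1 p e * th3 p b - th3 p e * th1 p b) / 2"
  "(if e = 3 then dth3 p b else 0) - (\<Sum>m\<in>UNIV. Gm p m e b * th3 p m)
    = - conn p e * th3 p b + th3 p e * (H 2 p / 4 * th2 p b - th4 p b / 2) - H 0 p * H 3 p / 6 * (th2 p e * th2 p b)"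
proof -
  have "\<forall>e b. 0 - (\<Sum>m\<in>UNIV. Gm p m e b * th1 p m)
      = conn p e * th1 p b + th1 p e * (th4 p b / 2 - H 2 p / 4 * th2 p b) - H 3 p / 6 * (th2 p e * th2 p b)"
    "\<forall>e b. (if e = 3 then dth2 b else 0) - (\<Sum>m\<in>UNIV. Gm p m e b * th2 p m)
      = (th1 p e * th3 p b - th3 p e * th1 p b) / 2"
    "\<forall>e b. (if e = 3 then dth3 p b else 0) - (\<Sum>m\<in>UNIV. Gm p m e b * th3 p m)
      = - conn p e * th3 p b + th3 p e * (H 2 p / 4 * th2 p b - th4 p b / 2) - H 0 p * H 3 p / 6 * (th2 p e * th2 p b)"
    unfolding forall_4
    by (intro conjI; simp add: sum_4 Gm_eval conn_def th_defs dth2_def dth3_def i field_simps del: One_nat_def)+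
  then show "0 - (\<Sum>m\<in>UNIV. Gm p m e b * th1 p m)
      = conn p e * th1 p b + th1 p e * (th4 p b / 2 - H 2 p / 4 * th2 p b) - H 3 p / 6 * (th2 p e * th2 p b)"
    "(if e = 3 then dth2 b else 0) - (\<Sum>m\<in>UNIV. Gm p m e b * th2 p m)
      = (th1 p e * th3 p b - th3 p e * th1 p b) / 2"
    "(if e = 3 then dth3 p b else 0) - (\<Sum>m\<in>UNIV. Gm p m e b * th3 p m)
      = - conn p e * th3 p b + th3 p e * (H 2 p / 4 * th2 p b - th4 p b / 2) - H 0 p * H 3 p / 6 * (th2 p e * th2 p b)"
    by blast+
qed

text \<open>\<open>dp = \<theta>\<^sup>3 + h \<theta>\<^sup>1\<close>.\<close>

lemma dp_frame: "(if e = 3 then 1 else 0) = th3 p e + H 0 p * th1 p e"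
  using exhaust_4[of e] by (auto simp: th_defs)

text \<open>The second divergence of the Weyl tensor. Together with half of \<open>RWt\<close> only the term with
  \<open>(h\<^sup>2 h'''')''\<close> survives.\<close>

lemma div_D_table: "(\<Sum>c\<in>UNIV. \<Sum>e\<in>UNIV. git p c e * ((if e = 3 then dDt p a c b else 0)
     - (\<Sum>m\<in>UNIV. Gm p m e a * Dt p m c b + Gm p m e c * Dt p a m b + Gm p m e b * Dt p a c m)))
     = 2 * al2 p * (th2 p a * th2 p b) - RWt p a b / 2"
proof -
  let ?one = "\<lambda>e x. if e = 3 then x else (0::real)"
  have nabla_D: "?one e (dDt p a c b)
     - (\<Sum>m\<in>UNIV. Gm p m e a * Dt p m c b + Gm p m e c * Dt p a m b + Gm p m e b * Dt p a c m)
     = (?one e (dw12 p a c) - (\<Sum>m\<in>UNIV. Gm p m e a * w12 p m c + Gm p m e c * w12 p a m))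
         * (- (al p / 2) * th1 p b - al1 p * th2 p b)
     + w12 p a c * (- (?one e 1 * al1 p / 2) * th1 p b - al p / 2 * (0 - (\<Sum>m\<in>UNIV. Gm p m e b * th1 p m))
         - ?one e 1 * al2 p * th2 p b - al1 p * (?one e (dth2 b) - (\<Sum>m\<in>UNIV. Gm p m e b * th2 p m)))
     + (?one e (dw23 p a c) - (\<Sum>m\<in>UNIV. Gm p m e a * w23 p m c + Gm p m e c * w23 p a m))
         * (be p * th2 p b - H 4 p / 12 * th3 p b)
     + w23 p a c * (?one e 1 * be1 p * th2 p b + be p * (?one e (dth2 b) - (\<Sum>m\<in>UNIV. Gm p m e b * th2 p m))
         - ?one e 1 * H 5 p / 12 * th3 p b - H 4 p / 12 * (?one e (dth3 p b) - (\<Sum>m\<in>UNIV. Gm p m e b * th3 p m)))"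
    for e c
    unfolding Dt_def dDt_def sum_4 by (cases "e = 3") (simp_all add: algebra_simps)
  have contract12: "(\<Sum>c\<in>UNIV. \<Sum>e\<in>UNIV. git p c e * (w12 p a c *
      (F1 * th1 p e + F2 * th2 p e + F3 * th3 p e + F4 * th4 p e))) = - F4 * th1 p a - F3 * th2 p a"
    and contract23: "(\<Sum>c\<in>UNIV. \<Sum>e\<in>UNIV. git p c e * (w23 p a c *
      (F1 * th1 p e + F2 * th2 p e + F3 * th3 p e + F4 * th4 p e))) = F1 * th2 p a + F4 * th3 p a"
    for F1 F2 F3 F4
  proof -
    have "(\<Sum>c\<in>UNIV. \<Sum>e\<in>UNIV. git p c e * ((a1 * th2 p c - a2 * th1 p c) *
      (F1 * th1 p e + F2 * th2 p e + F3 * th3 p e + F4 * th4 p e))) = - F4 * a1 - F3 * a2"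
      "(\<Sum>c\<in>UNIV. \<Sum>e\<in>UNIV. git p c e * ((a2 * th3 p c - a3 * th2 p c) *
      (F1 * th1 p e + F2 * th2 p e + F3 * th3 p e + F4 * th4 p e))) = F1 * a2 + F4 * a3" for a1 a2 a3
      by (simp_all add: sum_4 git_def e_defs th_defs i field_simps del: One_nat_def)
    then show "(\<Sum>c\<in>UNIV. \<Sum>e\<in>UNIV. git p c e * (w12 p a c *
      (F1 * th1 p e + F2 * th2 p e + F3 * th3 p e + F4 * th4 p e))) = - F4 * th1 p a - F3 * th2 p a"
      "(\<Sum>c\<in>UNIV. \<Sum>e\<in>UNIV. git p c e * (w23 p a c *
      (F1 * th1 p e + F2 * th2 p e + F3 * th3 p e + F4 * th4 p e))) = F1 * th2 p a + F4 * th3 p a"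
      unfolding w12_def w23_def by blast+
  qed
  have div12: "(\<Sum>c\<in>UNIV. \<Sum>e\<in>UNIV. git p c e * (conn p e * w12 p a c + th1 p e / 2 * (w13 p a c - w24 p a c))) = 0"
    and div23: "(\<Sum>c\<in>UNIV. \<Sum>e\<in>UNIV. git p c e * (- conn p e * w23 p a c - th3 p e / 2 * (w13 p a c + w24 p a c)))
      = H 1 p * th2 p a"
  proof -
    have "(\<Sum>c\<in>UNIV. \<Sum>e\<in>UNIV. git p c e * (conn p e * (a1 * th2 p c - a2 * th1 p c)
        + th1 p e / 2 * ((a1 * th3 p c - a3 * th1 p c) - (a2 * th4 p c - a4 * th2 p c)))) = 0"
      "(\<Sum>c\<in>UNIV. \<Sum>e\<in>UNIV. git p c e * (- conn p e * (a2 * th3 p c - a3 * th2 p c)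
        - th3 p e / 2 * ((a1 * th3 p c - a3 * th1 p c) + (a2 * th4 p c - a4 * th2 p c)))) = H 1 p * a2" for a1 a2 a3 a4
      by (simp_all add: sum_4 git_def conn_def e_defs th_defs i field_simps del: One_nat_def)
    then show "(\<Sum>c\<in>UNIV. \<Sum>e\<in>UNIV. git p c e * (conn p e * w12 p a c + th1 p e / 2 * (w13 p a c - w24 p a c))) = 0"
      "(\<Sum>c\<in>UNIV. \<Sum>e\<in>UNIV. git p c e * (- conn p e * w23 p a c - th3 p e / 2 * (w13 p a c + w24 p a c)))
      = H 1 p * th2 p a"
      unfolding w12_def w23_def w13_def w24_def by blast+
  qed
  \<comment> \<open>By the contraction rules only the coefficients of \<open>\<theta>\<^sup>3\<close>, \<open>\<theta>\<^sup>4\<close> along \<open>\<omega>\<^sup>1\<^sup>2\<close> and of \<open>\<theta>\<^sup>1\<close>, \<open>\<theta>\<^sup>4\<close> along \<open>\<omega>\<^sup>2\<^sup>3\<close>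
    matter.\<close>
  define x where "x = - (al p / 2) * th1 p b - al1 p * th2 p b"
  define y where "y = be p * th2 p b - H 4 p / 12 * th3 p b"
  define F1 where "F1 = - H 0 p * al1 p / 2 * th1 p b - al p / 2 * (th4 p b / 2 - H 2 p / 4 * th2 p b - H 1 p * th1 p b)
    - H 0 p * al2 p * th2 p b - al1 p / 2 * th3 p b"
  define F2 where "F2 = al p / 2 * (H 2 p / 4 * th1 p b + H 3 p / 6 * th2 p b)"
  define G1 where "G1 = H 0 p * be1 p * th2 p b + be p / 2 * th3 p b - H 0 p * H 5 p / 12 * th3 p b
    - H 4 p / 12 * (H 1 p * th3 p b)"
  define G2 where "G2 = - H 4 p / 12 * (H 2 p / 4 * th3 p b - H 0 p * H 3 p / 6 * th2 p b)"
  define G3 where "G3 = be1 p * th2 p b - be p / 2 * th1 p b - H 5 p / 12 * th3 p b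
    - H 4 p / 12 * (H 2 p / 4 * th2 p b - th4 p b / 2)"
  have "?one e (dDt p a c b)
     - (\<Sum>m\<in>UNIV. Gm p m e a * Dt p m c b + Gm p m e c * Dt p a m b + Gm p m e b * Dt p a c m)
     = x * (conn p e * w12 p a c + th1 p e / 2 * (w13 p a c - w24 p a c))
     + w12 p a c * (F1 * th1 p e + F2 * th2 p e + (- al2 p * th2 p b) * th3 p e + (- al p / 4 * th1 p b) * th4 p e)
     + y * (- conn p e * w23 p a c - th3 p e / 2 * (w13 p a c + w24 p a c))
     + w23 p a c * (G1 * th1 p e + G2 * th2 p e + G3 * th3 p e + (H 4 p / 24 * th3 p b) * th4 p e)" for e c
  proof -
    have "- ((th3 p e + H 0 p * th1 p e) * al1 p / 2) * th1 p b
         - al p / 2 * (conn p e * th1 p b + th1 p e * (th4 p b / 2 - H 2 p / 4 * th2 p b) - H 3 p / 6 * (th2 p e * th2 p b))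
         - (th3 p e + H 0 p * th1 p e) * al2 p * th2 p b - al1 p * ((th1 p e * th3 p b - th3 p e * th1 p b) / 2)
       = F1 * th1 p e + F2 * th2 p e + (- al2 p * th2 p b) * th3 p e + (- al p / 4 * th1 p b) * th4 p e"
      unfolding F1_def F2_def conn_def by (simp add: field_simps del: One_nat_def)
    moreover have "(th3 p e + H 0 p * th1 p e) * be1 p * th2 p b + be p * ((th1 p e * th3 p b - th3 p e * th1 p b) / 2)
         - (th3 p e + H 0 p * th1 p e) * H 5 p / 12 * th3 p b
         - H 4 p / 12 * (- conn p e * th3 p b + th3 p e * (H 2 p / 4 * th2 p b - th4 p b / 2)
             - H 0 p * H 3 p / 6 * (th2 p e * th2 p b))
       = G1 * th1 p e + G2 * th2 p e + G3 * th3 p e + (H 4 p / 24 * th3 p b) * th4 p e"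
      unfolding G1_def G2_def G3_def conn_def by (simp add: field_simps del: One_nat_def)
    ultimately show ?thesis
      unfolding nabla_D nabla_w12 nabla_w23 nabla_th dp_frame[of _ p] x_def y_def by simp
  qed
  then have "(\<Sum>c\<in>UNIV. \<Sum>e\<in>UNIV. git p c e * (?one e (dDt p a c b)
     - (\<Sum>m\<in>UNIV. Gm p m e a * Dt p m c b + Gm p m e c * Dt p a m b + Gm p m e b * Dt p a c m)))
     = x * (\<Sum>c\<in>UNIV. \<Sum>e\<in>UNIV. git p c e * (conn p e * w12 p a c + th1 p e / 2 * (w13 p a c - w24 p a c)))
     + (\<Sum>c\<in>UNIV. \<Sum>e\<in>UNIV. git p c e * (w12 p a c *
         (F1 * th1 p e + F2 * th2 p e + (- al2 p * th2 p b) * th3 p e + (- al p / 4 * th1 p b) * th4 p e)))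
     + y * (\<Sum>c\<in>UNIV. \<Sum>e\<in>UNIV. git p c e * (- conn p e * w23 p a c - th3 p e / 2 * (w13 p a c + w24 p a c)))
     + (\<Sum>c\<in>UNIV. \<Sum>e\<in>UNIV. git p c e * (w23 p a c *
         (G1 * th1 p e + G2 * th2 p e + G3 * th3 p e + (H 4 p / 24 * th3 p b) * th4 p e)))"
    by (simp only: distrib_left sum.distrib sum_distrib_left mult.left_commute[of x] mult.left_commute[of y])
  also have "\<dots> = 2 * al2 p * (th2 p a * th2 p b) - RWt p a b / 2"
    unfolding contract12 contract23 div12 div23 y_def G1_def RWt_def al2_def be_def be1_def
    by (simp add: field_simps del: One_nat_def)
  finally show ?thesis .
qed

lemma bach_g0:
  assumes v: "v \<in> U"
  shows "bach g0 v a b = 2 * al2 (v $ 3) * (th2 (v $ 3) a * th2 (v $ 3) b)"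
proof -
  define p where "p = v $ 3"
  have p: "p \<in> I" using UI[OF v] by (simp add: p_def)
  have pd: "pd e (\<lambda>u. div_weyl g0 u a c b) v = (if e = 3 then dDt p a c b else 0)" for e a c b
  proof -
    have "pd e (\<lambda>u. div_weyl g0 u a c b) v = pd e (\<lambda>u. Dt (u $ 3) a c b) v"
      by (rule pd_cong[OF U v]) (rule div_weyl_g0)
    also have "\<dots> = (if e = 3 then dDt p a c b else 0)"
      unfolding p_def
      by (rule pd_coord_fun[where F' = "\<lambda>p. dDt p a c b"]) (rule Dt_deriv[OF UI[OF v]])
    finally show ?thesis .
  qed
  have "\<forall>a b. (\<Sum>c\<in>UNIV. \<Sum>e\<in>UNIV. git p c e * ((if e = 3 then dDt p a c b else 0)
     - (\<Sum>m\<in>UNIV. Gm p m e a * Dt p m c b + Gm p m e c * Dt p a m b + Gm p m e b * Dt p a c m)))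
     + 1 / 2 * (\<Sum>c\<in>UNIV. \<Sum>m\<in>UNIV. git p c m * (\<Sum>d\<in>UNIV. \<Sum>n\<in>UNIV. git p d n
         * ((2 * St p m n - H 2 p / 4 * gt p m n) * Wt p a c b d)))
     = 2 * al2 p * (th2 p a * th2 p b)"
    unfolding ricci_weyl_table div_D_table by simp
  then show ?thesis
    unfolding bach_ctr ctr_def nabla3_def pd div_weyl_g0[OF v] christoffel_g0[OF v] ricci_g0[OF v] weyl_g0[OF v]
      ginv_g0 p_def by blast
qed

end

section \<open>The Hodge star and Petrov types\<close>

lemma det_4:
  fixes A :: "'a::comm_ring_1^4^4"
  shows "det A =
     A$1$1 * (A$2$2 * (A$3$3 * A$4$4 - A$3$4 * A$4$3) - A$2$3 * (A$3$2 * A$4$4 - A$3$4 * A$4$2)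
       + A$2$4 * (A$3$2 * A$4$3 - A$3$3 * A$4$2))
   - A$1$2 * (A$2$1 * (A$3$3 * A$4$4 - A$3$4 * A$4$3) - A$2$3 * (A$3$1 * A$4$4 - A$3$4 * A$4$1)
       + A$2$4 * (A$3$1 * A$4$3 - A$3$3 * A$4$1))
   + A$1$3 * (A$2$1 * (A$3$2 * A$4$4 - A$3$4 * A$4$2) - A$2$2 * (A$3$1 * A$4$4 - A$3$4 * A$4$1)
       + A$2$4 * (A$3$1 * A$4$2 - A$3$2 * A$4$1))
   - A$1$4 * (A$2$1 * (A$3$2 * A$4$3 - A$3$3 * A$4$2) - A$2$2 * (A$3$1 * A$4$3 - A$3$3 * A$4$1)
       + A$2$3 * (A$3$1 * A$4$2 - A$3$2 * A$4$1))"
proof -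
  have f1234: "finite {2::4, 3, 4}" "1 \<notin> {2::4, 3, 4}" and f234: "finite {3::4, 4}" "2 \<notin> {3::4, 4}"
    and f34: "finite {4::4}" "3 \<notin> {4::4}"
    by auto
  show ?thesis
    unfolding det_def UNIV_4
    unfolding sum_over_permutations_insert[OF f1234]
    unfolding sum_over_permutations_insert[OF f234]
    unfolding sum_over_permutations_insert[OF f34]
    unfolding permutes_sing
    by (simp add: sign_swap_id permutation_swap_id permutation_compose sign_compose sign_id swap_id_eq algebra_simps)
qed

lemma vector_4: "(vector [x, y, z, t] :: 'a::zero^4) $ 1 = x" "(vector [x, y, z, t] :: 'a^4) $ 2 = y"
  "(vector [x, y, z, t] :: 'a^4) $ 3 = z" "(vector [x, y, z, t] :: 'a^4) $ 4 = t"
  unfolding vector_def by simp_all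

lemma sum_swap4:
  "(\<Sum>c\<in>C. \<Sum>d\<in>D. \<Sum>m\<in>M. \<Sum>n\<in>N. T c d m n) = (\<Sum>m\<in>M. \<Sum>n\<in>N. \<Sum>c\<in>C. \<Sum>d\<in>D. T c d m n)"
proof -
  have "(\<Sum>c\<in>C. \<Sum>d\<in>D. \<Sum>m\<in>M. \<Sum>n\<in>N. T c d m n) = (\<Sum>c\<in>C. \<Sum>m\<in>M. \<Sum>d\<in>D. \<Sum>n\<in>N. T c d m n)"
    by (intro sum.cong refl sum.swap)
  also have "\<dots> = (\<Sum>m\<in>M. \<Sum>c\<in>C. \<Sum>d\<in>D. \<Sum>n\<in>N. T c d m n)" by (rule sum.swap)
  also have "\<dots> = (\<Sum>m\<in>M. \<Sum>c\<in>C. \<Sum>n\<in>N. \<Sum>d\<in>D. T c d m n)"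
    by (intro sum.cong refl sum.swap)
  also have "\<dots> = (\<Sum>m\<in>M. \<Sum>n\<in>N. \<Sum>c\<in>C. \<Sum>d\<in>D. T c d m n)"
    by (intro sum.cong refl sum.swap)
  finally show ?thesis .
qed

lemma sum_contract2:
  fixes L G :: "'i::finite \<Rightarrow> 'i \<Rightarrow> real"
  shows "(\<Sum>c\<in>UNIV. \<Sum>d\<in>UNIV. (\<Sum>m\<in>UNIV. \<Sum>n\<in>UNIV. L m n * (G m c * G n d)) * (x c * y d))
    = (\<Sum>m\<in>UNIV. \<Sum>n\<in>UNIV. L m n * ((\<Sum>c\<in>UNIV. G m c * x c) * (\<Sum>d\<in>UNIV. G n d * y d)))"
  unfolding sum_distrib_right
  by (rule trans[OF sum_swap4]) (simp add: sum_product sum_distrib_left mult_ac)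

lemma levi_civita_swap: "levi_civita a b d c = - levi_civita a b c d"
  unfolding levi_civita_def det_4 vector_4 by (simp add: algebra_simps)

text \<open>The two-form obtained by inserting two vectors into the last slots of the Levi-Civita symbol.\<close>

definition lev :: "4 \<Rightarrow> 4 \<Rightarrow> (4 \<Rightarrow> real) \<Rightarrow> (4 \<Rightarrow> real) \<Rightarrow> real" where
  "lev a b X Y = (\<Sum>m\<in>UNIV. \<Sum>n\<in>UNIV. levi_civita a b m n * (X m * Y n))"

lemma lev_eval:
  "lev 1 1 X Y = 0" "lev 1 2 X Y = X 3 * Y 4 - X 4 * Y 3"
  "lev 1 3 X Y = X 4 * Y 2 - X 2 * Y 4" "lev 1 4 X Y = X 2 * Y 3 - X 3 * Y 2"
  "lev 2 1 X Y = X 4 * Y 3 - X 3 * Y 4" "lev 2 2 X Y = 0"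
  "lev 2 3 X Y = X 1 * Y 4 - X 4 * Y 1" "lev 2 4 X Y = X 3 * Y 1 - X 1 * Y 3"
  "lev 3 1 X Y = X 2 * Y 4 - X 4 * Y 2" "lev 3 2 X Y = X 4 * Y 1 - X 1 * Y 4"
  "lev 3 3 X Y = 0" "lev 3 4 X Y = X 1 * Y 2 - X 2 * Y 1"
  "lev 4 1 X Y = X 3 * Y 2 - X 2 * Y 3" "lev 4 2 X Y = X 1 * Y 3 - X 3 * Y 1"
  "lev 4 3 X Y = X 2 * Y 1 - X 1 * Y 2" "lev 4 4 X Y = 0"
  unfolding lev_def sum_4 levi_civita_def by (simp_all add: det_4 vector_4 axis_def)

lemma lev_swap: "lev a b Y X = - lev a b X Y"
proof -
  have "lev a b Y X = (\<Sum>n\<in>UNIV. \<Sum>m\<in>UNIV. levi_civita a b m n * (Y m * X n))"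
    unfolding lev_def by (rule sum.swap)
  also have "\<dots> = - lev a b X Y"
    unfolding lev_def sum_negf[symmetric]
    by (intro sum.cong refl) (subst levi_civita_swap, simp)
  finally show ?thesis .
qed

lemma lev_minus: "lev a b (\<lambda>m. - X m) Y = - lev a b X Y" "lev a b X (\<lambda>m. - Y m) = - lev a b X Y"
  unfolding lev_def by (simp_all add: sum_negf)

lemma independent_span3:
  fixes x y z :: "'a::real_vector"
  assumes "\<And>a b c. a *\<^sub>R x + b *\<^sub>R y + c *\<^sub>R z = 0 \<Longrightarrow> a = 0 \<and> b = 0 \<and> c = 0"
  shows "distinct [x, y, z]" "independent {x, y, z}"
    "span {x, y, z} = {a *\<^sub>R x + b *\<^sub>R y + c *\<^sub>R z | a b c. True}"
proof -
  have "x \<noteq> y" using assms[of 1 "-1" 0] by auto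
  moreover have "x \<noteq> z" using assms[of 1 0 "-1"] by auto
  moreover have "y \<noteq> z" using assms[of 0 1 "-1"] by auto
  ultimately show dist: "distinct [x, y, z]" by simp
  have "u x = 0 \<and> u y = 0 \<and> u z = 0" if "(\<Sum>v\<in>{x, y, z}. u v *\<^sub>R v) = 0" for u :: "'a \<Rightarrow> real"
    using assms[of "u x" "u y" "u z"] that dist by (simp add: add.assoc)
  then show "independent {x, y, z}"
    by (auto simp: dependent_finite)
  show "span {x, y, z} = {a *\<^sub>R x + b *\<^sub>R y + c *\<^sub>R z | a b c. True}"
    unfolding span_insert span_empty
    by (auto simp: algebra_simps)
qed

context frame_metric
begin

definition w14 :: "real \<Rightarrow> 4 \<Rightarrow> 4 \<Rightarrow> real" where "w14 p a b = th1 p a * th4 p b - th4 p a * th1 p b"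
definition w34 :: "real \<Rightarrow> 4 \<Rightarrow> 4 \<Rightarrow> real" where "w34 p a b = th3 p a * th4 p b - th4 p a * th3 p b"

lemmas w_defs = w12_def w13_def w14_def w23_def w24_def w34_def

lemma det_g0: "det (g0 v) = (2 / 3 * i)\<^sup>2"
  unfolding det_4 g0_nth gt_def th_defs sel4_simps by (simp add: field_simps power2_eq_square del: One_nat_def)

lemma raise_th:
  "(\<Sum>c\<in>UNIV. git p m c * th1 p c) = e3 p m" "(\<Sum>c\<in>UNIV. git p m c * th2 p c) = - e4 p m"
  "(\<Sum>c\<in>UNIV. git p m c * th3 p c) = e1 p m" "(\<Sum>c\<in>UNIV. git p m c * th4 p c) = - e2 p m"
proof -
  have "\<forall>m. (\<Sum>c\<in>UNIV. git p m c * th1 p c) = e3 p m \<and> (\<Sum>c\<in>UNIV. git p m c * th2 p c) = - e4 p m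
    \<and> (\<Sum>c\<in>UNIV. git p m c * th3 p c) = e1 p m \<and> (\<Sum>c\<in>UNIV. git p m c * th4 p c) = - e2 p m"
    unfolding forall_4
    by (intro conjI) (simp_all add: sum_4 git_def e_defs th_defs i field_simps del: One_nat_def)
  then show "(\<Sum>c\<in>UNIV. git p m c * th1 p c) = e3 p m" "(\<Sum>c\<in>UNIV. git p m c * th2 p c) = - e4 p m"
    "(\<Sum>c\<in>UNIV. git p m c * th3 p c) = e1 p m" "(\<Sum>c\<in>UNIV. git p m c * th4 p c) = - e2 p m" by blast+
qed

lemma lev_frame:
  "2/3 * i * lev a b (e1 p) (e2 p) = w34 p a b" "2/3 * i * lev a b (e1 p) (e3 p) = - w24 p a b"
  "2/3 * i * lev a b (e1 p) (e4 p) = w23 p a b" "2/3 * i * lev a b (e2 p) (e3 p) = w14 p a b"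
  "2/3 * i * lev a b (e2 p) (e4 p) = - w13 p a b" "2/3 * i * lev a b (e3 p) (e4 p) = w12 p a b"
proof -
  have "\<forall>a b. 2/3 * i * lev a b (e1 p) (e2 p) = w34 p a b"
    "\<forall>a b. 2/3 * i * lev a b (e1 p) (e3 p) = - w24 p a b"
    "\<forall>a b. 2/3 * i * lev a b (e1 p) (e4 p) = w23 p a b"
    "\<forall>a b. 2/3 * i * lev a b (e2 p) (e3 p) = w14 p a b"
    "\<forall>a b. 2/3 * i * lev a b (e2 p) (e4 p) = - w13 p a b"
    "\<forall>a b. 2/3 * i * lev a b (e3 p) (e4 p) = w12 p a b"
    unfolding forall_4 lev_eval
    by (intro conjI; simp add: w_defs e_defs th_defs i field_simps del: One_nat_def)+
  then show "2/3 * i * lev a b (e1 p) (e2 p) = w34 p a b" "2/3 * i * lev a b (e1 p) (e3 p) = - w24 p a b"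
    "2/3 * i * lev a b (e1 p) (e4 p) = w23 p a b" "2/3 * i * lev a b (e2 p) (e3 p) = w14 p a b"
    "2/3 * i * lev a b (e2 p) (e4 p) = - w13 p a b" "2/3 * i * lev a b (e3 p) (e4 p) = w12 p a b"
    by blast+
qed

end

text \<open>A metric that agrees at the point \<open>v\<close> with a multiple of the base metric and has there the
  correspondingly scaled Weyl tensor; this is all that the Petrov type depends on.\<close>

locale frame_metric_point = frame_metric +
  fixes gh :: "real^4 \<Rightarrow> real^4^4" and v :: "real^4" and r :: real
  assumes r: "r \<noteq> 0" and gh: "gh v = r\<^sup>2 *\<^sub>R g0 v"
    and weyl_gh: "weyl gh v a b c d = r\<^sup>2 * Wt (v $ 3) a b c d"
begin

abbreviation "p \<equiv> v $ 3"

lemma ginv_gh: "ginv gh v a b = inverse (r\<^sup>2) * git p a b"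
  using ginv_g0[of v a b] by (simp add: ginv_def gh invertible_scaleR invertible_g0 r)

text \<open>The Hodge star on two-forms does not depend on the scale \<open>r\<close>: \<open>r\<^sup>4\<close> from the volume form cancels.\<close>

lemma vol_form_up_gh: "vol_form_up gh v a b c d
    = 2/3 * \<bar>i\<bar> * (\<Sum>m\<in>UNIV. \<Sum>n\<in>UNIV. levi_civita a b m n * (git p m c * git p n d))"
proof -
  have "det (gh v) = (r\<^sup>2)^4 * (2 / 3 * i)\<^sup>2"
    unfolding gh det_4 det_g0[symmetric, of v] by (simp add: algebra_simps power2_eq_square eval_nat_numeral)
  also have "\<dots> = ((r\<^sup>2)\<^sup>2 * (2 / 3 * i))\<^sup>2"
    by (simp add: power_mult_distrib power_divide flip: power_mult)
  finally have vol: "sqrt \<bar>det (gh v)\<bar> = (r\<^sup>2)\<^sup>2 * (2/3 * \<bar>i\<bar>)"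
    by (simp add: abs_mult)
  show ?thesis
    unfolding vol_form_up_def vol_form_def ginv_gh vol
    using r by (simp add: sum_distrib_left field_simps power2_eq_square)
qed

text \<open>The Hodge star on two-forms, for components given as a function of the indices.\<close>

definition star :: "(4 \<Rightarrow> 4 \<Rightarrow> real) \<Rightarrow> 4 \<Rightarrow> 4 \<Rightarrow> real" where
  "star f a b = 1/2 * (\<Sum>c\<in>UNIV. \<Sum>d\<in>UNIV. vol_form_up gh v a b c d * f c d)"

lemma star_wedge:
  "star (\<lambda>c d. x c * y d - y c * x d) a b
     = 2/3 * \<bar>i\<bar> * lev a b (\<lambda>m. \<Sum>c\<in>UNIV. git p m c * x c) (\<lambda>m. \<Sum>c\<in>UNIV. git p m c * y c)"
proof -
  have *: "(\<Sum>c\<in>UNIV. \<Sum>d\<in>UNIV. vol_form_up gh v a b c d * (x c * y d))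
     = 2/3 * \<bar>i\<bar> * lev a b (\<lambda>m. \<Sum>c\<in>UNIV. git p m c * x c) (\<lambda>m. \<Sum>c\<in>UNIV. git p m c * y c)" for x y
    unfolding vol_form_up_gh lev_def sum_contract2[symmetric]
    by (simp only: mult.assoc sum_distrib_left[symmetric])
  show ?thesis
    unfolding star_def right_diff_distrib sum_subtractf *
    by (subst (2) lev_swap) simp
qed

text \<open>The sign of \<open>i\<close> decides which orientation the coframe has, hence which of the two families of
  two-forms is self-dual.\<close>

lemma star_frame:
  "star (w12 p) a b = - sgn i * w12 p a b" "star (w34 p) a b = - sgn i * w34 p a b"
  "star (w13 p) a b = sgn i * w24 p a b" "star (w24 p) a b = sgn i * w13 p a b"
  "star (w23 p) a b = sgn i * w23 p a b" "star (w14 p) a b = sgn i * w14 p a b"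
proof -
  have pull: "2/3 * \<bar>i\<bar> * z = sgn i * (2/3 * i * z)" for z
    by (simp add: abs_sgn)
  have "star (w12 p) a b = - (2/3 * \<bar>i\<bar> * lev a b (e3 p) (e4 p))"
    "star (w34 p) a b = - (2/3 * \<bar>i\<bar> * lev a b (e1 p) (e2 p))"
    "star (w13 p) a b = 2/3 * \<bar>i\<bar> * lev a b (e3 p) (e1 p)"
    "star (w24 p) a b = 2/3 * \<bar>i\<bar> * lev a b (e4 p) (e2 p)"
    "star (w23 p) a b = - (2/3 * \<bar>i\<bar> * lev a b (e4 p) (e1 p))"
    "star (w14 p) a b = - (2/3 * \<bar>i\<bar> * lev a b (e3 p) (e2 p))"
    unfolding w_defs[abs_def] star_wedge raise_th by (simp_all add: lev_minus)
  then show "star (w12 p) a b = - sgn i * w12 p a b" "star (w34 p) a b = - sgn i * w34 p a b"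
    "star (w13 p) a b = sgn i * w24 p a b" "star (w24 p) a b = sgn i * w13 p a b"
    "star (w23 p) a b = sgn i * w23 p a b" "star (w14 p) a b = sgn i * w14 p a b"
    unfolding lev_swap[of a b "e3 p" "e1 p"] lev_swap[of a b "e4 p" "e2 p"] lev_swap[of a b "e4 p" "e1 p"]
      lev_swap[of a b "e3 p" "e2 p"]
    by (simp_all only: pull mult_minus_right mult_minus_left minus_minus lev_frame)
qed

end

context frame_metric
begin

text \<open>Every two-form is a combination of the six \<open>\<omega>\<^sup>i\<^sup>j\<close>; the coefficients are its values on the dual frame.\<close>

lemma antisymmetric_frame:
  fixes F :: "real^4^4"
  assumes "transpose F = - F"
  obtains c12 c13 c14 c23 c24 c34 where "\<And>a b. F $ a $ b = c12 * w12 p a b + c13 * w13 p a b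
     + c14 * w14 p a b + c23 * w23 p a b + c24 * w24 p a b + c34 * w34 p a b"
proof -
  have anti: "F $ a $ b = - F $ b $ a" for a b
    using arg_cong[OF assms, of "\<lambda>M. M $ b $ a"] by (simp add: transpose_def)
  have diag: "F $ a $ a = 0" for a using anti[of a a] by linarith
  define c where "c x y = (\<Sum>m\<in>UNIV. \<Sum>n\<in>UNIV. F $ m $ n * (x m * y n))" for x y :: "4 \<Rightarrow> real"
  have "\<forall>a b. F $ a $ b = c (e1 p) (e2 p) * w12 p a b + c (e1 p) (e3 p) * w13 p a b
     + c (e1 p) (e4 p) * w14 p a b + c (e2 p) (e3 p) * w23 p a b + c (e2 p) (e4 p) * w24 p a b
     + c (e3 p) (e4 p) * w34 p a b"
    unfolding forall_4 c_def sum_4 diag anti[of 2 1] anti[of 3 1] anti[of 4 1] anti[of 3 2] anti[of 4 2] anti[of 4 3]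
    by (intro conjI) (simp_all add: e_defs th_defs w_defs i field_simps del: One_nat_def)
  then show ?thesis using that by blast
qed

lemma frame_two_forms_independent:
  assumes "\<And>a b. c12 * w12 p a b + c13 * w13 p a b + c14 * w14 p a b + c23 * w23 p a b + c24 * w24 p a b
     + c34 * w34 p a b = 0"
  shows "c12 = 0" "c13 = 0" "c14 = 0" "c23 = 0" "c24 = 0" "c34 = 0"
proof -
  note w = w_defs th_defs sel4_simps
  \<comment> \<open>In this order the components form a triangular system.\<close>
  show "c34 = 0" using assms[of 3 4] i unfolding w by simp
  then show "c24 = 0" using assms[of 2 4] i unfolding w by simp
  with \<open>c34 = 0\<close> show "c14 = 0" using assms[of 1 4] i unfolding w by simp
  with \<open>c34 = 0\<close> \<open>c24 = 0\<close> show "c23 = 0" using assms[of 2 3] unfolding w by simp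
  with \<open>c34 = 0\<close> \<open>c24 = 0\<close> \<open>c14 = 0\<close> show "c13 = 0" using assms[of 1 3] unfolding w by simp
  with \<open>c34 = 0\<close> \<open>c24 = 0\<close> \<open>c14 = 0\<close> \<open>c23 = 0\<close> show "c12 = 0" using assms[of 1 2] unfolding w by simp
qed

lemma w_nonzero: "\<exists>a b. w12 p a b \<noteq> 0" "\<exists>a b. w23 p a b \<noteq> 0"
  using frame_two_forms_independent[of 1 p 0 0 0 0 0] frame_two_forms_independent[of 0 p 0 0 1 0 0] by auto

text \<open>The inner product of two-forms.\<close>

definition pairing :: "real \<Rightarrow> (4 \<Rightarrow> 4 \<Rightarrow> real) \<Rightarrow> (4 \<Rightarrow> 4 \<Rightarrow> real) \<Rightarrow> real" where
  "pairing p f h = 1/2 * (\<Sum>c\<in>UNIV. \<Sum>d\<in>UNIV. f c d * (\<Sum>m\<in>UNIV. \<Sum>n\<in>UNIV. git p c m * git p d n * h m n))"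

lemma raise_wedge: "(\<Sum>m\<in>UNIV. \<Sum>n\<in>UNIV. git p c m * git p d n * (x m * y n - y m * x n))
    = (\<Sum>m\<in>UNIV. git p c m * x m) * (\<Sum>m\<in>UNIV. git p d m * y m)
      - (\<Sum>m\<in>UNIV. git p c m * y m) * (\<Sum>m\<in>UNIV. git p d m * x m)"
  unfolding sum_product right_diff_distrib sum_subtractf by (simp add: mult_ac)

lemma pairing_frame:
  "pairing p (w12 p) (w12 p) = 0" "pairing p (w12 p) (w34 p) = -1" "pairing p (w12 p) (w13 p) = 0"
  "pairing p (w12 p) (w24 p) = 0" "pairing p (w23 p) (w23 p) = 0" "pairing p (w23 p) (w14 p) = 1"
  "pairing p (w23 p) (w13 p) = 0" "pairing p (w23 p) (w24 p) = 0"
  unfolding pairing_def w_defs raise_wedge raise_th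
  by (simp_all add: sum_4 e_defs th_defs i field_simps del: One_nat_def)

lemma pairing_add: "pairing p f (\<lambda>a b. x * h a b + y * k a b) = x * pairing p f h + y * pairing p f k"
  unfolding pairing_def by (simp add: algebra_simps sum.distrib sum_distrib_left)

end

text \<open>It suffices that the Weyl endomorphism maps \<open>y\<close> to a nonzero multiple of \<open>x\<close>: the Jordan basis is then
  \<open>k x, y, z\<close>.\<close>

lemma petrov_type_N_I:
  assumes "\<And>a b c. a *\<^sub>R x + b *\<^sub>R y + c *\<^sub>R z = 0 \<Longrightarrow> a = 0 \<and> b = 0 \<and> c = 0"
    and "dual_forms g s v = {a *\<^sub>R x + b *\<^sub>R y + c *\<^sub>R z | a b c. True}" and "k \<noteq> 0"
    and "weyl_endo g s v x = 0" "weyl_endo g s v y = k *\<^sub>R x" "weyl_endo g s v z = 0"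
  shows "petrov_type_N g s v"
proof -
  have x: "weyl_endo g s v (k *\<^sub>R x) = k *\<^sub>R weyl_endo g s v x"
    unfolding weyl_endo_def
    by (simp add: vec_eq_iff sum_distrib_left mult_ac)
  have ind: "a = 0 \<and> b = 0 \<and> c = 0" if "a *\<^sub>R (k *\<^sub>R x) + b *\<^sub>R y + c *\<^sub>R z = 0" for a b c
    using assms(1)[of "a * k" b c] that assms(3) by simp
  have "{a *\<^sub>R x + b *\<^sub>R y + c *\<^sub>R z | a b c. True} = {a *\<^sub>R (k *\<^sub>R x) + b *\<^sub>R y + c *\<^sub>R z | a b c. True}"
  proof (intro set_eqI iffI; clarify)
    fix a b c
    show "\<exists>a' b' c'. a *\<^sub>R x + b *\<^sub>R y + c *\<^sub>R z = a' *\<^sub>R (k *\<^sub>R x) + b' *\<^sub>R y + c' *\<^sub>R z \<and> True"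
      using assms(3) by (intro exI[of _ "a / k"] exI[of _ b] exI[of _ c]) simp
    show "\<exists>a' b' c'. a *\<^sub>R (k *\<^sub>R x) + b *\<^sub>R y + c *\<^sub>R z = a' *\<^sub>R x + b' *\<^sub>R y + c' *\<^sub>R z \<and> True"
      by (intro exI[of _ "a * k"] exI[of _ b] exI[of _ c]) simp
  qed
  moreover have "distinct [k *\<^sub>R x, y, z]" "independent {k *\<^sub>R x, y, z}"
    "span {k *\<^sub>R x, y, z} = {a *\<^sub>R (k *\<^sub>R x) + b *\<^sub>R y + c *\<^sub>R z | a b c. True}"
    by (rule independent_span3; rule ind, assumption)+
  ultimately show ?thesis
    unfolding petrov_type_N_def assms(2)
    using x assms(4-6) by (intro exI[of _ "k *\<^sub>R x"] exI[of _ y] exI[of _ z]) simp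
qed

context frame_metric_point
begin

text \<open>The matrix of a two-form.\<close>

definition mat_of :: "(4 \<Rightarrow> 4 \<Rightarrow> real) \<Rightarrow> real^4^4" where "mat_of f = (\<chi> a b. f a b)"

lemma star_add: "star (\<lambda>c d. f c d + h c d) a b = star f a b + star h a b"
  by (simp add: star_def distrib_left sum.distrib)

lemma star_cmult: "star (\<lambda>c d. x * f c d) a b = x * star f a b"
  by (simp add: star_def sum_distrib_left mult_ac)

lemma dual_forms_gh:
  "dual_forms gh (- sgn i) v = {a *\<^sub>R mat_of (w12 p) + b *\<^sub>R mat_of (w34 p)
      + c *\<^sub>R mat_of (\<lambda>a b. 1 * w13 p a b + (-1) * w24 p a b) | a b c. True}" (is "_ = ?M")
  "dual_forms gh (sgn i) v = {a *\<^sub>R mat_of (w23 p) + b *\<^sub>R mat_of (w14 p)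
      + c *\<^sub>R mat_of (\<lambda>a b. 1 * w13 p a b + 1 * w24 p a b) | a b c. True}" (is "_ = ?P")
proof -
  have sgn: "sgn i = 1 \<or> sgn i = -1" using i by (simp add: sgn_if)
  have star_F: "hodge2 gh v F $ a $ b = - sgn i * c12 * w12 p a b + sgn i * c24 * w13 p a b
      + sgn i * c14 * w14 p a b + sgn i * c23 * w23 p a b + sgn i * c13 * w24 p a b - sgn i * c34 * w34 p a b"
    if F: "\<And>a b. F $ a $ b = c12 * w12 p a b + c13 * w13 p a b
       + c14 * w14 p a b + c23 * w23 p a b + c24 * w24 p a b + c34 * w34 p a b"
    for F a b c12 c13 c14 c23 c24 c34
  proof -
    have "hodge2 gh v F $ a $ b = star (\<lambda>a b. c12 * w12 p a b + c13 * w13 p a b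
       + c14 * w14 p a b + c23 * w23 p a b + c24 * w24 p a b + c34 * w34 p a b) a b"
      by (simp add: hodge2_def star_def F)
    then show ?thesis by (simp add: star_add star_cmult star_frame)
  qed
  have eigen: "(- sgn i - s) * c12 = 0 \<and> sgn i * c24 - s * c13 = 0 \<and> (sgn i - s) * c14 = 0 \<and> (sgn i - s) * c23 = 0
      \<and> sgn i * c13 - s * c24 = 0 \<and> (- sgn i - s) * c34 = 0"
    if F: "\<And>a b. F $ a $ b = c12 * w12 p a b + c13 * w13 p a b
       + c14 * w14 p a b + c23 * w23 p a b + c24 * w24 p a b + c34 * w34 p a b"
    and d: "hodge2 gh v F = s *\<^sub>R F"
    for F s c12 c13 c14 c23 c24 c34
  proof -
    have "(- sgn i - s) * c12 * w12 p a b + (sgn i * c24 - s * c13) * w13 p a b + (sgn i - s) * c14 * w14 p a b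
        + (sgn i - s) * c23 * w23 p a b + (sgn i * c13 - s * c24) * w24 p a b + (- sgn i - s) * c34 * w34 p a b = 0" for a b
      using star_F[OF F, of a b] d by (simp add: F algebra_simps)
    from frame_two_forms_independent[OF this] show ?thesis by blast
  qed
  show "dual_forms gh (- sgn i) v = ?M"
  proof (intro set_eqI iffI)
    fix F assume "F \<in> dual_forms gh (- sgn i) v"
    then have F: "transpose F = - F" "hodge2 gh v F = (- sgn i) *\<^sub>R F" by (auto simp: dual_forms_def)
    obtain c12 c13 c14 c23 c24 c34 where c: "\<And>a b. F $ a $ b = c12 * w12 p a b + c13 * w13 p a b
       + c14 * w14 p a b + c23 * w23 p a b + c24 * w24 p a b + c34 * w34 p a b"
      using antisymmetric_frame[OF F(1), of p] by blast
    from eigen[OF c F(2)] have "c24 = - c13" "c14 = 0" "c23 = 0" using sgn by auto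
    then have "F = c12 *\<^sub>R mat_of (w12 p) + c34 *\<^sub>R mat_of (w34 p)
        + c13 *\<^sub>R mat_of (\<lambda>a b. 1 * w13 p a b + (-1) * w24 p a b)"
      by (simp add: vec_eq_iff mat_of_def c algebra_simps)
    then show "F \<in> ?M" by blast
  next
    fix F assume "F \<in> ?M"
    then obtain x y z where F: "F = x *\<^sub>R mat_of (w12 p) + y *\<^sub>R mat_of (w34 p)
        + z *\<^sub>R mat_of (\<lambda>a b. 1 * w13 p a b + (-1) * w24 p a b)" by blast
    have c: "F $ a $ b = x * w12 p a b + z * w13 p a b + 0 * w14 p a b + 0 * w23 p a b + (- z) * w24 p a b + y * w34 p a b" for a b
      by (simp add: F mat_of_def algebra_simps)
    have "transpose F = - F"
      unfolding vec_eq_iff transpose_def vec_lambda_beta vector_uminus_component c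
      by (simp add: w_defs algebra_simps)
    moreover have "hodge2 gh v F = (- sgn i) *\<^sub>R F"
      by (simp add: vec_eq_iff star_F[OF c] c algebra_simps)
    ultimately show "F \<in> dual_forms gh (- sgn i) v" by (simp add: dual_forms_def)
  qed
  show "dual_forms gh (sgn i) v = ?P"
  proof (intro set_eqI iffI)
    fix F assume "F \<in> dual_forms gh (sgn i) v"
    then have F: "transpose F = - F" "hodge2 gh v F = sgn i *\<^sub>R F" by (auto simp: dual_forms_def)
    obtain c12 c13 c14 c23 c24 c34 where c: "\<And>a b. F $ a $ b = c12 * w12 p a b + c13 * w13 p a b
       + c14 * w14 p a b + c23 * w23 p a b + c24 * w24 p a b + c34 * w34 p a b"
      using antisymmetric_frame[OF F(1), of p] by blast
    from eigen[OF c F(2)] have "c24 = c13" "c12 = 0" "c34 = 0" using sgn by auto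
    then have "F = c23 *\<^sub>R mat_of (w23 p) + c14 *\<^sub>R mat_of (w14 p)
        + c13 *\<^sub>R mat_of (\<lambda>a b. 1 * w13 p a b + 1 * w24 p a b)"
      by (simp add: vec_eq_iff mat_of_def c algebra_simps)
    then show "F \<in> ?P" by blast
  next
    fix F assume "F \<in> ?P"
    then obtain x y z where F: "F = x *\<^sub>R mat_of (w23 p) + y *\<^sub>R mat_of (w14 p)
        + z *\<^sub>R mat_of (\<lambda>a b. 1 * w13 p a b + 1 * w24 p a b)" by blast
    have c: "F $ a $ b = 0 * w12 p a b + z * w13 p a b + y * w14 p a b + x * w23 p a b + z * w24 p a b + 0 * w34 p a b" for a b
      by (simp add: F mat_of_def algebra_simps)
    have "transpose F = - F"
      unfolding vec_eq_iff transpose_def vec_lambda_beta vector_uminus_component c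
      by (simp add: w_defs algebra_simps)
    moreover have "hodge2 gh v F = sgn i *\<^sub>R F"
      by (simp add: vec_eq_iff star_F[OF c] c algebra_simps)
    ultimately show "F \<in> dual_forms gh (sgn i) v" by (simp add: dual_forms_def)
  qed
qed

text \<open>One half of the Weyl tensor is a multiple of the square of \<open>\<omega>\<^sup>1\<^sup>2\<close>, the other of the square of \<open>\<omega>\<^sup>2\<^sup>3\<close>.\<close>

lemma weyl_part_gh:
  "weyl_part gh (- sgn i) v a b c d = r\<^sup>2 * al p * (w12 p a b * w12 p c d)"
  "weyl_part gh (sgn i) v a b c d = r\<^sup>2 * (H 4 p / 6) * (w23 p a b * w23 p c d)"
proof -
  have sgn: "sgn i * sgn i = 1" using i by (simp add: sgn_if)
  have W: "weyl gh v a b c d = (r\<^sup>2 * al p * w12 p c d) * w12 p a b + (r\<^sup>2 * (H 4 p / 6) * w23 p c d) * w23 p a b"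
    for a b
    unfolding weyl_gh Wt_def al_def by (simp add: algebra_simps)
  have "1/2 * (\<Sum>e\<in>UNIV. \<Sum>f\<in>UNIV. vol_form_up gh v a b e f * weyl gh v e f c d)
     = star (\<lambda>e f. (r\<^sup>2 * al p * w12 p c d) * w12 p e f + (r\<^sup>2 * (H 4 p / 6) * w23 p c d) * w23 p e f) a b"
    unfolding star_def W ..
  also have "\<dots> = sgn i * (r\<^sup>2 * (H 4 p / 6) * (w23 p a b * w23 p c d) - r\<^sup>2 * al p * (w12 p a b * w12 p c d))"
    unfolding star_add star_cmult star_frame by (simp add: algebra_simps)
  finally have star_weyl: "1/2 * (\<Sum>e\<in>UNIV. \<Sum>f\<in>UNIV. vol_form_up gh v a b e f * weyl gh v e f c d)
     = sgn i * (r\<^sup>2 * (H 4 p / 6) * (w23 p a b * w23 p c d) - r\<^sup>2 * al p * (w12 p a b * w12 p c d))" .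
  show "weyl_part gh (- sgn i) v a b c d = r\<^sup>2 * al p * (w12 p a b * w12 p c d)"
    "weyl_part gh (sgn i) v a b c d = r\<^sup>2 * (H 4 p / 6) * (w23 p a b * w23 p c d)"
    unfolding weyl_part_def star_weyl unfolding W mult_minus_left mult.assoc[symmetric, of "sgn i" "sgn i"] sgn
    by (simp_all add: algebra_simps)
qed

lemma weyl_endo_gh:
  "weyl_endo gh (- sgn i) v (mat_of f) = (inverse (r\<^sup>2) * al p * pairing p (w12 p) f) *\<^sub>R mat_of (w12 p)"
  "weyl_endo gh (sgn i) v (mat_of f) = (inverse (r\<^sup>2) * (H 4 p / 6) * pairing p (w23 p) f) *\<^sub>R mat_of (w23 p)"
proof -
  have raised: "(\<Sum>m\<in>UNIV. \<Sum>n\<in>UNIV. ginv gh v c m * ginv gh v d n * f m n)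
      = inverse (r\<^sup>2) * (inverse (r\<^sup>2) * (\<Sum>m\<in>UNIV. \<Sum>n\<in>UNIV. git p c m * git p d n * f m n))" for c d
    unfolding ginv_gh by (simp add: sum_distrib_left mult_ac)
  have "weyl_endo gh s v (mat_of f) = (inverse (r\<^sup>2) * k * pairing p w f) *\<^sub>R mat_of w"
    if "\<And>a b c d. weyl_part gh s v a b c d = r\<^sup>2 * k * (w a b * w c d)" for s k w
  proof -
    have "weyl_endo gh s v (mat_of f) $ a $ b = inverse (r\<^sup>2) * k * pairing p w f * w a b" for a b
    proof -
      have assoc: "r\<^sup>2 * k * (w a b * w c d) * (inverse (r\<^sup>2) * (inverse (r\<^sup>2) * X)) = (inverse (r\<^sup>2) * k * w a b) * (w c d * X)"
        for c d X using r by (simp add: field_simps power2_eq_square)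
      have "weyl_endo gh s v (mat_of f) $ a $ b = 1/2 * (\<Sum>c\<in>UNIV. \<Sum>d\<in>UNIV. (inverse (r\<^sup>2) * k * w a b)
          * (w c d * (\<Sum>m\<in>UNIV. \<Sum>n\<in>UNIV. git p c m * git p d n * f m n)))"
        unfolding weyl_endo_def that mat_of_def vec_lambda_beta raised assoc ..
      also have "\<dots> = inverse (r\<^sup>2) * k * pairing p w f * w a b"
        unfolding pairing_def sum_distrib_left[symmetric] by simp
      finally show ?thesis .
    qed
    then show ?thesis by (simp add: vec_eq_iff mat_of_def)
  qed
  from this[OF weyl_part_gh(1)] this[OF weyl_part_gh(2)]
  show "weyl_endo gh (- sgn i) v (mat_of f) = (inverse (r\<^sup>2) * al p * pairing p (w12 p) f) *\<^sub>R mat_of (w12 p)"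
    "weyl_endo gh (sgn i) v (mat_of f) = (inverse (r\<^sup>2) * (H 4 p / 6) * pairing p (w23 p) f) *\<^sub>R mat_of (w23 p)" .
qed

text \<open>The null form \<open>\<omega>\<^sup>1\<^sup>2\<close> pairs only with \<open>\<omega>\<^sup>3\<^sup>4\<close> among its companions, and \<open>\<omega>\<^sup>2\<^sup>3\<close> only with \<open>\<omega>\<^sup>1\<^sup>4\<close>, so each Weyl
  endomorphism is nilpotent of rank one.\<close>

theorem type_NN'_gh:
  assumes "H 0 p \<noteq> 0" "H 4 p \<noteq> 0"
  shows "type_NN' gh v"
proof -
  have al: "al p \<noteq> 0" using assms by (simp add: al_def)
  have minus: "petrov_type_N gh (- sgn i) v"
  proof (rule petrov_type_N_I[OF _ dual_forms_gh(1)])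
    fix a b c assume 0: "a *\<^sub>R mat_of (w12 p) + b *\<^sub>R mat_of (w34 p)
      + c *\<^sub>R mat_of (\<lambda>a b. 1 * w13 p a b + (-1) * w24 p a b) = 0"
    have "a * w12 p x y + c * w13 p x y + 0 * w14 p x y + 0 * w23 p x y + (- c) * w24 p x y + b * w34 p x y = 0" for x y
      using arg_cong[OF 0, of "\<lambda>F. F $ x $ y"] by (simp add: mat_of_def algebra_simps)
    from frame_two_forms_independent[OF this] show "a = 0 \<and> b = 0 \<and> c = 0" by blast
  next
    show "- (inverse (r\<^sup>2) * al p) \<noteq> 0" using r al by simp
  qed (simp_all only: weyl_endo_gh pairing_add pairing_frame, simp_all)
  have plus: "petrov_type_N gh (sgn i) v"
  proof (rule petrov_type_N_I[OF _ dual_forms_gh(2)])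
    fix a b c assume 0: "a *\<^sub>R mat_of (w23 p) + b *\<^sub>R mat_of (w14 p)
      + c *\<^sub>R mat_of (\<lambda>a b. 1 * w13 p a b + 1 * w24 p a b) = 0"
    have "0 * w12 p x y + c * w13 p x y + b * w14 p x y + a * w23 p x y + c * w24 p x y + 0 * w34 p x y = 0" for x y
      using arg_cong[OF 0, of "\<lambda>F. F $ x $ y"] by (simp add: mat_of_def algebra_simps)
    from frame_two_forms_independent[OF this] show "a = 0 \<and> b = 0 \<and> c = 0" by blast
  next
    show "inverse (r\<^sup>2) * (H 4 p / 6) \<noteq> 0" using r assms by simp
  qed (simp_all only: weyl_endo_gh pairing_add pairing_frame, simp_all)
  have nonzero: "\<exists>a b c d. weyl_part gh s v a b c d \<noteq> 0" if "s = sgn i \<or> s = - sgn i" for s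
  proof -
    obtain a b c d where "w12 p a b \<noteq> 0" "w23 p c d \<noteq> 0" using w_nonzero by blast
    then have "weyl_part gh (- sgn i) v a b a b \<noteq> 0" "weyl_part gh (sgn i) v c d c d \<noteq> 0"
      using r al assms by (simp_all add: weyl_part_gh)
    then show ?thesis using that by blast
  qed
  have "type_NN' gh v \<longleftrightarrow> (\<forall>s\<in>{sgn i, - sgn i}. (\<exists>a b c d. weyl_part gh s v a b c d \<noteq> 0) \<and> petrov_type_N gh s v)"
    unfolding type_NN'_def using i by (auto simp: sgn_if)
  then show ?thesis using plus minus nonzero by simp
qed

end

section \<open>Conformal Einstein metrics\<close>

context conformal_change
begin

text \<open>In terms of \<open>u = 1/w\<close> the change of the Schouten tensor is the Hessian of \<open>u\<close> over \<open>u\<close>, up to a multiple of \<open>g\<close>.\<close>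

lemma qs_hessian:
  assumes v: "v \<in> U"
  defines "u \<equiv> \<lambda>v. inverse (w v)"
  shows "u v * qs v a b = pd a (pd b u) v - (\<Sum>m\<in>UNIV. christoffel g v m a b * pd m u v)
    - u v * ups2 v / 2 * g v $ a $ b"
proof -
  have su: "smooth_fun_on U u"
    unfolding u_def by (rule smooth_inverse[OF U smooth_w w_nz])
  have pdu: "pd k u z = - u z * ups z k" if "z \<in> U" for k z
    unfolding u_def ups_def
    by (simp add: pd_inverse differentiableI[OF smooth_w that] w_nz[OF that])
  have "pd a (pd b u) v = pd a (\<lambda>z. - u z * ups z b) v"
    by (rule pd_cong[OF U v]) (rule pdu)
  also have "\<dots> = u v * (ups v a * ups v b - pd a (\<lambda>z. ups z b) v)"
    by (simp add: pd_mult pd_minus differentiableI[OF _ v] smooth_intros su smooth_ups pdu[OF v] algebra_simps)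
  finally have "pd a (pd b u) v = u v * (ups v a * ups v b - pd a (\<lambda>z. ups z b) v)" .
  moreover have "(\<Sum>m\<in>UNIV. christoffel g v m a b * pd m u v)
      = - u v * (\<Sum>m\<in>UNIV. christoffel g v m a b * ups v m)"
    by (simp add: pdu[OF v] sum_distrib_left mult_ac)
  ultimately show ?thesis
    unfolding qs_def nups_def by (simp add: algebra_simps)
qed

text \<open>The linear equation for \<open>u = 1/w\<close> when \<open>w\<^sup>2 g\<close> is Einstein.\<close>

lemma einstein_hessian:
  assumes v: "v \<in> U" and ein: "\<And>a b. ricci gh v a b = \<Lambda> * gh v $ a $ b"
  defines "u \<equiv> \<lambda>v. inverse (w v)"
  shows "\<exists>\<mu>. \<forall>a b. pd a (pd b u) v - (\<Sum>m\<in>UNIV. christoffel g v m a b * pd m u v)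
    + u v * schouten g v a b = \<mu> * g v $ a $ b"
proof -
  have scal: "scalar_curv gh v = 4 * \<Lambda>"
  proof -
    have "scalar_curv gh v = (\<Sum>a\<in>UNIV. \<Sum>b\<in>UNIV. \<Lambda> * (ginv g v a b * g v $ b $ a))"
      unfolding scalar_curv_def ein ginv_gh[OF v]
      by (intro sum.cong refl) (use g_sym[OF v] w_nz[OF v] in \<open>simp add: field_simps power2_eq_square\<close>)
    then show ?thesis by (simp add: ginv_g[OF v] kd_def flip: sum_distrib_left)
  qed
  define \<mu> where "\<mu> = u v * (\<Lambda> / 6 * (w v)\<^sup>2 + ups2 v / 2)"
  have "pd a (pd b u) v - (\<Sum>m\<in>UNIV. christoffel g v m a b * pd m u v) + u v * schouten g v a b
      = \<mu> * g v $ a $ b" for a b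
  proof -
    have "schouten gh v a b = \<Lambda> / 6 * (w v)\<^sup>2 * g v $ a $ b"
      unfolding schouten_def scal ein by simp
    then have "schouten g v a b + qs v a b = \<Lambda> / 6 * (w v)\<^sup>2 * g v $ a $ b"
      unfolding schouten_gh[OF v] .
    then have "u v * schouten g v a b + u v * qs v a b = u v * (\<Lambda> / 6 * (w v)\<^sup>2 * g v $ a $ b)"
      by (simp flip: distrib_left)
    moreover have "u v = inverse (w v)" by (simp add: u_def)
    ultimately show ?thesis
      using qs_hessian[OF v, of a b, folded u_def] unfolding \<mu>_def by (simp add: algebra_simps)
  qed
  then show ?thesis by blast
qed

end

context frame_metric
begin

lemma pd_H:
  assumes "v \<in> U"
  shows "pd 3 (\<lambda>u. H 0 (u $ 3)) v = H 1 (v $ 3)" "pd 3 (\<lambda>u. H 1 (u $ 3)) v = H 2 (v $ 3)"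
    "pd 3 (\<lambda>u. H 2 (u $ 3)) v = H 3 (v $ 3)" "pd 3 (\<lambda>u. H 3 (u $ 3)) v = H 4 (v $ 3)"
    "pd 3 (\<lambda>u. H 4 (u $ 3)) v = H 5 (v $ 3)" "pd 3 (\<lambda>u. u $ 3) v = 1"
  using UI[OF assms]
  by (simp_all only: pd_coord_fun[where F' = "H 1"] pd_coord_fun[where F' = "H 2"] pd_coord_fun[where F' = "H 3"]
      pd_coord_fun[where F' = "H 4"] pd_coord_fun[where F' = "H 5"] H_deriv if_True simp_thms
      pd_coord_fun[where F = "\<lambda>p. p" and F' = "\<lambda>_. 1"] DERIV_ident)

text \<open>The components \<open>(3,3)\<close>, \<open>(3,4)\<close>, \<open>(2,3)\<close> of the equation for \<open>u = 1/w\<close> involve no \<open>\<mu>\<close>; \<open>\<mu>\<close> is eliminated from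
  \<open>(2,2)\<close> by \<open>(2,4)\<close>. Everything after that is differentiation with respect to \<open>p\<close> on the open set \<open>V\<close>
  where \<open>a p + b\<close> does not vanish.\<close>

theorem not_einstein:
  assumes "conformal_change U g0 w"
    and ein: "\<And>v c d. v \<in> U \<Longrightarrow> ricci (\<lambda>v. (w v)\<^sup>2 *\<^sub>R g0 v) v c d = \<Lambda> * ((w v)\<^sup>2 *\<^sub>R g0 v) $ c $ d"
    and ode: "\<And>p. p \<in> I \<Longrightarrow> H 0 p * H 0 p * H 4 p = a * p + b"
    and z: "z \<in> U" "a * z $ 3 + b \<noteq> 0"
  shows False
proof -
  interpret conformal_change U g0 w by fact
  define u where "u v = inverse (w v)" for v
  define V where "V = {v \<in> U. a * v $ 3 + b \<noteq> 0}"
  have "open V"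
  proof -
    have "V = U \<inter> {v. a * v $ 3 + b \<noteq> 0}" by (auto simp: V_def)
    moreover have "open {v :: real^4. a * v $ 3 + b \<noteq> 0}"
      by (intro open_Collect_neq continuous_intros)
    ultimately show ?thesis using U by auto
  qed
  have V: "v \<in> U" if "v \<in> V" for v using that by (simp add: V_def)
  have su: "smooth_fun_on U u"
    unfolding u_def[abs_def] by (rule smooth_inverse[OF U smooth_w w_nz])
  have u_nz: "u v \<noteq> 0" if "v \<in> U" for v using w_nz[OF that] by (simp add: u_def)
  have hess: "\<exists>\<mu>. \<forall>c d. pd c (pd d u) v - (\<Sum>m\<in>UNIV. Gm (v $ 3) m c d * pd m u v)
    + u v * St (v $ 3) c d = \<mu> * gt (v $ 3) c d" if "v \<in> U" for v
    using einstein_hessian[OF that ein[OF that]]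
    unfolding u_def[abs_def, symmetric] christoffel_g0[OF that] schouten_g0[OF that] g0_nth
    unfolding u_def .
  note eval = sum_4 Gm_eval St_def gt_def th_defs
  have e33: "pd 3 (pd 3 u) v = 0" and e34: "pd 3 (pd 4 u) v = i / 3 * pd 3 u v"
    and e23: "pd 2 (pd 3 u) v + H 2 (v $ 3) / 6 * pd 3 u v - H 3 (v $ 3) / (4 * i) * pd 4 u v
      - H 3 (v $ 3) / 12 * u v = 0"
    and e22: "pd 2 (pd 2 u) v - (H 3 (v $ 3) / 6 * pd 1 u v + H 3 (v $ 3) * v $ 3 / 6 * pd 2 u v
        + H 0 (v $ 3) * H 3 (v $ 3) / 3 * pd 3 u v - H 1 (v $ 3) * H 3 (v $ 3) / (6 * i) * pd 4 u v)
      + u v * (H 0 (v $ 3) * H 4 (v $ 3) / 6 + H 1 (v $ 3) * H 3 (v $ 3) / 6 - 5 / 72 * H 2 (v $ 3) * H 2 (v $ 3))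
      = H 2 (v $ 3) / (2 * i) * (pd 2 (pd 4 u) v - u v * H 2 (v $ 3) * i / 36)"
    if v: "v \<in> U" for v
  proof -
    obtain \<mu> where \<mu>: "\<And>c d. pd c (pd d u) v - (\<Sum>m\<in>UNIV. Gm (v $ 3) m c d * pd m u v)
      + u v * St (v $ 3) c d = \<mu> * gt (v $ 3) c d" using hess[OF v] by blast
    show "pd 3 (pd 3 u) v = 0" using \<mu>[of 3 3] by (simp add: eval)
    show "pd 3 (pd 4 u) v = i / 3 * pd 3 u v" using \<mu>[of 3 4] by (simp add: eval)
    show "pd 2 (pd 3 u) v + H 2 (v $ 3) / 6 * pd 3 u v - H 3 (v $ 3) / (4 * i) * pd 4 u v
      - H 3 (v $ 3) / 12 * u v = 0"
      using \<mu>[of 2 3] by (simp add: eval algebra_simps)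
    have mu: "pd 2 (pd 4 u) v - u v * H 2 (v $ 3) * i / 36 = - (2/3) * i * \<mu>"
      using \<mu>[of 2 4] by (simp add: eval algebra_simps)
    show "pd 2 (pd 2 u) v - (H 3 (v $ 3) / 6 * pd 1 u v + H 3 (v $ 3) * v $ 3 / 6 * pd 2 u v
        + H 0 (v $ 3) * H 3 (v $ 3) / 3 * pd 3 u v - H 1 (v $ 3) * H 3 (v $ 3) / (6 * i) * pd 4 u v)
      + u v * (H 0 (v $ 3) * H 4 (v $ 3) / 6 + H 1 (v $ 3) * H 3 (v $ 3) / 6 - 5 / 72 * H 2 (v $ 3) * H 2 (v $ 3))
      = H 2 (v $ 3) / (2 * i) * (pd 2 (pd 4 u) v - u v * H 2 (v $ 3) * i / 36)"
      unfolding mu using \<mu>[of 2 2] i by (simp add: eval algebra_simps del: One_nat_def)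
  qed
  have commute: "pd c (pd d f) v = pd d (pd c f) v" if "smooth_fun_on U f" "v \<in> U" for c d f v
    by (rule pd_commute[OF U that])
  note pd_rules = pd_cdivide pd_add pd_diff pd_mult pd_const pd_minus pd_H
  note diff_rules = smooth_intros smooth_H smooth_p su smooth_cdivide[OF U]
  have zero: "pd c f v = 0" if "\<And>v. v \<in> V \<Longrightarrow> f v = 0" "v \<in> V" for c f v
    using pd_cong[OF \<open>open V\<close> that(2), of f "\<lambda>_. 0" c] that(1) by (simp add: pd_const)
  have ode': "H 0 (v $ 3) * H 0 (v $ 3) * H 4 (v $ 3) = a * v $ 3 + b" if "v \<in> U" for v
    by (rule ode[OF UI[OF that]])
  have ode1: "2 * H 0 (v $ 3) * H 1 (v $ 3) * H 4 (v $ 3) + H 0 (v $ 3) * H 0 (v $ 3) * H 5 (v $ 3) = a"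
    if v: "v \<in> U" for v
  proof -
    have "pd 3 (\<lambda>v. H 0 (v $ 3) * H 0 (v $ 3) * H 4 (v $ 3)) v = pd 3 (\<lambda>v. a * v $ 3 + b) v"
      by (rule pd_cong[OF U v]) (rule ode')
    then show ?thesis
      by (simp add: pd_rules differentiableI[OF _ v] diff_rules v algebra_simps del: One_nat_def)
  qed
  have H4: "H 4 (v $ 3) \<noteq> 0" "H 0 (v $ 3) \<noteq> 0" if "v \<in> V" for v
    using ode'[OF V[OF that]] that by (auto simp: V_def)
  have u4: "pd 4 u v = - (i / 3) * u v" if v: "v \<in> V" for v
  proof -
    \<comment> \<open>Differentiate \<open>e23\<close> with respect to \<open>p\<close>; the second derivatives drop out by \<open>e33\<close> and \<open>e34\<close>.\<close>
    let ?f = "\<lambda>v. pd 2 (pd 3 u) v + H 2 (v $ 3) / 6 * pd 3 u v - H 3 (v $ 3) / (4 * i) * pd 4 u v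
      - H 3 (v $ 3) / 12 * u v"
    have "pd 3 (pd 2 (pd 3 u)) v = pd 2 (pd 3 (pd 3 u)) v"
      by (rule commute[OF smooth_pd[OF su] V[OF v]])
    also have "\<dots> = 0" by (rule zero[OF e33[OF V] v])
    finally have "pd 3 ?f v = H 3 (v $ 3) / 6 * pd 3 u v
      - (H 4 (v $ 3) / (4 * i) * pd 4 u v + H 3 (v $ 3) / (4 * i) * (i / 3 * pd 3 u v))
      - (H 4 (v $ 3) / 12 * u v + H 3 (v $ 3) / 12 * pd 3 u v)"
      by (simp add: pd_rules differentiableI[OF _ V[OF v]] diff_rules V[OF v] e33[OF V[OF v]]
          e34[OF V[OF v]] del: One_nat_def) (simp add: i field_simps del: One_nat_def)
    moreover have "pd 3 ?f v = 0" by (rule zero[OF e23[OF V] v])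
    moreover have "H 4 (v $ 3) * (3 * pd 4 u v + i * u v) = - 12 * i * (H 3 (v $ 3) / 6 * pd 3 u v
      - (H 4 (v $ 3) / (4 * i) * pd 4 u v + H 3 (v $ 3) / (4 * i) * (i / 3 * pd 3 u v))
      - (H 4 (v $ 3) / 12 * u v + H 3 (v $ 3) / 12 * pd 3 u v))"
      using i by (simp add: field_simps)
    ultimately have "H 4 (v $ 3) * (3 * pd 4 u v + i * u v) = 0" by simp
    then have "3 * pd 4 u v + i * u v = 0" using H4(1)[OF v] by simp
    then show ?thesis by simp
  qed
  have u3: "pd 3 u v = 0" if v: "v \<in> V" for v
  proof -
    have "pd 3 (pd 4 u) v = pd 3 (\<lambda>v. - (i / 3) * u v) v"
      by (rule pd_cong[OF \<open>open V\<close> v]) (rule u4)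
    also have "\<dots> = - (i / 3) * pd 3 u v"
      by (simp add: pd_rules differentiableI[OF _ V[OF v]] diff_rules del: mult_minus_left)
    finally show ?thesis using e34[OF V[OF v]] i by simp
  qed
  have u3j: "pd 3 (pd c u) v = 0" if v: "v \<in> V" for c v
    using zero[of "pd 3 u" v c, OF u3 v] commute[OF su V[OF v], of 3 c] by simp
  have u3jk: "pd 3 (pd c (pd d u)) v = 0" if v: "v \<in> V" for c d v
    using zero[of "pd 3 (pd d u)" v c, OF u3j v] commute[OF smooth_pd[OF su] V[OF v], of 3 c d] by simp
  have e22': "pd 2 (pd 2 u) v + (H 2 (v $ 3) - H 3 (v $ 3) * v $ 3) / 6 * pd 2 u v - H 3 (v $ 3) / 6 * pd 1 u v
      + (H 0 (v $ 3) * H 4 (v $ 3) / 6 + H 1 (v $ 3) * H 3 (v $ 3) / 9 - H 2 (v $ 3) * H 2 (v $ 3) / 18) * u v = 0"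
    if v: "v \<in> V" for v
  proof -
    have "pd 2 (pd 4 u) v = pd 2 (\<lambda>v. - (i / 3) * u v) v"
      by (rule pd_cong[OF \<open>open V\<close> v]) (rule u4)
    also have "\<dots> = - (i / 3) * pd 2 u v"
      by (simp add: pd_rules differentiableI[OF _ V[OF v]] diff_rules del: mult_minus_left)
    finally have u24: "pd 2 (pd 4 u) v = - (i / 3) * pd 2 u v" .
    have cancel: "x / (6 * i) * (- (i / 3) * y) = - x * y / 18"
      "x / (2 * i) * (- (i / 3) * y - t * x * i / 36) = - x * y / 6 - t * x * x / 72" for x y t
      using i by (simp_all add: field_simps)
    show ?thesis
      using e22[OF V[OF v], unfolded u24 u3[OF v] u4[OF v] cancel] by (simp add: field_simps del: One_nat_def)
  qed
  \<comment> \<open>The \<open>p\<close>-derivative of \<open>e22'\<close>, multiplied by \<open>6 h\<^sup>2\<close> to remove \<open>h''''\<close> and \<open>h'''''\<close> with the equation. As \<open>u\<close>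
    does not depend on \<open>p\<close>, three more derivatives eliminate \<open>\<partial>\<^sub>x u\<close> and \<open>\<partial>\<^sub>y u\<close>.\<close>
  have transport: "- (a * v $ 3 + b) * (pd 1 u v + v $ 3 * pd 2 u v)
      + (a * H 0 (v $ 3) - H 1 (v $ 3) * (a * v $ 3 + b) / 3) * u v = 0" if v: "v \<in> V" for v
  proof -
    have "pd 3 (\<lambda>v. pd 2 (pd 2 u) v + (H 2 (v $ 3) - H 3 (v $ 3) * v $ 3) / 6 * pd 2 u v - H 3 (v $ 3) / 6 * pd 1 u v
      + (H 0 (v $ 3) * H 4 (v $ 3) / 6 + H 1 (v $ 3) * H 3 (v $ 3) / 9 - H 2 (v $ 3) * H 2 (v $ 3) / 18) * u v) v = 0"
      by (rule zero[OF e22' v])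
    then have "- H 4 (v $ 3) / 6 * (pd 1 u v + v $ 3 * pd 2 u v)
      + (5 / 18 * H 1 (v $ 3) * H 4 (v $ 3) + H 0 (v $ 3) * H 5 (v $ 3) / 6) * u v = 0"
      by (simp add: pd_H[OF V[OF v]] u3[OF v] u3j[OF v] u3jk[OF v] pd_cdivide pd_add pd_diff pd_mult pd_const
          differentiableI[OF _ V[OF v]] diff_rules
          del: One_nat_def) (simp add: field_simps del: One_nat_def)
    then have "6 * (H 0 (v $ 3) * H 0 (v $ 3)) * (- H 4 (v $ 3) / 6 * (pd 1 u v + v $ 3 * pd 2 u v)
      + (5 / 18 * H 1 (v $ 3) * H 4 (v $ 3) + H 0 (v $ 3) * H 5 (v $ 3) / 6) * u v) = 0" by simp
    then show ?thesis
      unfolding ode'[OF V[OF v], symmetric] unfolding ode1[OF V[OF v], symmetric]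
      by (simp add: field_simps del: One_nat_def)
  qed
  have t1: "- a * (pd 1 u v + v $ 3 * pd 2 u v) - (a * v $ 3 + b) * pd 2 u v
      + (2 / 3 * a * H 1 (v $ 3) - H 2 (v $ 3) * (a * v $ 3 + b) / 3) * u v = 0" if v: "v \<in> V" for v
  proof -
    have "pd 3 (\<lambda>v. - (a * v $ 3 + b) * (pd 1 u v + v $ 3 * pd 2 u v)
      + (a * H 0 (v $ 3) - H 1 (v $ 3) * (a * v $ 3 + b) / 3) * u v) v = 0"
      by (rule zero[OF transport v])
    then show ?thesis
      by (simp add: pd_H[OF V[OF v]] u3[OF v] u3j[OF v] u3jk[OF v] pd_cdivide pd_add pd_diff pd_mult pd_minus pd_const
          differentiableI[OF _ V[OF v]] diff_rules del: One_nat_def) (simp add: field_simps del: One_nat_def)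
  qed
  have t2: "- 2 * a * pd 2 u v + (a * H 2 (v $ 3) / 3 - H 3 (v $ 3) * (a * v $ 3 + b) / 3) * u v = 0"
    if v: "v \<in> V" for v
  proof -
    have "pd 3 (\<lambda>v. - a * (pd 1 u v + v $ 3 * pd 2 u v) - (a * v $ 3 + b) * pd 2 u v
      + (2 / 3 * a * H 1 (v $ 3) - H 2 (v $ 3) * (a * v $ 3 + b) / 3) * u v) v = 0"
      by (rule zero[OF t1 v])
    then show ?thesis
      by (simp add: pd_H[OF V[OF v]] u3[OF v] u3j[OF v] u3jk[OF v] pd_cdivide pd_add pd_diff pd_mult pd_minus pd_const
          differentiableI[OF _ V[OF v]] diff_rules del: One_nat_def) (simp add: field_simps del: One_nat_def)
  qed
  have t3: "H 4 (v $ 3) * (a * v $ 3 + b) * u v = 0" if v: "v \<in> V" for v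
  proof -
    have "pd 3 (\<lambda>v. - 2 * a * pd 2 u v + (a * H 2 (v $ 3) / 3 - H 3 (v $ 3) * (a * v $ 3 + b) / 3) * u v) v = 0"
      by (rule zero[OF t2 v])
    then show ?thesis
      by (simp add: pd_H[OF V[OF v]] u3[OF v] u3j[OF v] u3jk[OF v] pd_cdivide pd_add pd_diff pd_mult pd_minus pd_const
          differentiableI[OF _ V[OF v]] diff_rules del: One_nat_def mult_eq_0_iff)
  qed
  have "z \<in> V" using z by (simp add: V_def)
  then show False
    using t3[of z] H4[of z] u_nz[of z] z by simp
qed

end

section \<open>Solutions of the fourth-order equation\<close>

lemma pd_coord: "pd j (\<lambda>v. F (v $ j)) = (\<lambda>v. deriv F (v $ j))"
proof
  fix v :: "real^4"
  have "((\<lambda>t. F (v $ j + t)) has_real_derivative D) (at 0) \<longleftrightarrow> (F has_real_derivative D) (at (v $ j))" for D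
    using DERIV_shift[of F D "v $ j" 0] DERIV_shift[of F D 0 "v $ j"] by (simp add: add.commute)
  then have "deriv (\<lambda>t. F (v $ j + t)) 0 = deriv F (v $ j)"
    by (simp add: deriv_def)
  then show "pd j (\<lambda>v. F (v $ j)) v = deriv F (v $ j)"
    unfolding pd_def by (simp add: axis_def)
qed

locale ode_solution =
  fixes a b :: real and h :: "real \<Rightarrow> real" and I :: "real set"
  assumes ab: "a \<noteq> 0 \<or> b \<noteq> 0" and I: "open I"
    and diff: "\<And>n. n < 4 \<Longrightarrow> (deriv ^^ n) h differentiable_on I"
    and ode: "\<And>p. p \<in> I \<Longrightarrow> (h p)\<^sup>2 * (deriv ^^ 4) h p = a * p + b"
begin

lemma DERIV_low:
  assumes "n < 4" "p \<in> I"
  shows "((deriv ^^ n) h has_real_derivative (deriv ^^ Suc n) h p) (at p)"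
proof -
  have "(deriv ^^ n) h differentiable (at p)"
    using diff[OF assms(1)] assms(2) I by (metis at_within_open differentiable_on_def)
  then show ?thesis by (simp add: DERIV_deriv_iff_real_differentiable)
qed

text \<open>A zero \<open>p\<^sub>0\<close> of \<open>h\<close> is a root of \<open>a p + b\<close>, so \<open>h\<^sup>2 h'''' = a (p - p\<^sub>0)\<close> with \<open>a \<noteq> 0\<close>. As \<open>h = O(p - p\<^sub>0)\<close>, the derivative \<open>h''''\<close> is unbounded near \<open>p\<^sub>0\<close>, while the mean value theorem finds points near \<open>p\<^sub>0\<close> at
  which it is close to its value at \<open>p\<^sub>0\<close>.\<close>

lemma h_nonzero:
  assumes p0: "p0 \<in> I" shows "h p0 \<noteq> 0"
proof
  assume h0: "h p0 = 0"
  let ?k = "(deriv ^^ 3) h" and ?c = "(deriv ^^ 4) h p0"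
  have root: "a * p0 + b = 0" using ode[OF p0] h0 by simp
  then have a: "a \<noteq> 0" using ab by auto
  have dk: "(?k has_real_derivative (deriv ^^ 4) h p) (at p)" if "p \<in> I" for p
    using DERIV_low[of 3 p] that by (simp add: eval_nat_numeral)
  have dh: "(h has_real_derivative deriv h p0) (at p0)"
    using DERIV_low[of 0 p0] p0 by simp
  define K where "K = \<bar>deriv h p0\<bar> + 1"
  obtain d1 where d1: "d1 > 0" "\<And>p. p \<noteq> p0 \<Longrightarrow> \<bar>p - p0\<bar> < d1 \<Longrightarrow> \<bar>(h p - h p0) / (p - p0) - deriv h p0\<bar> < 1"
    using dh[unfolded has_field_derivative_iff LIM_def dist_real_def, rule_format, of 1] by auto
  obtain d2 where d2: "d2 > 0" "\<And>p. p \<noteq> p0 \<Longrightarrow> \<bar>p - p0\<bar> < d2 \<Longrightarrow> \<bar>(?k p - ?k p0) / (p - p0) - ?c\<bar> < 1"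
    using dk[OF p0, unfolded has_field_derivative_iff LIM_def dist_real_def, rule_format, of 1] by auto
  obtain d3 where d3: "d3 > 0" "\<And>p. \<bar>p - p0\<bar> < d3 \<Longrightarrow> p \<in> I"
    using I p0 unfolding open_dist dist_real_def by blast
  define d4 where "d4 = \<bar>a\<bar> / (K\<^sup>2 * (\<bar>?c\<bar> + 1))"
  have K: "K > 0" by (simp add: K_def)
  have d4: "d4 > 0" using a K unfolding d4_def by (intro divide_pos_pos mult_pos_pos) auto
  define t where "t = min (min d1 d2) (min d3 d4) / 2"
  have t: "0 < t" "t < d1" "t < d2" "t < d3" "t < d4"
    using d1(1) d2(1) d3(1) d4 unfolding t_def by linarith+
  have "\<exists>z>p0. z < p0 + t \<and> ?k (p0 + t) - ?k p0 = (p0 + t - p0) * (deriv ^^ 4) h z"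
    by (rule MVT2) (use t d3(2) dk in auto)
  then obtain z where z: "p0 < z" "z < p0 + t" "?k (p0 + t) - ?k p0 = t * (deriv ^^ 4) h z" by auto
  have "\<bar>(deriv ^^ 4) h z - ?c\<bar> < 1"
    using d2(2)[of "p0 + t"] t z(3) by simp
  then have kz: "\<bar>(deriv ^^ 4) h z\<bar> < \<bar>?c\<bar> + 1" by linarith
  have "\<bar>h z / (z - p0) - deriv h p0\<bar> < 1"
    using d1(2)[of z] z t h0 by simp
  then have "\<bar>h z / (z - p0)\<bar> < K" unfolding K_def by linarith
  then have hz: "\<bar>h z\<bar> < K * (z - p0)" using z(1) by (simp add: field_simps)
  have "a * (z - p0) = (h z)\<^sup>2 * (deriv ^^ 4) h z"
    using ode[of z] d3(2)[of z] z t root by (simp add: algebra_simps)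
  then have "\<bar>a\<bar> * (z - p0) = \<bar>h z\<bar>\<^sup>2 * \<bar>(deriv ^^ 4) h z\<bar>"
    using z(1) by (metis abs_mult abs_of_pos diff_gt_0_iff_gt power2_abs power_abs)
  also have "\<dots> \<le> (K * (z - p0))\<^sup>2 * (\<bar>?c\<bar> + 1)"
    using hz kz by (intro mult_mono power_mono) auto
  finally have "\<bar>a\<bar> * (z - p0) \<le> (K\<^sup>2 * (\<bar>?c\<bar> + 1) * (z - p0)) * (z - p0)"
    by (simp add: power2_eq_square mult_ac)
  then have "\<bar>a\<bar> \<le> K\<^sup>2 * (\<bar>?c\<bar> + 1) * (z - p0)" using z(1) by simp
  also have "\<dots> < K\<^sup>2 * (\<bar>?c\<bar> + 1) * d4"
    using K z t by (intro mult_strict_left_mono mult_pos_pos) auto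
  also have "\<dots> = \<bar>a\<bar>" using K by (simp add: d4_def)
  finally show False by simp
qed

text \<open>The algebra generated by \<open>p\<close>, \<open>1/h\<close> and the derivatives of \<open>h\<close> of order below four is closed under
  differentiation, since \<open>h'''' = (a p + b) / h\<^sup>2\<close>. The function is read in the third coordinate so that the
  smoothness criterion for functions of four variables applies.\<close>

lemma smooth_h:
  defines "W \<equiv> {v :: real^4. v $ 3 \<in> I}"
  shows "open W" "smooth_fun_on W (\<lambda>v. h (v $ 3))"
proof -
  show W: "open W"
    unfolding W_def using open_vimage_vec_nth[OF I, of 3] by (simp add: vimage_def)
  let ?S = "(\<lambda>n (v::real^4). (deriv ^^ n) h (v $ 3)) ` {..<4} \<union> {\<lambda>v. v $ 3, \<lambda>v. inverse (h (v $ 3))}"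
  have coord: "(\<lambda>v::real^4. v $ 3) differentiable (at v)" for v
    by (rule bounded_linear_imp_differentiable[OF bounded_linear_vec_nth])
  have low: "(\<lambda>v::real^4. (deriv ^^ n) h (v $ 3)) differentiable (at v)" if "n < 4" "v \<in> W" for n v
    by (rule differentiable_compose[of "(deriv ^^ n) h", OF _ coord])
      (use DERIV_low[OF that(1), of "v $ 3"] that(2) in \<open>auto simp: W_def real_differentiable_def\<close>)
  have h: "(\<lambda>v::real^4. h (v $ 3)) differentiable (at v)" if "v \<in> W" for v
    using low[of 0 v] that by simp
  have nz: "h (v $ 3) \<noteq> 0" if "v \<in> W" for v using h_nonzero that by (simp add: W_def)
  have mem: "(\<lambda>v. (deriv ^^ n) h (v $ 3)) \<in> fun_alg ?S" if "n < 4" for n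
    by (rule fun_alg.base) (use that in auto)
  have inv: "(\<lambda>v. inverse (h (v $ 3))) \<in> fun_alg ?S" and id: "(\<lambda>v. v $ 3) \<in> fun_alg ?S"
    by (rule fun_alg.base, simp)+
  have "(\<lambda>v. h (v $ 3)) \<in> fun_alg ?S" using mem[of 0] by simp
  with W show "smooth_fun_on W (\<lambda>v. h (v $ 3))"
  proof (rule smooth_fun_alg)
    fix f and k :: 4 assume f: "f \<in> ?S"
    show "f differentiable_on W"
      unfolding differentiable_on_def
    proof
      fix v assume v: "v \<in> W"
      have "f differentiable (at v)"
        using f low[OF _ v] coord differentiable_inverse[OF h[OF v] nz[OF v]] by auto
      then show "f differentiable (at v within W)" by (rule differentiable_at_withinI)
    qed
    let ?one = "if k = 3 then 1 else (0::real)"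
    have "(\<exists>n<4. f = (\<lambda>v. (deriv ^^ n) h (v $ 3))) \<or> f = (\<lambda>v. v $ 3) \<or> f = (\<lambda>v. inverse (h (v $ 3)))"
      using f by blast
    moreover have "n < 3 \<or> n = 3" if "n < 4" for n :: nat using that by linarith
    ultimately consider n where "n < 3" "f = (\<lambda>v. (deriv ^^ n) h (v $ 3))" | "f = (\<lambda>v. (deriv ^^ 3) h (v $ 3))"
      | "f = (\<lambda>v. v $ 3)" | "f = (\<lambda>v. inverse (h (v $ 3)))"
      by metis
    then show "\<exists>f'\<in>fun_alg ?S. \<forall>v\<in>W. pd k f v = f' v"
    proof cases
      case 1
      show ?thesis
      proof (rule bexI[OF _ fun_alg.mult[OF fun_alg.const[of ?one] mem[of "Suc n"]]], rule ballI)
        fix v assume "v \<in> W"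
        then show "pd k f v = ?one * (deriv ^^ Suc n) h (v $ 3)"
          unfolding 1(2) using 1(1) DERIV_low[of n "v $ 3"]
          by (subst pd_coord_fun[where F' = "(deriv ^^ Suc n) h"]) (auto simp: W_def)
      qed (use 1 in simp)
    next
      case 2
      have alg: "(\<lambda>v. ?one * ((a * v $ 3 + b) * (inverse (h (v $ 3)) * inverse (h (v $ 3))))) \<in> fun_alg ?S"
        by (rule fun_alg.mult[OF fun_alg.const fun_alg.mult[OF fun_alg.add[OF fun_alg.mult[OF fun_alg.const id]
                fun_alg.const] fun_alg.mult[OF inv inv]]])
      show ?thesis
      proof (rule bexI[OF _ alg], rule ballI)
        fix v assume v: "v \<in> W"
        then have p: "v $ 3 \<in> I" by (simp add: W_def)
        have "(deriv ^^ 4) h (v $ 3) = (a * v $ 3 + b) * (inverse (h (v $ 3)) * inverse (h (v $ 3)))"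
          using ode[OF p] h_nonzero[OF p] by (simp add: field_simps power2_eq_square)
        moreover have "pd k f v = ?one * (deriv ^^ 4) h (v $ 3)"
          unfolding 2 using DERIV_low[of 3, OF _ p]
          by (subst pd_coord_fun[where F' = "(deriv ^^ 4) h"]) (auto simp: eval_nat_numeral)
        ultimately show "pd k f v = ?one * ((a * v $ 3 + b) * (inverse (h (v $ 3)) * inverse (h (v $ 3))))"
          by simp
      qed
    next
      case 3
      show ?thesis
        by (rule bexI[OF _ fun_alg.const[of ?one]])
          (auto simp: 3 pd_coord_fun[where F = "\<lambda>p. p" and F' = "\<lambda>_. 1"])
    next
      case 4
      have alg: "(\<lambda>v. (- ?one * (deriv ^^ 1) h (v $ 3)) * (inverse (h (v $ 3)) * inverse (h (v $ 3)))) \<in> fun_alg ?S"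
        by (rule fun_alg.mult[OF fun_alg.mult[OF fun_alg.const mem[of 1]] fun_alg.mult[OF inv inv]]) simp
      show ?thesis
      proof (rule bexI[OF _ alg], rule ballI)
        fix v assume v: "v \<in> W"
        then have "pd k (\<lambda>v. h (v $ 3)) v = ?one * (deriv ^^ 1) h (v $ 3)"
          using DERIV_low[of 0 "v $ 3"]
          by (subst pd_coord_fun[where F' = "(deriv ^^ 1) h"]) (auto simp: W_def)
        then show "pd k f v = (- ?one * (deriv ^^ 1) h (v $ 3)) * (inverse (h (v $ 3)) * inverse (h (v $ 3)))"
          unfolding 4 by (subst pd_inverse[OF h[OF v] nz[OF v]]) simp
      qed
    qed
  qed
qed

lemma DERIV_all:
  assumes p: "p \<in> I"
  shows "((deriv ^^ n) h has_real_derivative (deriv ^^ Suc n) h p) (at p)"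
proof -
  let ?W = "{v :: real^4. v $ 3 \<in> I}"
  have iter: "foldr pd (replicate n 3) (\<lambda>v. h (v $ 3)) = (\<lambda>v. (deriv ^^ n) h (v $ 3))" for n
    by (induction n) (simp_all add: pd_coord)
  have "(\<lambda>v::real^4. (deriv ^^ n) h (v $ 3)) differentiable_on ?W"
    using smooth_h(2) unfolding smooth_fun_on_def iter[symmetric] by blast
  moreover have "p *\<^sub>R axis 3 1 \<in> ?W" using p by simp
  ultimately have "(\<lambda>v::real^4. (deriv ^^ n) h (v $ 3)) differentiable (at (p *\<^sub>R axis 3 1))"
    using differentiable_on_open_at smooth_h(1) by blast
  then have "(\<lambda>t::real. (deriv ^^ n) h ((t *\<^sub>R axis 3 1 :: real^4) $ 3)) differentiable (at p)"
    by (rule differentiable_compose)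
      (intro bounded_linear_imp_differentiable bounded_linear_scaleR_left)
  then have "(deriv ^^ n) h differentiable (at p)" by (simp add: axis_def)
  then show ?thesis by (simp add: DERIV_deriv_iff_real_differentiable)
qed

end

section \<open>The conformal class\<close>

lemma ricci_cong:
  assumes U: "open U" and eq: "\<And>v. v \<in> U \<Longrightarrow> g v = g' v" and v: "v \<in> U"
  shows "ricci g v c d = ricci g' v c d"
proof -
  have \<Gamma>: "christoffel g u k x y = christoffel g' u k x y" if u: "u \<in> U" for u k x y
  proof -
    have "pd l (\<lambda>u. g u $ m $ n) u = pd l (\<lambda>u. g' u $ m $ n) u" for l m n
      by (rule pd_cong[OF U u]) (simp add: eq)
    then show ?thesis by (simp add: christoffel_def ginv_def eq[OF u])
  qed
  have "pd l (\<lambda>u. christoffel g u k x y) v = pd l (\<lambda>u. christoffel g' u k x y) v" for l k x y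
    by (rule pd_cong[OF U v]) (rule \<Gamma>)
  then show ?thesis by (simp add: ricci_def riemann_up_def \<Gamma>[OF v])
qed

context frame_metric
begin

lemma split_signature_g0:
  assumes r: "r \<noteq> 0" shows "split_signature (r\<^sup>2 *\<^sub>R g0 v)"
proof -
  let ?p = "v $ 3"
  \<comment> \<open>The columns are the orthonormal basis \<open>e\<^sub>1 + e\<^sub>3/2\<close>, \<open>e\<^sub>2 - e\<^sub>4/2\<close>, \<open>e\<^sub>1 - e\<^sub>3/2\<close>, \<open>e\<^sub>2 + e\<^sub>4/2\<close>.\<close>
  define P :: "real^4^4" where "P = (\<chi> a. \<chi> j. sel4 (e1 ?p a + e3 ?p a / 2) (e2 ?p a - e4 ?p a / 2)
    (e1 ?p a - e3 ?p a / 2) (e2 ?p a + e4 ?p a / 2) j)"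
  define Q where "Q = inverse r *\<^sub>R P"
  let ?D = "(\<chi> a b. if a = b then (if a = 1 \<or> a = 2 then 1 else - 1) else 0) :: real^4^4"
  have "\<forall>a b. (\<Sum>k\<in>UNIV. (\<Sum>m\<in>UNIV. P $ m $ a * gt ?p m k) * P $ k $ b) = ?D $ a $ b"
    unfolding forall_4
    by (intro conjI) (simp_all add: P_def sum_4 gt_def e_defs th_defs i field_simps del: One_nat_def)
  then have "transpose P ** g0 v ** P = ?D"
    by (simp add: vec_eq_iff matrix_matrix_mult_def transpose_def g0_nth)
  moreover have "transpose Q ** (r\<^sup>2 *\<^sub>R g0 v) ** Q = transpose P ** g0 v ** P"
  proof -
    have "transpose Q = inverse r *\<^sub>R transpose P" by (simp add: Q_def transpose_def vec_eq_iff)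
    moreover have "inverse r * (r * r) * inverse r = 1" using r by (simp add: field_simps)
    ultimately show ?thesis
      by (simp add: Q_def scaleR_matrix_mult power2_eq_square)
  qed
  ultimately have D: "transpose Q ** (r\<^sup>2 *\<^sub>R g0 v) ** Q = ?D" by simp
  have "?D ** ?D = mat 1"
    by (simp add: vec_eq_iff forall_4 matrix_matrix_mult_def mat_def sum_4)
  then have "(?D ** (transpose Q ** (r\<^sup>2 *\<^sub>R g0 v))) ** Q = mat 1"
    using D by (simp add: matrix_mul_assoc[symmetric])
  then have "invertible Q" unfolding invertible_left_inverse by blast
  moreover have "transpose (r\<^sup>2 *\<^sub>R g0 v) = r\<^sup>2 *\<^sub>R g0 v"
    by (simp add: vec_eq_iff transpose_def g0_nth gt_def mult_ac)
  ultimately show ?thesis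
    unfolding split_signature_def using D by blast
qed

lemma conformal_changeI:
  assumes "smooth_fun_on U w" "\<And>v. v \<in> U \<Longrightarrow> w v \<noteq> 0"
  shows "conformal_change U g0 w"
  by unfold_locales (use assms in auto)

text \<open>\<open>al2\<close> is a multiple of the second derivative of the affine function \<open>h\<^sup>2 h''''\<close>.\<close>

lemma bach_zero:
  assumes w: "smooth_fun_on U w" "\<And>v. v \<in> U \<Longrightarrow> w v \<noteq> 0"
    and ode: "\<And>p. p \<in> I \<Longrightarrow> H 0 p * H 0 p * H 4 p = a * p + b" and v: "v \<in> U"
  shows "bach (\<lambda>v. (w v)\<^sup>2 *\<^sub>R g0 v) v c d = 0"
proof -
  interpret conformal_change U g0 w by (rule conformal_changeI[OF w])
  interpret conformal_change_weyl U g0 w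
    by unfold_locales (auto intro: weyl_symmetric_g0 weyl_trace_g0)
  have uniq: "F' p = G' p" if "\<And>p. p \<in> I \<Longrightarrow> (F has_real_derivative F' p) (at p)"
    "\<And>p. p \<in> I \<Longrightarrow> (G has_real_derivative G' p) (at p)" "\<And>p. p \<in> I \<Longrightarrow> F p = G p" "p \<in> I"
    for F F' G G' and p :: real
    using DERIV_unique has_field_derivative_transform_within_open[OF that(1)[OF that(4)] I that(4) that(3)]
      that(2)[OF that(4)] by blast
  have "al1 p = a / 6" if "p \<in> I" for p
    by (rule uniq[OF coefficients_deriv(1) _ _ that, where G = "\<lambda>p. (a * p + b) / 6"])
      (auto simp: al_def ode intro!: derivative_eq_intros)
  then have "al2 p = 0" if "p \<in> I" for p
    by (intro uniq[OF coefficients_deriv(2) _ _ that, where G = "\<lambda>p. a / 6"]) auto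
  then show ?thesis
    unfolding bach_gh[OF v] bach_g0[OF v] using UI[OF v] by simp
qed

lemma type_NN':
  assumes w: "smooth_fun_on U w" "\<And>v. v \<in> U \<Longrightarrow> w v \<noteq> 0" and v: "v \<in> U"
    and "H 0 (v $ 3) \<noteq> 0" "H 4 (v $ 3) \<noteq> 0"
  shows "type_NN' (\<lambda>v. (w v)\<^sup>2 *\<^sub>R g0 v) v"
proof -
  interpret conformal_change U g0 w by (rule conformal_changeI[OF w])
  interpret frame_metric_point U I i H "\<lambda>v. (w v)\<^sup>2 *\<^sub>R g0 v" v "w v"
    by unfold_locales (use w(2) v in \<open>auto simp: weyl_gh weyl_g0\<close>)
  show ?thesis by (rule type_NN'_gh) fact+
qed

end

lemma gF_frame:
  assumes "frame_metric U I i (\<lambda>n. (deriv ^^ n) h)"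
  shows "gF i h w v = (w v)\<^sup>2 *\<^sub>R frame_metric.g0 i (\<lambda>n. (deriv ^^ n) h) v"
proof -
  interpret frame_metric U I i "\<lambda>n. (deriv ^^ n) h" by fact
  show ?thesis
    unfolding vec_eq_iff forall_4 gF_def Let_def sym_prod_def
    by (simp add: g0_nth gt_def th_defs axis_def field_simps)
qed

lemma open_avoids_zero:
  assumes "open (U :: (real^4) set)" "U \<noteq> {}" "a \<noteq> 0 \<or> b \<noteq> 0"
  obtains z where "z \<in> U" "a * z $ 3 + b \<noteq> 0"
proof -
  obtain v where v: "v \<in> U" using assms(2) by blast
  obtain d where d: "d > 0" "\<And>t. \<bar>t\<bar> < d \<Longrightarrow> v + t *\<^sub>R axis 3 1 \<in> U"
    using eventually_line_in[OF assms(1) v, of "axis 3 1"] unfolding eventually_nhds_metric dist_real_def by auto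
  show ?thesis
  proof (cases "a * v $ 3 + b = 0")
    case True
    then have "a \<noteq> 0" using assms(3) by auto
    have "a * (v + (d / 2) *\<^sub>R axis 3 1) $ 3 + b = a * (d / 2)"
      using True by (simp add: axis_def algebra_simps)
    then have "a * (v + (d / 2) *\<^sub>R axis 3 1) $ 3 + b \<noteq> 0"
      using \<open>a \<noteq> 0\<close> d(1) by (simp only:) simp
    with d show ?thesis
      by (intro that[of "v + (d / 2) *\<^sub>R axis 3 1"]) auto
  qed (use v that in blast)
qed

theorem mainTheorem4:
  fixes a b i :: real and h :: "real \<Rightarrow> real" and I :: "real set"
    and U :: "(real^4) set" and \<rho> :: "real^4 \<Rightarrow> real"
  assumes "i \<noteq> 0"
    and "a \<noteq> 0 \<or> b \<noteq> 0"
    and "open I"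
    and "\<forall>n<4. (deriv ^^ n) h differentiable_on I"
    and "\<forall>p\<in>I. (h p)\<^sup>2 * (deriv ^^ 4) h p = a * p + b"
    and "open U" and "U \<noteq> {}" and "\<forall>v\<in>U. v $ 3 \<in> I"
    and "smooth_fun_on U \<rho>" and "\<forall>v\<in>U. \<rho> v \<noteq> 0"
  shows "split_metric_on U (gF i h \<rho>) \<and>
    (\<forall>g. conformal_on U (gF i h \<rho>) g \<longleftrightarrow>
       (\<exists>\<sigma>. smooth_fun_on U \<sigma> \<and> (\<forall>v\<in>U. \<sigma> v \<noteq> 0) \<and> (\<forall>v\<in>U. g v = gF i h \<sigma> v))) \<and>
    (\<forall>v\<in>U. \<forall>c d. bach (gF i h \<rho>) v c d = 0) \<and>
    (\<forall>v\<in>U. a * v $ 3 + b \<noteq> 0 \<longrightarrow> type_NN' (gF i h \<rho>) v) \<and>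
    \<not> conformal_to_einstein_on U (gF i h \<rho>)"
proof -
  interpret ode_solution a b h I
    by unfold_locales (use assms in auto)
  interpret frame_metric U I i "\<lambda>n. (deriv ^^ n) h"
    by unfold_locales (use assms DERIV_all in auto)
  have gF: "gF i h w v = (w v)\<^sup>2 *\<^sub>R g0 v" for w v
    by (rule gF_frame) unfold_locales
  have gF_fun: "gF i h w = (\<lambda>v. (w v)\<^sup>2 *\<^sub>R g0 v)" for w
    using gF by blast
  have \<rho>: "smooth_fun_on U \<rho>" "\<And>v. v \<in> U \<Longrightarrow> \<rho> v \<noteq> 0"
    using assms by auto
  interpret conformal_change U g0 \<rho> by (rule conformal_changeI[OF \<rho>])
  have ode0: "(deriv ^^ 0) h p * (deriv ^^ 0) h p * (deriv ^^ 4) h p = a * p + b" if "p \<in> I" for p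
    using ode[OF that] by (simp add: power2_eq_square)
  have split: "split_metric_on U (gF i h \<rho>)"
    unfolding split_metric_on_def gF_fun
    using smooth_gh \<rho>(2) by (auto intro: split_signature_g0)
  have conf: "conformal_on U (gF i h \<rho>) g \<longleftrightarrow>
      (\<exists>\<sigma>. smooth_fun_on U \<sigma> \<and> (\<forall>v\<in>U. \<sigma> v \<noteq> 0) \<and> (\<forall>v\<in>U. g v = gF i h \<sigma> v))" for g
  proof
    assume "conformal_on U (gF i h \<rho>) g"
    then obtain \<Omega> where "smooth_fun_on U \<Omega>" "\<forall>v\<in>U. \<Omega> v \<noteq> 0" "\<forall>v\<in>U. g v = (\<Omega> v)\<^sup>2 *\<^sub>R gF i h \<rho> v"
      unfolding conformal_on_def by blast
    then show "\<exists>\<sigma>. smooth_fun_on U \<sigma> \<and> (\<forall>v\<in>U. \<sigma> v \<noteq> 0) \<and> (\<forall>v\<in>U. g v = gF i h \<sigma> v)"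
      using \<rho> by (intro exI[of _ "\<lambda>v. \<Omega> v * \<rho> v"]) (auto simp: gF power_mult_distrib intro: smooth_mult U)
  next
    assume "\<exists>\<sigma>. smooth_fun_on U \<sigma> \<and> (\<forall>v\<in>U. \<sigma> v \<noteq> 0) \<and> (\<forall>v\<in>U. g v = gF i h \<sigma> v)"
    then obtain \<sigma> where "smooth_fun_on U \<sigma>" "\<forall>v\<in>U. \<sigma> v \<noteq> 0" "\<forall>v\<in>U. g v = gF i h \<sigma> v" by blast
    then show "conformal_on U (gF i h \<rho>) g"
      unfolding conformal_on_def using \<rho>
      by (intro exI[of _ "\<lambda>v. \<sigma> v / \<rho> v"]) (auto simp: gF power_divide intro: smooth_divide U)
  qed
  have bach: "bach (gF i h \<rho>) v c d = 0" if "v \<in> U" for v c d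
    unfolding gF_fun by (rule bach_zero[OF \<rho> ode0 that])
  have typeN: "type_NN' (gF i h \<rho>) v" if v: "v \<in> U" "a * v $ 3 + b \<noteq> 0" for v
  proof -
    have p: "v $ 3 \<in> I" by (rule UI[OF v(1)])
    show ?thesis
      unfolding gF_fun by (rule type_NN'[OF \<rho> v(1)]) (use ode[OF p] h_nonzero[OF p] v(2) in auto)
  qed
  have "\<not> conformal_to_einstein_on U (gF i h \<rho>)"
  proof
    assume "conformal_to_einstein_on U (gF i h \<rho>)"
    then obtain g' \<Lambda> where g': "conformal_on U (gF i h \<rho>) g'"
      and ein: "\<And>v c d. v \<in> U \<Longrightarrow> ricci g' v c d = \<Lambda> * g' v $ c $ d"
      unfolding conformal_to_einstein_on_def einstein_on_def by blast
    obtain \<sigma> where \<sigma>: "smooth_fun_on U \<sigma>" "\<And>v. v \<in> U \<Longrightarrow> \<sigma> v \<noteq> 0" "\<And>v. v \<in> U \<Longrightarrow> g' v = gF i h \<sigma> v"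
      using g' unfolding conf by blast
    obtain z where z: "z \<in> U" "a * z $ 3 + b \<noteq> 0"
      using open_avoids_zero assms by blast
    have "ricci (\<lambda>v. (\<sigma> v)\<^sup>2 *\<^sub>R g0 v) v c d = \<Lambda> * ((\<sigma> v)\<^sup>2 *\<^sub>R g0 v) $ c $ d" if "v \<in> U" for v c d
      using ein[OF that, of c d] ricci_cong[of U g' "gF i h \<sigma>" v c d, OF U \<sigma>(3) that] \<sigma>(3)[OF that]
      unfolding gF_fun by simp
    from not_einstein[OF conformal_changeI[OF \<sigma>(1,2)] this ode0 z] show False .
  qed
  then show ?thesis using split conf bach typeN by blast
qed

end
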